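(* Let $(M,d)$ be a separable, geodesic, $\delta$-hyperbolic space, $o\in M$, and $\mu$ a non-elementary probability measure on $G=\mathrm{Isom}(M)$ with countable bounded support $S$. Let $\check\nu$ be a $\mu^{-1}$-stationary probability measure on $\overline{M}^h$, and let $\psi(x)=-2\int_{\overline{M}^h}(x|y)_o\,d\check\nu(y)$ for $x\in\overline{M}^h$. Denoting $\kappa_S=\sup_{g\in S}d(go,o)$ and $\mathfrak{c}=-\inf_{x\in\overline{M}^h}\psi(x)$, for every $t>0$ and $n\in\mathbb{N}$, we have $$\sup_{\xi\in\overline{M}^h}\mathbb{P}\left(|\sigma(L_n,\xi)-n\ell(\mu)|\geq nt\right)\leq 2\exp\left(-\frac{nt^2}{32(\kappa_S+\mathfrak{c})^2}\right).$$ In particular, $$\mathbb{P}\left(|\kappa(L_n)-n\ell(\mu)|\geq nt\right)\leq 2\exp\left(-\frac{nt^2}{32(\kappa_S+\mathfrak{c})^2}\right).$$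
   Context: $M$ is $\delta$-hyperbolic if $(x|y)_o\geq\min\{(x|z)_o,(z|y)_o\}-\delta$ for all $x,y,z,o\in M$, where $(x|y)_o=\frac12(d(x,o)+d(y,o)-d(x,y))$. An isometry $\gamma$ is loxodromic if $(\gamma^nx)_{n\in\mathbb{Z}}$ is a quasi-geodesic for any $x \in M$; it then fixes exactly two points of the Gromov boundary; two loxodromic elements are independent if their fixed point pairs are disjoint. $\mu$ is non-elementary if the semigroup generated by its support contains two independent loxodromic elements. For $x\in M$ let $h_x(m)=d(x,m)-d(x,o)$. The horofunction compactification $\overline{M}^h$ is the closure of $\{h_x:x\in M\}$ in the space of $1$-Lipschitz real functions on $M$ vanishing at $o$, with the topology of pointwise convergence; it is compact metrizable, and $M$ is identified with its image via $x\mapsto h_x$. $\mathrm{Isom}(M)$ acts on it by $(g.h)(m)=h(g^{-1}m)-h(g^{-1}o)$. The Busemann cocycle is $\sigma(g,h)=h(g^{-1}o)$. For $h_1,h_2\in\overline{M}^h$, $(h_1|h_2)_o=-\frac12\inf_{m\in M}(h_1(m)+h_2(m))$, which extends the Gromov product on $M$. $\kappa(g)=d(go,o)$; $S$ is bounded if $\kappa_S<\infty$. $\mu^{-1}$ is the image of $\mu$ under $g\mapsto g^{-1}$. A probability measure $\nu$ on a space with a $G$-action is $\mu$-stationary if $\iint\phi(gx)\,d\mu(g)\,d\nu(x)=\int\phi\,d\nu$ for bounded measurable $\phi$. $(X_i)$ are i.i.d. with law $\mu$, $L_n=X_n\cdots X_1$, and $\ell(\mu)$ is the drift, i.e. the a.s.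 limit of $\frac1n\kappa(X_1\cdots X_n)$. *)

theory Defs
  imports "HOL-Probability.Probability"
begin

text \<open>The space \<open>M\<close> is the type \<open>'a\<close>; throughout, \<open>p\<close> is the base point.\<close>

section \<open>Hyperbolic spaces and isometries\<close>

definition gromov_product :: "'a::metric_space \<Rightarrow> 'a \<Rightarrow> 'a \<Rightarrow> real" where
  "gromov_product p x y = (dist x p + dist y p - dist x y) / 2"

definition hyperbolic :: "real \<Rightarrow> 'a::metric_space itself \<Rightarrow> bool" where
  "hyperbolic \<delta> (_ :: 'a itself) \<longleftrightarrow>
     (\<forall>x y z p :: 'a. gromov_product p x y \<ge> min (gromov_product p x z) (gromov_product p z y) - \<delta>)"

definition geodesic_space :: "'a::metric_space itself \<Rightarrow> bool" where
  "geodesic_space (_ :: 'a itself) \<longleftrightarrow>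
     (\<forall>x y :: 'a. \<exists>c :: real \<Rightarrow> 'a. c 0 = x \<and> c (dist x y) = y \<and>
        (\<forall>s\<in>{0..dist x y}. \<forall>t\<in>{0..dist x y}. dist (c s) (c t) = \<bar>s - t\<bar>))"

definition Isom :: "('a::metric_space \<Rightarrow> 'a) set" where
  "Isom = {g. surj g \<and> (\<forall>x y. dist (g x) (g y) = dist x y)}"

definition int_iterate :: "('a \<Rightarrow> 'a) \<Rightarrow> int \<Rightarrow> 'a \<Rightarrow> 'a" where
  "int_iterate g n = (if 0 \<le> n then g ^^ nat n else inv g ^^ nat (- n))"

definition quasi_geodesic :: "(int \<Rightarrow> 'a::metric_space) \<Rightarrow> bool" where
  "quasi_geodesic c \<longleftrightarrow>
     (\<exists>A\<ge>1. \<exists>B\<ge>0. \<forall>m n. \<bar>real_of_int (m - n)\<bar> / A - B \<le> dist (c m) (c n) \<and>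
                          dist (c m) (c n) \<le> A * \<bar>real_of_int (m - n)\<bar> + B)"

definition loxodromic :: "('a::metric_space \<Rightarrow> 'a) \<Rightarrow> bool" where
  "loxodromic g \<longleftrightarrow> g \<in> Isom \<and> (\<forall>x. quasi_geodesic (\<lambda>n. int_iterate g n x))"

section \<open>Gromov boundary\<close>

text \<open>Since \<open>M\<close> need not be proper, boundary points are classes of sequences
  converging at infinity. For a hyperbolic space neither the sequences nor the classes depend on
  the base point.\<close>

definition seq_to_infinity :: "'a::metric_space \<Rightarrow> (nat \<Rightarrow> 'a) \<Rightarrow> (nat \<Rightarrow> 'a) \<Rightarrow> bool" where
  "seq_to_infinity p u v \<longleftrightarrow>
     filterlim (\<lambda>(m, n). gromov_product p (u m) (v n)) at_top (sequentially \<times>\<^sub>F sequentially)"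

definition gromov_sequences :: "'a::metric_space \<Rightarrow> (nat \<Rightarrow> 'a) set" where
  "gromov_sequences p = {u. seq_to_infinity p u u}"

definition gromov_boundary :: "'a::metric_space \<Rightarrow> (nat \<Rightarrow> 'a) set set" where
  "gromov_boundary p =
     gromov_sequences p //
       {(u, v). u \<in> gromov_sequences p \<and> v \<in> gromov_sequences p \<and> seq_to_infinity p u v}"

definition boundary_fixed_points :: "'a::metric_space \<Rightarrow> ('a \<Rightarrow> 'a) \<Rightarrow> (nat \<Rightarrow> 'a) set set" where
  "boundary_fixed_points p g = {\<xi> \<in> gromov_boundary p. (\<lambda>u. g \<circ> u) ` \<xi> = \<xi>}"

definition independent_loxodromics :: "'a::metric_space \<Rightarrow> ('a \<Rightarrow> 'a) \<Rightarrow> ('a \<Rightarrow> 'a) \<Rightarrow> bool" where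
  "independent_loxodromics p g h \<longleftrightarrow>
     loxodromic g \<and> loxodromic h \<and> boundary_fixed_points p g \<inter> boundary_fixed_points p h = {}"

inductive_set generated_semigroup :: "('a \<Rightarrow> 'a) set \<Rightarrow> ('a \<Rightarrow> 'a) set" for S where
  generator: "g \<in> S \<Longrightarrow> g \<in> generated_semigroup S"
| composition: "g \<in> generated_semigroup S \<Longrightarrow> h \<in> generated_semigroup S
                  \<Longrightarrow> g \<circ> h \<in> generated_semigroup S"

text \<open>A probability measure with countable support is a probability mass function.\<close>

definition non_elementary :: "'a::metric_space \<Rightarrow> ('a \<Rightarrow> 'a) pmf \<Rightarrow> bool" where
  "non_elementary p \<mu> \<longleftrightarrow>
     (\<exists>g\<in>generated_semigroup (set_pmf \<mu>). \<exists>h\<in>generated_semigroup (set_pmf \<mu>).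
        independent_loxodromics p g h)"

section \<open>Horofunction compactification\<close>

definition horo :: "'a::metric_space \<Rightarrow> 'a \<Rightarrow> 'a \<Rightarrow> real" where
  "horo p x = (\<lambda>m. dist x m - dist x p)"

text \<open>The topology of the function type \<open>'a \<Rightarrow> real\<close> is that of pointwise convergence.\<close>

definition horo_compactification :: "'a::metric_space \<Rightarrow> ('a \<Rightarrow> real) set" where
  "horo_compactification p =
     top_of_set {h. 1-lipschitz_on UNIV h \<and> h p = 0} closure_of range (horo p)"

definition horo_action :: "'a::metric_space \<Rightarrow> ('a \<Rightarrow> 'a) \<Rightarrow> ('a \<Rightarrow> real) \<Rightarrow> 'a \<Rightarrow> real" where
  "horo_action p g h = (\<lambda>m. h (inv g m) - h (inv g p))"

definition busemann_cocycle :: "'a::metric_space \<Rightarrow> ('a \<Rightarrow> 'a) \<Rightarrow> ('a \<Rightarrow> real) \<Rightarrow> real" where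
  "busemann_cocycle p g h = h (inv g p)"

text \<open>The product of two horofunctions is infinite when their sum is unbounded below.\<close>

definition horo_product :: "('a::metric_space \<Rightarrow> real) \<Rightarrow> ('a \<Rightarrow> real) \<Rightarrow> ereal" where
  "horo_product h\<^sub>1 h\<^sub>2 = - ((INF m. ereal (h\<^sub>1 m + h\<^sub>2 m)) / 2)"

definition stationary :: "('g \<Rightarrow> 'x \<Rightarrow> 'x) \<Rightarrow> 'g pmf \<Rightarrow> 'x measure \<Rightarrow> bool" where
  "stationary act \<mu> \<nu> \<longleftrightarrow>
     (\<forall>\<phi> :: 'x \<Rightarrow> real. \<phi> \<in> borel_measurable \<nu> \<longrightarrow> (\<exists>B. \<forall>x\<in>space \<nu>. \<bar>\<phi> x\<bar> \<le> B) \<longrightarrow>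
        (\<integral>x. (\<integral>g. \<phi> (act g x) \<partial>measure_pmf \<mu>) \<partial>\<nu>) = (\<integral>x. \<phi> x \<partial>\<nu>))"

definition stationary_horo_measure ::
  "'a::metric_space \<Rightarrow> ('a \<Rightarrow> 'a) pmf \<Rightarrow> ('a \<Rightarrow> real) measure \<Rightarrow> bool" where
  "stationary_horo_measure p \<mu> \<nu> \<longleftrightarrow>
     prob_space \<nu> \<and> sets \<nu> = sets (restrict_space borel (horo_compactification p)) \<and>
     stationary (horo_action p) \<mu> \<nu>"

text \<open>On the compactification \<open>horo_product\<close> is nonnegative (evaluate the infimum at \<open>p\<close>), so
  the integral is a nonnegative Lebesgue integral, and \<open>\<psi>\<close> takes values in \<open>[-\<infinity>, 0]\<close>.\<close>

definition psi :: "('a::metric_space \<Rightarrow> real) measure \<Rightarrow> ('a \<Rightarrow> real) \<Rightarrow> ereal" where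
  "psi \<nu> x = - 2 * enn2ereal (\<integral>\<^sup>+ y. e2ennreal (horo_product x y) \<partial>\<nu>)"

definition frak_c :: "'a::metric_space \<Rightarrow> ('a \<Rightarrow> real) measure \<Rightarrow> ereal" where
  "frak_c p \<nu> = - (INF x\<in>horo_compactification p. psi \<nu> x)"

section \<open>Random walk\<close>

definition kappa :: "'a::metric_space \<Rightarrow> ('a \<Rightarrow> 'a) \<Rightarrow> real" where
  "kappa p g = dist (g p) p"

definition bounded_support :: "'a::metric_space \<Rightarrow> ('a \<Rightarrow> 'a) pmf \<Rightarrow> bool" where
  "bounded_support p \<mu> \<longleftrightarrow> bdd_above (kappa p ` set_pmf \<mu>)"

definition kappa_supp :: "'a::metric_space \<Rightarrow> ('a \<Rightarrow> 'a) pmf \<Rightarrow> real" where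
  "kappa_supp p \<mu> = (SUP g\<in>set_pmf \<mu>. kappa p g)"

text \<open>\<open>left_walk x n = x n \<circ> \<dots> \<circ> x 1\<close> and \<open>right_walk x n = x 1 \<circ> \<dots> \<circ> x n\<close>; the index 0
  is not used.\<close>

primrec left_walk :: "(nat \<Rightarrow> 'a \<Rightarrow> 'a) \<Rightarrow> nat \<Rightarrow> 'a \<Rightarrow> 'a" where
  "left_walk x 0 = id"
| "left_walk x (Suc n) = x (Suc n) \<circ> left_walk x n"

primrec right_walk :: "(nat \<Rightarrow> 'a \<Rightarrow> 'a) \<Rightarrow> nat \<Rightarrow> 'a \<Rightarrow> 'a" where
  "right_walk x 0 = id"
| "right_walk x (Suc n) = right_walk x n \<circ> x (Suc n)"

definition drift :: "'a::metric_space \<Rightarrow> ('a \<Rightarrow> 'a) pmf \<Rightarrow> real" where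
  "drift p \<mu> = (THE l. AE x in Pi\<^sub>M (UNIV :: nat set) (\<lambda>_. measure_pmf \<mu>).
      (\<lambda>n. kappa p (right_walk x n) / real n) \<longlonglongrightarrow> l)"

text \<open>As the law is discrete, the steps are taken measurable for the discrete sigma-algebra.\<close>

definition iid_steps :: "'w measure \<Rightarrow> ('a \<Rightarrow> 'a) pmf \<Rightarrow> (nat \<Rightarrow> 'w \<Rightarrow> 'a \<Rightarrow> 'a) \<Rightarrow> bool" where
  "iid_steps P \<mu> X \<longleftrightarrow>
     prob_space P \<and>
     prob_space.indep_vars P (\<lambda>_. count_space UNIV) X {1..} \<and>
     (\<forall>i\<ge>1. distr P (count_space UNIV) (X i) = measure_pmf \<mu>)"

end

theory Submission
  imports Defs
begin

text \<open>
  Averaging the identity \<open>\<sigma>(g, x) = 2 (g x|y) - 2 (x|g\<inverse> y) + \<sigma>(g\<inverse>, y)\<close> over \<open>\<mu>\<close> and over the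
  stationary measure shows that \<open>\<sigma>(g, x) + \<psi> (g x) - \<psi> x\<close> has the same mean for every \<open>x\<close>, provided
  that \<open>\<psi>\<close> is bounded. Hence \<open>\<sigma>(L\<^sub>n, x)\<close> is, up to the bounded term \<open>\<psi>\<close> and a linear drift, a
  martingale with bounded increments, and Hoeffding's lemma gives the concentration inequality around
  that common mean; by Borel-Cantelli the mean is the drift.

  The boundedness of \<open>\<psi>\<close> follows from the exponential decay of the mass \<open>A R\<close> of the heaviest shadow
  \<open>{y. (x|y) > R}\<close>. First \<open>A R\<close> tends to \<open>0\<close>: otherwise the semigroup would move a horofunction whose
  deep shadows are almost heaviest to arbitrarily many others with disjoint shadows of almost the
  same mass. Then the maximum principle for harmonic functions of bounded step walks, applied outside
  an intermediate shadow of \<open>x\<close>, yields \<open>A R \<le> A (R - K) / 2\<close> for a constant \<open>K\<close>.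
\<close>

text \<open>The overview's \<open>A R\<close> is \<open>max_mass R\<close> below. The obstacle is
  that \<open>M\<close> need not be proper: neither the mass of the heaviest shadow nor the supremum
  in the maximum principle is known to be attained, and infinitely many orbit points may lie within
  a bounded distance of \<open>p\<close>. Every extremal argument therefore runs with a slack: an
  almost extremal value is carried along a fixed finite word in the support, the loss at each letter
  being controlled by the mass of that atom of \<open>\<mu>\<close>. For the maximum principle the
  word displaces \<open>p\<close> by more than twice the size of the region, so that it always leads
  out of it.

  The functions involved are \<open>u \<mapsto> \<nu> {y. u y \<in> shadow x R}\<close> on
  isometries. Stationarity makes them harmonic for right multiplication by \<open>inv s\<close>,
  with \<open>s\<close> distributed by \<open>\<mu>\<close>. The loss of depth under
  \<open>u\<close> is bounded by \<open>(x|u p)\<close> rather than by the displacement of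
  \<open>u\<close> (\<open>shadow_horo_action_inv\<close>), so a walk may wander far from
  \<open>p\<close> at bounded cost while it stays away from the direction of
  \<open>x\<close>.\<close>

text \<open>The four-point inequality is hyperbolicity in a form that does not mention the base point and
  passes to pointwise limits.\<close>

definition horofunctions :: "real \<Rightarrow> 'a::metric_space \<Rightarrow> ('a \<Rightarrow> real) set" where
  "horofunctions \<delta> p = {h. h p = 0 \<and> (\<forall>a b. h a - h b \<le> dist a b) \<and>
     (\<forall>a b c. h a + dist b c \<le> max (h b + dist a c) (h c + dist a b) + 2 * \<delta>)}"

text \<open>The Gromov product of \<open>h\<close> and the horofunction of the point \<open>m\<close>.\<close>

definition point_product :: "'a::metric_space \<Rightarrow> ('a \<Rightarrow> real) \<Rightarrow> 'a \<Rightarrow> real" where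
  "point_product p h m = (dist m p - h m) / 2"

text \<open>The set of all \<open>y\<close> with \<open>(x|y) > R\<close>.\<close>

definition shadow :: "('a \<Rightarrow> real) \<Rightarrow> real \<Rightarrow> ('a \<Rightarrow> real) set" where
  "shadow x R = {y. \<exists>m. x m + y m < - 2 * R}"

section \<open>Isometries\<close>

lemma Isom_dist: "g \<in> Isom \<Longrightarrow> dist (g x) (g y) = dist x y"
  by (auto simp: Isom_def)

lemma Isom_inj: "g \<in> Isom \<Longrightarrow> inj g"
  by (rule injI) (metis Isom_dist dist_eq_0_iff)

lemma Isom_bij: "g \<in> Isom \<Longrightarrow> bij g"
  using Isom_inj by (auto simp: Isom_def bij_def)

lemma Isom_inv_f [simp]: "g \<in> Isom \<Longrightarrow> inv g (g x) = x"
  by (simp add: Isom_inj)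

lemma Isom_f_inv [simp]: "g \<in> Isom \<Longrightarrow> g (inv g x) = x"
  by (simp add: Isom_def surj_f_inv_f)

lemma Isom_id [simp]: "id \<in> Isom"
  by (auto simp: Isom_def)

lemma Isom_comp [intro]: "g \<in> Isom \<Longrightarrow> h \<in> Isom \<Longrightarrow> g \<circ> h \<in> Isom"
  using comp_surj[of h g] by (auto simp: Isom_def simp del: o_apply) (simp add: o_def)

lemma Isom_inv [intro]: assumes "g \<in> Isom" shows "inv g \<in> Isom"
proof -
  have "dist (inv g x) (inv g y) = dist x y" for x y
    using assms Isom_dist[of g "inv g x" "inv g y"] by simp
  then show ?thesis
    using Isom_bij[OF assms] by (auto simp: Isom_def bij_imp_bij_inv bij_is_surj)
qed

lemma Isom_inv_inv [simp]: "g \<in> Isom \<Longrightarrow> inv (inv g) = g"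
  by (simp add: Isom_bij inv_inv_eq)

lemma Isom_inv_comp: "g \<in> Isom \<Longrightarrow> h \<in> Isom \<Longrightarrow> inv (g \<circ> h) = inv h \<circ> inv g"
  by (simp add: Isom_bij o_inv_distrib)

lemma Isom_funpow [intro]: "g \<in> Isom \<Longrightarrow> g ^^ n \<in> Isom"
  by (induction n) (auto simp flip: id_def)

lemma inv_funpow: "g \<in> Isom \<Longrightarrow> inv (g ^^ n) = inv g ^^ n"
  by (simp add: Isom_bij inv_fn)

lemma generated_semigroup_Isom: "g \<in> generated_semigroup S \<Longrightarrow> S \<subseteq> Isom \<Longrightarrow> g \<in> Isom"
  by (induction rule: generated_semigroup.induct) auto

lemma generated_semigroup_funpow:
  "g \<in> generated_semigroup S \<Longrightarrow> n > 0 \<Longrightarrow> g ^^ n \<in> generated_semigroup S"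
proof (induction n)
  case (Suc n)
  then show ?case
    by (cases "n = 0") (auto intro: generated_semigroup.composition simp del: o_apply simp: o_def[symmetric])
qed simp

lemma kappa_nonneg [simp]: "0 \<le> kappa p g"
  by (simp add: kappa_def)

lemma kappa_inv [simp]: "g \<in> Isom \<Longrightarrow> kappa p (inv g) = kappa p g"
  using Isom_dist[of g "inv g p" p] by (simp add: kappa_def dist_commute)

lemma kappa_comp: "g \<in> Isom \<Longrightarrow> kappa p (g \<circ> h) \<le> kappa p g + kappa p h"
  using dist_triangle[of "g (h p)" p "g p"] Isom_dist[of g "h p" p] by (simp add: kappa_def)

lemma kappa_comp_ge: "g \<in> Isom \<Longrightarrow> kappa p h - kappa p g \<le> kappa p (g \<circ> h)"
  using dist_triangle[of "g (h p)" "g p" p] Isom_dist[of g "h p" p]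
  by (simp add: kappa_def dist_commute)

lemma kappa_funpow: "g \<in> Isom \<Longrightarrow> kappa p (g ^^ n) \<le> real n * kappa p g"
proof (induction n)
  case (Suc n)
  then show ?case
    using kappa_comp[of g p "g ^^ n"] by (simp add: algebra_simps o_def)
qed (simp add: kappa_def)

section \<open>Geometry of horofunctions\<close>

lemma gromov_product_commute: "gromov_product p x y = gromov_product p y x"
  by (simp add: gromov_product_def dist_commute)

lemma hyperbolic_four_point:
  assumes "hyperbolic \<delta> TYPE('a::metric_space)"
  shows "dist (x::'a) a + dist b c \<le> max (dist x b + dist a c) (dist x c + dist a b) + 2 * \<delta>"
proof -
  have "gromov_product a b c \<ge> min (gromov_product a b x) (gromov_product a x c) - \<delta>"
    using assms by (auto simp: hyperbolic_def)
  then show ?thesis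
    using dist_commute[of b a] dist_commute[of c a] dist_commute[of b x]
    unfolding gromov_product_def min_def max_def by argo
qed

lemma hyperbolic_nonneg:
  assumes "hyperbolic \<delta> TYPE('a::metric_space)" shows "\<delta> \<ge> 0"
  using hyperbolic_four_point[OF assms, of "undefined::'a" undefined undefined undefined] by simp

lemma horo_in_horofunctions:
  assumes "hyperbolic \<delta> TYPE('a::metric_space)"
  shows "horo p (x::'a) \<in> horofunctions \<delta> p"
proof -
  have "dist x a - dist x b \<le> dist a b" for a b
    using dist_triangle[of x a b] by (simp add: dist_commute)
  moreover have "horo p x a + dist b c \<le> max (horo p x b + dist a c) (horo p x c + dist a b) + 2 * \<delta>" for a b c
    using hyperbolic_four_point[OF assms, of x a b c] by (auto simp: horo_def max_def)
  ultimately show ?thesis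
    by (auto simp: horofunctions_def horo_def)
qed

lemma horofunctions_base: "x \<in> horofunctions \<delta> p \<Longrightarrow> x p = 0"
  by (simp add: horofunctions_def)

lemma horofunctions_lipschitz: "x \<in> horofunctions \<delta> p \<Longrightarrow> x a - x b \<le> dist a b"
  by (simp add: horofunctions_def)

lemma horofunctions_four_point:
  "x \<in> horofunctions \<delta> p \<Longrightarrow> x a + dist b c \<le> max (x b + dist a c) (x c + dist a b) + 2 * \<delta>"
  by (simp add: horofunctions_def)

lemma horofunctions_nonneg: "x \<in> horofunctions \<delta> p \<Longrightarrow> \<delta> \<ge> 0"
  using horofunctions_four_point[of x \<delta> p p p p] by simp

lemma horofunctions_abs_le: "x \<in> horofunctions \<delta> p \<Longrightarrow> \<bar>x a\<bar> \<le> dist a p"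
  using horofunctions_lipschitz[of x \<delta> p a p] horofunctions_lipschitz[of x \<delta> p p a]
  by (auto simp: horofunctions_base dist_commute)

lemma point_product_bounds:
  assumes "x \<in> horofunctions \<delta> p"
  shows "0 \<le> point_product p x m" "point_product p x m \<le> dist m p"
  using horofunctions_abs_le[OF assms, of m] by (auto simp: point_product_def)

lemma point_product_lipschitz:
  assumes "x \<in> horofunctions \<delta> p"
  shows "point_product p x m \<le> point_product p x m' + dist m m'"
  using horofunctions_lipschitz[OF assms, of m' m] dist_triangle[of m p m']
  by (auto simp: point_product_def dist_commute field_simps)

text \<open>Both are the four-point inequality with one of its points at \<open>p\<close>, where
  \<open>x\<close> vanishes.\<close>

lemma point_product_min:
  assumes "x \<in> horofunctions \<delta> p"
  shows "gromov_product p m m' \<ge> min (point_product p x m) (point_product p x m') - \<delta>"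
    and "point_product p x m \<ge> min (point_product p x m') (gromov_product p m m') - \<delta>"
  using horofunctions_four_point[OF assms, of p m m'] horofunctions_four_point[OF assms, of m m' p]
  by (auto simp: point_product_def gromov_product_def horofunctions_base[OF assms] min_def max_def
      dist_commute field_simps split: if_splits)

text \<open>A witness of the shadow is a point whose products with both \<open>x\<close> and
  \<open>y\<close> exceed \<open>R\<close>, because horofunctions are at least
  \<open>- dist m' p\<close> there. Passing from \<open>y\<close> to \<open>x\<close> through this
  point uses hyperbolicity twice, hence \<open>2 * \<delta>\<close>.\<close>

lemma shadow_point_product:
  assumes x: "x \<in> horofunctions \<delta> p" and y: "y \<in> horofunctions \<delta> p" and "y \<in> shadow x R"
  shows "point_product p x m \<ge> min R (point_product p y m) - 2 * \<delta>"
proof -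
  obtain m' where m': "x m' + y m' < - 2 * R"
    using assms(3) by (auto simp: shadow_def)
  have "point_product p x m' > R" "point_product p y m' > R"
    using m' horofunctions_abs_le[OF x, of m'] horofunctions_abs_le[OF y, of m']
    by (auto simp: point_product_def abs_le_iff)
  then show ?thesis
    using point_product_min(2)[OF x, of m' m] point_product_min(1)[OF y, of m m'] horofunctions_nonneg[OF x]
    unfolding min_def by argo
qed

lemma shadow_commute: "y \<in> shadow x R \<longleftrightarrow> x \<in> shadow y R"
  by (auto simp: shadow_def add.commute)

lemma shadow_antimono: "R \<le> R' \<Longrightarrow> shadow x R' \<subseteq> shadow x R"
  unfolding shadow_def by clarsimp (meson less_le_trans mult_left_mono neg_le_iff_le zero_le_numeral)

text \<open>The point at distance \<open>r\<close> from \<open>p\<close> on a geodesic from \<open>p\<close> to \<open>m\<close> is a witness.\<close>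

lemma shadowI_point_product:
  assumes geo: "geodesic_space TYPE('a::metric_space)"
    and x: "(x :: 'a \<Rightarrow> real) \<in> horofunctions \<delta> p" and y: "y \<in> horofunctions \<delta> p"
    and r: "0 \<le> r" "r \<le> point_product p x m" "r \<le> point_product p y m" and R: "R < r - 2 * \<delta>"
  shows "y \<in> shadow x R"
proof -
  obtain c where c: "c 0 = p" "c (dist p m) = m"
    "\<And>s t. s \<in> {0..dist p m} \<Longrightarrow> t \<in> {0..dist p m} \<Longrightarrow> dist (c s) (c t) = \<bar>s - t\<bar>"
    using geo unfolding geodesic_space_def by meson
  have r': "r \<in> {0..dist p m}"
    using r point_product_bounds[OF x, of m] by (auto simp: dist_commute)
  define m' where "m' = c r"
  have d: "dist m' p = r" "dist m' m = dist p m - r"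
    using c(3)[of r 0] c(3)[of r "dist p m"] r' c(1,2) by (auto simp: m'_def)
  have g: "gromov_product p m' m = r"
    using d by (simp add: gromov_product_def dist_commute)
  \<comment> \<open>At distance \<open>r\<close> from \<open>p\<close>, a product of at least
    \<open>r - \<delta>\<close> with \<open>m'\<close> means a value of at most
    \<open>- r + 2 * \<delta>\<close>. Adding this for \<open>x\<close> and \<open>y\<close>
    explains the margin \<open>2 * \<delta>\<close> between \<open>R\<close> and
    \<open>r\<close>.\<close>
  have "z m' \<le> - r + 2 * \<delta>" if z: "z \<in> horofunctions \<delta> p" "r \<le> point_product p z m" for z
  proof -
    have "point_product p z m' \<ge> r - \<delta>"
      using point_product_min(2)[OF z(1), of m m'] gromov_product_commute[of p m m'] z(2) g unfolding min_def by argo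
    then show ?thesis using d by (simp add: point_product_def)
  qed
  from this[OF x r(2)] this[OF y r(3)] show ?thesis
    unfolding shadow_def using R by (auto intro!: exI[of _ m'])
qed

lemma mem_shadow_horo:
  "R < point_product p y m \<Longrightarrow> y \<in> shadow (horo p m) R"
  unfolding shadow_def point_product_def horo_def by (auto intro!: exI[of _ m] simp: field_simps)

section \<open>The action of isometries on horofunctions and shadows\<close>

lemma horo_action_horofunctions:
  assumes g: "g \<in> Isom" and x: "x \<in> horofunctions \<delta> p"
  shows "horo_action p g x \<in> horofunctions \<delta> p"
proof -
  have d: "dist (inv g a) (inv g b) = dist a b" for a b
    by (rule Isom_dist[OF Isom_inv[OF g]])
  have "horo_action p g x a - horo_action p g x b \<le> dist a b" for a b
    using horofunctions_lipschitz[OF x, of "inv g a" "inv g b"] d by (simp add: horo_action_def)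
  moreover have "horo_action p g x a + dist b c \<le> max (horo_action p g x b + dist a c) (horo_action p g x c + dist a b) + 2 * \<delta>" for a b c
    using horofunctions_four_point[OF x, of "inv g a" "inv g b" "inv g c"] unfolding d
    by (auto simp: horo_action_def max_def)
  ultimately show ?thesis
    by (auto simp: horofunctions_def horo_action_def)
qed

lemma horo_action_comp:
  "g \<in> Isom \<Longrightarrow> h \<in> Isom \<Longrightarrow> horo_action p (g \<circ> h) x = horo_action p g (horo_action p h x)"
  by (auto simp: horo_action_def Isom_inv_comp)

lemma horo_action_id: "x p = 0 \<Longrightarrow> horo_action p id x = x"
  by (auto simp: horo_action_def)

text \<open>If \<open>y\<close> has a small product with \<open>inv g p\<close>, its image has a
  product with \<open>g p\<close> close to the maximum \<open>kappa p g\<close>: this is how an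
  isometry of large displacement contracts towards \<open>g p\<close>.\<close>

lemma point_product_horo_action:
  assumes "y \<in> horofunctions \<delta> p" "g \<in> Isom"
  shows "point_product p (horo_action p g y) (g p) = kappa p g - point_product p y (inv g p)"
  using kappa_inv[OF assms(2), of p] horofunctions_base[OF assms(1)] assms(2)
  by (simp add: point_product_def horo_action_def kappa_def field_simps)

lemma shadow_horo_action:
  assumes g: "g \<in> Isom" and x: "x \<in> horofunctions \<delta> p" and y: "y \<in> horofunctions \<delta> p"
    and "y \<in> shadow x R"
  shows "horo_action p g y \<in> shadow (horo_action p g x) (R - kappa p g)"
proof -
  obtain m where m: "x m + y m < - 2 * R"
    using assms(4) by (auto simp: shadow_def)
  have "\<bar>x (inv g p)\<bar> \<le> kappa p g" "\<bar>y (inv g p)\<bar> \<le> kappa p g"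
    using horofunctions_abs_le[OF x, of "inv g p"] horofunctions_abs_le[OF y, of "inv g p"] kappa_inv[OF g, of p]
    by (auto simp: kappa_def)
  then have "horo_action p g x (g m) + horo_action p g y (g m) < - 2 * (R - kappa p g)"
    using m g by (auto simp: horo_action_def abs_le_iff)
  then show ?thesis by (auto simp: shadow_def)
qed

text \<open>Only the value of \<open>y\<close> at \<open>inv g p\<close> is estimated by
  \<open>kappa p g\<close>, while that of \<open>x\<close> at \<open>g p\<close> is kept; the two
  combine to twice the product of \<open>x\<close> with \<open>g p\<close>. Unlike the loss in
  \<open>shadow_horo_action\<close>, this one stays bounded when \<open>g\<close> moves
  \<open>p\<close> far away, but not in the direction of \<open>x\<close>.\<close>

lemma shadow_horo_action_inv:
  assumes g: "g \<in> Isom" and y: "y \<in> horofunctions \<delta> p"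
    and "horo_action p g y \<in> shadow x R"
  shows "y \<in> shadow (horo_action p (inv g) x) (R - point_product p x (g p))"
proof -
  obtain m where m: "x m + horo_action p g y m < - 2 * R"
    using assms(3) by (auto simp: shadow_def)
  have "\<bar>y (inv g p)\<bar> \<le> kappa p g"
    using horofunctions_abs_le[OF y, of "inv g p"] kappa_inv[OF g, of p] by (auto simp: kappa_def)
  then have "horo_action p (inv g) x (inv g m) + y (inv g m) < - 2 * (R - point_product p x (g p))"
    using m g by (auto simp: horo_action_def point_product_def kappa_def abs_le_iff field_simps)
  then show ?thesis by (auto simp: shadow_def)
qed

section \<open>The compactification as an invariant set of horofunctions\<close>

lemma lipschitz_iff_real:
  "1-lipschitz_on UNIV h \<longleftrightarrow> (\<forall>a b. h a - h b \<le> dist a b)" for h :: "'a::metric_space \<Rightarrow> real"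
  unfolding lipschitz_on_def dist_real_def abs_le_iff by (auto, metis dist_commute minus_diff_eq)

lemma horo_compactification_eq:
  "horo_compactification p = {h. 1-lipschitz_on UNIV h \<and> h p = 0} \<inter> closure (range (horo p))"
proof -
  have "range (horo p) \<subseteq> {h. 1-lipschitz_on UNIV h \<and> h p = 0}"
  proof -
    have "dist x a - dist x b \<le> dist a b" for x a b :: 'a
      using dist_triangle[of x a b] by (simp add: dist_commute)
    then show ?thesis by (auto simp: lipschitz_iff_real horo_def)
  qed
  then show ?thesis
    unfolding horo_compactification_def closure_of_subtopology
    by (simp add: Int_absorb1)
qed

lemma horo_in_compactification [simp]: "horo p x \<in> horo_compactification p"
proof -
  have "dist x a - dist x b \<le> dist a b" for a b
    using dist_triangle[of x a b] by (simp add: dist_commute)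
  then show ?thesis
    unfolding horo_compactification_eq using closure_subset[of "range (horo p)"]
    by (auto simp: lipschitz_iff_real horo_def)
qed

lemma continuous_on_eval [continuous_intros]: "continuous_on UNIV (\<lambda>h :: 'a \<Rightarrow> real. h m)"
  by (rule continuous_on_product_coordinates)

lemma horo_compactification_subset:
  assumes "hyperbolic \<delta> TYPE('a::metric_space)"
  shows "horo_compactification p \<subseteq> horofunctions \<delta> (p::'a)"
proof -
  let ?C = "{h::'a \<Rightarrow> real. \<forall>a b c. h a + dist b c \<le> max (h b + dist a c) (h c + dist a b) + 2 * \<delta>}"
  have "closed ?C"
    by (intro closed_Collect_all closed_Collect_le continuous_intros)
  moreover have "range (horo p) \<subseteq> ?C"
    using horo_in_horofunctions[OF assms] by (auto simp: horofunctions_def)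
  ultimately have "closure (range (horo p)) \<subseteq> ?C"
    by (rule closure_minimal[rotated])
  then show ?thesis
    unfolding horo_compactification_eq horofunctions_def lipschitz_iff_real by auto
qed

text \<open>The action is continuous for pointwise convergence and sends the horofunction of a point
  \<open>y\<close> to that of \<open>g y\<close>, so it preserves the closure.\<close>

lemma horo_action_compactification:
  assumes g: "g \<in> Isom" and x: "x \<in> horo_compactification p"
  shows "horo_action p g x \<in> horo_compactification p"
proof -
  have c: "continuous_on UNIV (horo_action p g)"
    unfolding horo_action_def
    by (intro continuous_on_coordinatewise_then_product continuous_intros)
  have d: "dist (inv g a) (inv g b) = dist a b" for a b
    by (rule Isom_dist[OF Isom_inv[OF g]])
  have i: "dist y (inv g m) = dist (g y) m" for y m
    using Isom_dist[OF g, of y "inv g m"] g by simp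
  have "horo_action p g (horo p y) = horo p (g y)" for y
    by (auto simp: horo_action_def horo_def i)
  then have "horo_action p g ` range (horo p) \<subseteq> range (horo p)"
    by auto
  then have "horo_action p g ` closure (range (horo p)) \<subseteq> closure (range (horo p))"
    by (meson c closure_subset image_closure_subset order_trans closed_closure continuous_on_subset subset_UNIV)
  moreover have "horo_action p g x a - horo_action p g x b \<le> dist a b" for a b
    using x d[of a b] by (auto simp: horo_action_def horo_compactification_eq lipschitz_iff_real) (metis)
  ultimately show ?thesis
    using x by (auto simp: horo_compactification_eq lipschitz_iff_real horo_action_def)
qed


section \<open>Independent loxodromic isometries\<close>

lemma gromov_product_min:
  assumes "hyperbolic \<delta> TYPE('a::metric_space)"
  shows "gromov_product p (x::'a) y \<ge> min (gromov_product p x z) (gromov_product p z y) - \<delta>"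
  using assms by (auto simp: hyperbolic_def)

lemma gromov_product_le_dist:
  "gromov_product p x y \<le> dist x p" "gromov_product p x y \<le> dist y p"
  using dist_triangle[of y p x] dist_triangle[of x p y] by (auto simp: gromov_product_def dist_commute)

lemma gromov_product_ge: "gromov_product p x y \<ge> dist x p - dist x y"
  using dist_triangle[of x p y] by (simp add: gromov_product_def)

lemma funpow_orbit_dist:
  assumes "g \<in> Isom"
  shows "dist ((g ^^ m) x) ((g ^^ (m + k)) x) = dist ((g ^^ k) x) x"
proof -
  have "(g ^^ (m + k)) x = (g ^^ m) ((g ^^ k) x)"
    by (simp add: funpow_add)
  then show ?thesis
    using Isom_dist[OF Isom_funpow[OF assms], of m x "(g ^^ k) x"] by (simp add: dist_commute)
qed

text \<open>The part of loxodromy that is kept: the lower quasi-geodesic bound along one half-orbit.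
  In this one-sided form it applies to \<open>g\<close> and to \<open>inv g\<close> separately, one
  for each end.\<close>

definition linear_growth :: "'a::metric_space \<Rightarrow> ('a \<Rightarrow> 'a) \<Rightarrow> bool" where
  "linear_growth p g \<longleftrightarrow> (\<exists>A B. A > 0 \<and> (\<forall>n::nat. real n / A - B \<le> kappa p (g ^^ n)))"

lemma loxodromic_linear_growth:
  assumes "loxodromic g"
  shows "linear_growth p g" "linear_growth p (inv g)"
proof -
  have g: "g \<in> Isom" using assms by (simp add: loxodromic_def)
  obtain A B where AB: "A \<ge> 1" "\<And>m n. \<bar>real_of_int (m - n)\<bar> / A - B \<le> dist (int_iterate g m p) (int_iterate g n p)"
    using assms unfolding loxodromic_def quasi_geodesic_def by metis
  have "real n / A - B \<le> kappa p (g ^^ n)" for n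
    using AB(2)[of "int n" 0] by (simp add: int_iterate_def kappa_def)
  then show "linear_growth p g"
    using AB(1) unfolding linear_growth_def by (intro exI[of _ A] exI[of _ B]) auto
  have "real n / A - B \<le> kappa p (inv g ^^ n)" for n
    using AB(2)[of "- int n" 0] by (cases "n = 0") (auto simp: int_iterate_def kappa_def)
  then show "linear_growth p (inv g)"
    using AB(1) unfolding linear_growth_def by (intro exI[of _ A] exI[of _ B]) auto
qed

text \<open>Chaining the hyperbolicity inequality along the orbit in steps of length \<open>N\<close>, each step costs
  \<open>\<delta>\<close> but gains \<open>N / A \<ge> \<delta>\<close>.\<close>

lemma orbit_gromov_product:
  assumes hyp: "hyperbolic \<delta> TYPE('a::metric_space)" and g: "(g::'a \<Rightarrow> 'a) \<in> Isom" and "linear_growth p g"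
  shows "\<exists>A E. A > 0 \<and> (\<forall>m n. gromov_product p ((g ^^ m) p) ((g ^^ n) p) \<ge> real (min m n) / A - E)"
proof -
  obtain A B where A: "A > 0" and B: "\<And>n. real n / A - B \<le> kappa p (g ^^ n)"
    using assms(3) unfolding linear_growth_def by auto
  have \<delta>: "\<delta> \<ge> 0" by (rule hyperbolic_nonneg[OF hyp])
  obtain N0 :: nat where "real N0 \<ge> A * \<delta>" using real_arch_simple by blast
  then obtain N :: nat where N: "real N \<ge> A * \<delta>" "N > 0"
    by (intro that[of "Suc N0"]) auto
  define D where "D = real N * kappa p g"
  \<comment> \<open>With this value both branches of the minimum in the induction step end at
    exactly \<open>real m / A - E\<close>.\<close>
  define E where "E = B + D + \<delta>"
  let ?G = "\<lambda>m n. gromov_product p ((g ^^ m) p) ((g ^^ n) p)"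
  have short: "?G m (m + k) \<ge> real m / A - B - D" if "k \<le> N" for m k
  proof -
    have "dist ((g ^^ k) p) p \<le> real k * kappa p g"
      using kappa_funpow[OF g, of p k] by (simp add: kappa_def)
    also have "\<dots> \<le> D"
      using that unfolding D_def by (intro mult_right_mono) auto
    finally have "dist ((g ^^ m) p) ((g ^^ (m + k)) p) \<le> D"
      by (simp add: funpow_orbit_dist[OF g])
    then show ?thesis
      using gromov_product_ge[of "(g ^^ m) p" p "(g ^^ (m + k)) p"] B[of m] by (simp add: kappa_def)
  qed
  have le: "?G m (m + k) \<ge> real m / A - E" for m k
  proof (induction k arbitrary: m rule: less_induct)
    case (less k)
    show ?case
    proof (cases "k \<le> N")
      case True
      then show ?thesis using short[of k m] \<delta> by (simp add: E_def)
    next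
      case False
      then have "?G (m + N) (m + N + (k - N)) \<ge> real (m + N) / A - E"
        using N(2) by (intro less.IH) auto
      moreover have "real (m + N) / A \<ge> real m / A + \<delta>"
        using N(1) A by (simp add: field_simps)
      ultimately show ?thesis
        using False short[of N m] gromov_product_min[OF hyp, of p "(g ^^ m) p" "(g ^^ (m + N)) p" "(g ^^ (m + k)) p"]
        unfolding min_def E_def by simp argo
    qed
  qed
  have "?G m n \<ge> real (min m n) / A - E" for m n
  proof (cases "m \<le> n")
    case True
    then show ?thesis using le[of m "n - m"] by (simp add: min_def)
  next
    case False
    then show ?thesis
      using le[of n "m - n"] gromov_product_commute[of p "(g ^^ m) p" "(g ^^ n) p"] by (simp add: min_def)
  qed
  then show ?thesis using A by blast
qed

section \<open>Sequences converging at infinity and the ends of half-orbits\<close>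

lemma seq_to_infinity_iff:
  "seq_to_infinity p u v \<longleftrightarrow> (\<forall>T. \<exists>N. \<forall>m\<ge>N. \<forall>n\<ge>N. T \<le> gromov_product p (u m) (v n))"
  unfolding seq_to_infinity_def filterlim_at_top eventually_prod_sequentially by (auto, blast+)

lemma seq_to_infinity_sym: "seq_to_infinity p u v \<Longrightarrow> seq_to_infinity p v u"
  unfolding seq_to_infinity_iff by (subst gromov_product_commute) blast

lemma seq_to_infinity_trans:
  assumes hyp: "hyperbolic \<delta> TYPE('a::metric_space)"
    and "seq_to_infinity (p::'a) u v" "seq_to_infinity p v w"
  shows "seq_to_infinity p u w"
  unfolding seq_to_infinity_iff
proof
  fix T
  obtain N1 where N1: "\<And>m n. m \<ge> N1 \<Longrightarrow> n \<ge> N1 \<Longrightarrow> T + \<delta> \<le> gromov_product p (u m) (v n)"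
    using assms(2) unfolding seq_to_infinity_iff by meson
  obtain N2 where N2: "\<And>m n. m \<ge> N2 \<Longrightarrow> n \<ge> N2 \<Longrightarrow> T + \<delta> \<le> gromov_product p (v m) (w n)"
    using assms(3) unfolding seq_to_infinity_iff by meson
  have "T \<le> gromov_product p (u m) (w n)" if "m \<ge> max N1 N2" "n \<ge> max N1 N2" for m n
    using gromov_product_min[OF hyp, of p "u m" "v (max N1 N2)" "w n"] N1[of m "max N1 N2"] N2[of "max N1 N2" n] that
    by auto
  then show "\<exists>N. \<forall>m\<ge>N. \<forall>n\<ge>N. T \<le> gromov_product p (u m) (w n)" by blast
qed

lemma seq_to_infinity_isometry:
  assumes g: "g \<in> Isom" and uv: "seq_to_infinity p u v"
  shows "seq_to_infinity p (g \<circ> u) (g \<circ> v)"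
  unfolding seq_to_infinity_iff
proof
  fix T
  have *: "gromov_product p (g x) (g y) \<ge> gromov_product p x y - kappa p g" for x y
    using dist_triangle[of "g x" "g p" p] dist_triangle[of "g y" "g p" p] Isom_dist[OF g] 
    by (simp add: gromov_product_def kappa_def dist_commute field_simps)
  obtain N where N: "\<And>m n. m \<ge> N \<Longrightarrow> n \<ge> N \<Longrightarrow> T + kappa p g \<le> gromov_product p (u m) (v n)"
    using uv unfolding seq_to_infinity_iff by meson
  have "T \<le> gromov_product p ((g \<circ> u) m) ((g \<circ> v) n)" if "m \<ge> N" "n \<ge> N" for m n
    using N[OF that] *[of "u m" "v n"] by simp
  then show "\<exists>N. \<forall>m\<ge>N. \<forall>n\<ge>N. T \<le> gromov_product p ((g \<circ> u) m) ((g \<circ> v) n)" by blast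
qed

lemma orbit_seq_to_infinity:
  assumes "hyperbolic \<delta> TYPE('a::metric_space)" "(g::'a \<Rightarrow> 'a) \<in> Isom" "linear_growth p g"
  shows "seq_to_infinity p (\<lambda>n. (g ^^ n) p) (\<lambda>n. (g ^^ n) p)"
  unfolding seq_to_infinity_iff
proof
  fix T
  obtain A E where A: "A > 0" and E: "\<And>m n. gromov_product p ((g ^^ m) p) ((g ^^ n) p) \<ge> real (min m n) / A - E"
    using orbit_gromov_product[OF assms] by blast
  obtain N :: nat where N: "real N \<ge> A * (T + E)" using real_arch_simple by blast
  have "T \<le> gromov_product p ((g ^^ m) p) ((g ^^ n) p)" if "m \<ge> N" "n \<ge> N" for m n
  proof -
    have "A * (T + E) \<le> real (min m n)" using N that by (auto simp: min_def)
    then have "T + E \<le> real (min m n) / A" using A by (simp add: field_simps)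
    then show ?thesis using E[of m n] by linarith
  qed
  then show "\<exists>N. \<forall>m\<ge>N. \<forall>n\<ge>N. T \<le> gromov_product p ((g ^^ m) p) ((g ^^ n) p)" by blast
qed

definition boundary_class :: "'a::metric_space \<Rightarrow> (nat \<Rightarrow> 'a) \<Rightarrow> (nat \<Rightarrow> 'a) set" where
  "boundary_class p u = {v \<in> gromov_sequences p. seq_to_infinity p u v}"

lemma boundary_class_eqI:
  assumes hyp: "hyperbolic \<delta> TYPE('a::metric_space)" and "seq_to_infinity (p::'a) u v"
  shows "boundary_class p u = boundary_class p v"
  using seq_to_infinity_trans[OF hyp] seq_to_infinity_sym[OF assms(2)] assms(2)
  unfolding boundary_class_def by blast

text \<open>Applying \<open>g\<close> shifts the orbit by one index, so the image converges to the
  same end. \<open>boundary_fixed_points\<close> asks the class to equal its image as a set of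
  sequences, which is why stability under \<open>inv g\<close> is proved along with that under
  \<open>g\<close>.\<close>

lemma orbit_class_fixed:
  assumes hyp: "hyperbolic \<delta> TYPE('a::metric_space)" and g: "(g::'a \<Rightarrow> 'a) \<in> Isom" and lin: "linear_growth p g"
  defines "u \<equiv> \<lambda>n. (g ^^ n) p"
  shows "boundary_class p u \<in> boundary_fixed_points p g"
    "boundary_class p u \<in> boundary_fixed_points p (inv g)"
proof -
  have uu: "seq_to_infinity p u u"
    unfolding u_def by (rule orbit_seq_to_infinity[OF hyp g lin])
  have ugu: "seq_to_infinity p u (g \<circ> u)"
    unfolding seq_to_infinity_iff
  proof
    fix T
    obtain N where "\<And>m n. m \<ge> N \<Longrightarrow> n \<ge> N \<Longrightarrow> T \<le> gromov_product p (u m) (u n)"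
      using uu unfolding seq_to_infinity_iff by meson
    moreover have "(g \<circ> u) n = u (Suc n)" for n by (simp add: u_def)
    ultimately show "\<exists>N. \<forall>m\<ge>N. \<forall>n\<ge>N. T \<le> gromov_product p (u m) ((g \<circ> u) n)"
      by (metis le_Suc_eq)
  qed
  have bd: "boundary_class p u \<in> gromov_boundary p"
    unfolding gromov_boundary_def quotient_def boundary_class_def Image_def
    using uu by (auto simp: gromov_sequences_def)
  have ig: "inv g \<circ> (g \<circ> v) = v" "g \<circ> (inv g \<circ> v) = v" for v :: "nat \<Rightarrow> 'a"
    using g by (auto simp: fun_eq_iff)
  have uiu: "seq_to_infinity p u (inv g \<circ> u)"
    using seq_to_infinity_isometry[OF Isom_inv[OF g] ugu] ig seq_to_infinity_sym by metis
  have in1: "g \<circ> v \<in> boundary_class p u" if "v \<in> boundary_class p u" for v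
    using that seq_to_infinity_isometry[OF g] seq_to_infinity_trans[OF hyp ugu]
    by (auto simp: boundary_class_def gromov_sequences_def)
  have in2: "inv g \<circ> v \<in> boundary_class p u" if "v \<in> boundary_class p u" for v
    using that seq_to_infinity_isometry[OF Isom_inv[OF g]] seq_to_infinity_trans[OF hyp uiu]
    by (auto simp: boundary_class_def gromov_sequences_def)
  have "(\<lambda>v. g \<circ> v) ` boundary_class p u = boundary_class p u"
    using in1 in2 ig(2) by (auto simp: image_iff) metis
  moreover have "(\<lambda>v. inv g \<circ> v) ` boundary_class p u = boundary_class p u"
    using in1 in2 ig(1) by (auto simp: image_iff) metis
  ultimately show "boundary_class p u \<in> boundary_fixed_points p g"
    "boundary_class p u \<in> boundary_fixed_points p (inv g)"
    using bd by (auto simp: boundary_fixed_points_def)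
qed

text \<open>A single pair of orbit points with a very large product forces all later pairs to have a
  large product: one goes from \<open>(g ^^ m) p\<close> to \<open>(h ^^ n) p\<close> through the
  two points of that pair, at a cost of \<open>2 * \<delta>\<close>.\<close>

lemma orbits_bounded_or_equivalent:
  assumes hyp: "hyperbolic \<delta> TYPE('a::metric_space)"
    and g: "(g::'a \<Rightarrow> 'a) \<in> Isom" "linear_growth p g"
    and h: "h \<in> Isom" "linear_growth p h"
    and ne: "\<not> seq_to_infinity p (\<lambda>n. (g ^^ n) p) (\<lambda>n. (h ^^ n) p)"
  shows "\<exists>C. \<forall>m n. gromov_product p ((g ^^ m) p) ((h ^^ n) p) \<le> C"
proof (rule ccontr)
  assume "\<nexists>C. \<forall>m n. gromov_product p ((g ^^ m) p) ((h ^^ n) p) \<le> C"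
  then have unb: "\<exists>m n. C < gromov_product p ((g ^^ m) p) ((h ^^ n) p)" for C
    by (meson not_le)
  have "\<exists>N. \<forall>m\<ge>N. \<forall>n\<ge>N. T \<le> gromov_product p ((g ^^ m) p) ((h ^^ n) p)" for T
  proof -
    obtain N1 where N1: "\<And>m n. m \<ge> N1 \<Longrightarrow> n \<ge> N1 \<Longrightarrow> T + 2 * \<delta> \<le> gromov_product p ((g ^^ m) p) ((g ^^ n) p)"
      using orbit_seq_to_infinity[OF hyp g] unfolding seq_to_infinity_iff by meson
    obtain N2 where N2: "\<And>m n. m \<ge> N2 \<Longrightarrow> n \<ge> N2 \<Longrightarrow> T + 2 * \<delta> \<le> gromov_product p ((h ^^ m) p) ((h ^^ n) p)"
      using orbit_seq_to_infinity[OF hyp h] unfolding seq_to_infinity_iff by meson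
    \<comment> \<open>A product is at most the distance of either point from \<open>p\<close>, hence
      at most \<open>m0 * kappa p g\<close> and \<open>n0 * kappa p h\<close>. The last two entries
      of the maximum thus force \<open>m0 \<ge> N1\<close> and \<open>n0 \<ge> N2\<close>.\<close>
    define C where "C = max (T + 2 * \<delta>) (max (real N1 * kappa p g) (real N2 * kappa p h))"
    obtain m0 n0 where mn: "C < gromov_product p ((g ^^ m0) p) ((h ^^ n0) p)"
      using unb by blast
    have "C < real m0 * kappa p g" "C < real n0 * kappa p h"
      using mn gromov_product_le_dist[of p "(g ^^ m0) p" "(h ^^ n0) p"]
        kappa_funpow[OF g(1), of p m0] kappa_funpow[OF h(1), of p n0]
      unfolding kappa_def by linarith+
    then have "real N1 * kappa p g < real m0 * kappa p g" "real N2 * kappa p h < real n0 * kappa p h"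
      by (auto simp: C_def)
    then have ge: "m0 \<ge> N1" "n0 \<ge> N2"
      by (metis kappa_nonneg linorder_not_le mult_right_mono nless_le of_nat_le_iff)+
    have "T \<le> gromov_product p ((g ^^ m) p) ((h ^^ n) p)" if "m \<ge> max N1 N2" "n \<ge> max N1 N2" for m n
    proof -
      have "T + 2 * \<delta> \<le> gromov_product p ((g ^^ m) p) ((g ^^ m0) p)" using N1[of m m0] ge that by auto
      moreover have "T + 2 * \<delta> \<le> gromov_product p ((h ^^ n0) p) ((h ^^ n) p)" using N2[of n0 n] ge that by auto
      moreover have "T + 2 * \<delta> \<le> gromov_product p ((g ^^ m0) p) ((h ^^ n0) p)" using mn by (auto simp: C_def)
      ultimately show ?thesis
        using gromov_product_min[OF hyp, of p "(g ^^ m) p" "(g ^^ m0) p" "(h ^^ n) p"]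
          gromov_product_min[OF hyp, of p "(g ^^ m0) p" "(h ^^ n0) p" "(h ^^ n) p"]
          hyperbolic_nonneg[OF hyp]
        by (auto simp: min_def split: if_splits)
    qed
    then show ?thesis by blast
  qed
  then show False using ne unfolding seq_to_infinity_iff by blast
qed

text \<open>A common limit of two half-orbits would be a common fixed point.\<close>

lemma independent_loxodromics_bounded:
  assumes hyp: "hyperbolic \<delta> TYPE('a::metric_space)"
    and ind: "independent_loxodromics p (g::'a \<Rightarrow> 'a) h"
  shows "\<exists>C. \<forall>a\<in>{g, inv g}. \<forall>b\<in>{h, inv h}. \<forall>m n. gromov_product p ((a ^^ m) p) ((b ^^ n) p) \<le> C"
proof -
  have lox: "loxodromic g" "loxodromic h" and disj: "boundary_fixed_points p g \<inter> boundary_fixed_points p h = {}"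
    using ind by (auto simp: independent_loxodromics_def)
  have I: "g \<in> Isom" "h \<in> Isom" using lox by (auto simp: loxodromic_def)
  have key: "\<exists>C. \<forall>m n. gromov_product p ((a ^^ m) p) ((b ^^ n) p) \<le> C"
    if a: "a \<in> {g, inv g}" and b: "b \<in> {h, inv h}" for a b
  proof (rule orbits_bounded_or_equivalent[OF hyp])
    show aa: "a \<in> Isom" "linear_growth p a" and bb: "b \<in> Isom" "linear_growth p b"
      using a b I loxodromic_linear_growth lox by auto
    show "\<not> seq_to_infinity p (\<lambda>n. (a ^^ n) p) (\<lambda>n. (b ^^ n) p)"
    proof
      assume "seq_to_infinity p (\<lambda>n. (a ^^ n) p) (\<lambda>n. (b ^^ n) p)"
      then have "boundary_class p (\<lambda>n. (a ^^ n) p) = boundary_class p (\<lambda>n. (b ^^ n) p)"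
        by (rule boundary_class_eqI[OF hyp])
      moreover have "boundary_class p (\<lambda>n. (a ^^ n) p) \<in> boundary_fixed_points p g"
        using a orbit_class_fixed[OF hyp aa] I by auto
      moreover have "boundary_class p (\<lambda>n. (b ^^ n) p) \<in> boundary_fixed_points p h"
        using b orbit_class_fixed[OF hyp bb] I by auto
      ultimately show False using disj by auto
    qed
  qed
  obtain C1 where C1: "\<And>m n. gromov_product p ((g ^^ m) p) ((h ^^ n) p) \<le> C1" using key by blast
  obtain C2 where C2: "\<And>m n. gromov_product p ((g ^^ m) p) ((inv h ^^ n) p) \<le> C2" using key by blast
  obtain C3 where C3: "\<And>m n. gromov_product p ((inv g ^^ m) p) ((h ^^ n) p) \<le> C3" using key by blast
  obtain C4 where C4: "\<And>m n. gromov_product p ((inv g ^^ m) p) ((inv h ^^ n) p) \<le> C4" using key by blast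
  have "\<forall>a\<in>{g, inv g}. \<forall>b\<in>{h, inv h}. \<forall>m n. gromov_product p ((a ^^ m) p) ((b ^^ n) p)
      \<le> max (max C1 C2) (max C3 C4)"
    using C1 C2 C3 C4 by (auto simp: le_max_iff_disj)
  then show ?thesis by blast
qed


section \<open>Integration against a probability mass function\<close>

lemma integrable_pmf_bounded:
  fixes f :: "'b \<Rightarrow> real"
  assumes "\<And>s. s \<in> set_pmf \<mu> \<Longrightarrow> \<bar>f s\<bar> \<le> B"
  shows "integrable (measure_pmf \<mu>) f"
  using assms by (intro measure_pmf.integrable_const_bound[where B = B]) (auto simp: AE_measure_pmf_iff)

text \<open>The deficit of the mean below the bound \<open>B\<close> contains the deficit at the
  atom \<open>s\<close>, weighted by its mass. An almost maximal mean thus forces almost maximal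
  values at each atom.\<close>

lemma pmf_integral_le_point:
  fixes f :: "'b \<Rightarrow> real"
  assumes s: "s \<in> set_pmf \<mu>" and bd: "\<And>g. g \<in> set_pmf \<mu> \<Longrightarrow> \<bar>f g\<bar> \<le> C"
    and le: "\<And>g. g \<in> set_pmf \<mu> \<Longrightarrow> f g \<le> B"
  shows "pmf \<mu> s * (B - f s) \<le> B - (\<integral>g. f g \<partial>measure_pmf \<mu>)"
proof -
  have i: "integrable (measure_pmf \<mu>) f"
    using bd by (rule integrable_pmf_bounded)
  have "pmf \<mu> s * (B - f s) = (\<integral>g. (B - f s) * indicator {s} g \<partial>measure_pmf \<mu>)"
    by (simp add: pmf.rep_eq)
  also have "\<dots> \<le> (\<integral>g. B - f g \<partial>measure_pmf \<mu>)"
  proof (rule integral_mono_AE)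
    show "integrable (measure_pmf \<mu>) (\<lambda>g. (B - f s) * indicator {s} g)"
      by (rule integrable_pmf_bounded[where B = "\<bar>B - f s\<bar>"]) (auto simp: indicator_def)
  qed (use le i in \<open>auto simp: AE_measure_pmf_iff indicator_def\<close>)
  also have "\<dots> = B - (\<integral>g. f g \<partial>measure_pmf \<mu>)"
    using i by simp
  finally show ?thesis .
qed

text \<open>The support is countable, so the measure is an image of one on \<open>nat\<close>, where joint
  measurability is automatic.\<close>

lemma pmf_integral_swap:
  fixes f :: "'b \<Rightarrow> 'c \<Rightarrow> real"
  assumes "finite_measure \<nu>"
    and meas: "\<And>g. g \<in> set_pmf \<mu> \<Longrightarrow> f g \<in> borel_measurable \<nu>"
    and bd: "\<And>g x. g \<in> set_pmf \<mu> \<Longrightarrow> x \<in> space \<nu> \<Longrightarrow> \<bar>f g x\<bar> \<le> B"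
  shows "(\<integral>x. (\<integral>g. f g x \<partial>measure_pmf \<mu>) \<partial>\<nu>) = (\<integral>g. (\<integral>x. f g x \<partial>\<nu>) \<partial>measure_pmf \<mu>)"
proof -
  interpret nu: finite_measure \<nu> by fact
  define e where "e = from_nat_into (set_pmf \<mu>)"
  define q where "q = map_pmf (to_nat_on (set_pmf \<mu>)) \<mu>"
  have e: "e n \<in> set_pmf \<mu>" for n
    unfolding e_def by (rule from_nat_into[OF set_pmf_not_empty])
  have \<mu>: "\<mu> = map_pmf e q"
    unfolding q_def e_def map_pmf_comp
    by (rule map_pmf_idI[symmetric]) (simp add: countable_set_pmf)
  interpret pair_sigma_finite "measure_pmf q" \<nu>
    by (intro pair_sigma_finite.intro measure_pmf.sigma_finite_measure_axioms nu.sigma_finite_measure_axioms)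
  interpret P: finite_measure "measure_pmf q \<Otimes>\<^sub>M \<nu>"
    by (intro finite_measure_pair_measure measure_pmf.finite_measure_axioms nu.finite_measure_axioms)
  have m: "(\<lambda>(n, x). f (e n) x) \<in> borel_measurable (measure_pmf q \<Otimes>\<^sub>M \<nu>)"
  proof -
    have "(\<lambda>(n, x). f (e n) x) \<in> borel_measurable (count_space UNIV \<Otimes>\<^sub>M \<nu>)"
      by (rule measurable_pair_measure_countable1) (auto intro: meas e)
    moreover have "sets (measure_pmf q \<Otimes>\<^sub>M \<nu>) = sets (count_space UNIV \<Otimes>\<^sub>M \<nu>)"
      by (intro sets_pair_measure_cong) auto
    ultimately show ?thesis by (simp cong: measurable_cong_sets)
  qed
  have "integrable (measure_pmf q \<Otimes>\<^sub>M \<nu>) (\<lambda>(n, x). f (e n) x)"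
    using bd e by (intro P.integrable_const_bound[where B = B] m AE_I2) (auto simp: space_pair_measure)
  from Fubini_integral[OF this] show ?thesis
    unfolding \<mu> by simp
qed

section \<open>A maximum principle\<close>

text \<open>The supremum \<open>E\<close> of \<open>e\<close> over \<open>U\<close> need not be
  attained, so almost maximal values are followed instead. If \<open>E > 0\<close>, a point with a
  value close to \<open>E\<close> lies in \<open>D\<close>, its neighbours have values close to
  \<open>E\<close> too, and after the finitely many letters of \<open>w\<close> a value of at least
  \<open>E / 2\<close> is found outside of \<open>D\<close>, which \<open>stop\<close>
  forbids.\<close>

lemma harmonic_nonpos:
  fixes e :: "('a::metric_space \<Rightarrow> 'a) \<Rightarrow> real"
  assumes iso: "set_pmf \<mu> \<subseteq> Isom" and U: "U \<subseteq> Isom"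
    and bd: "\<And>u. u \<in> Isom \<Longrightarrow> \<bar>e u\<bar> \<le> B"
    and harm: "\<And>u. u \<in> D \<Longrightarrow> e u = (\<integral>s. e (u \<circ> inv s) \<partial>measure_pmf \<mu>)"
    and step: "\<And>u s. u \<in> D \<Longrightarrow> s \<in> set_pmf \<mu> \<Longrightarrow> u \<circ> inv s \<in> U"
    and stop: "\<And>u. u \<in> U \<Longrightarrow> u \<notin> D \<Longrightarrow> e u \<le> 0"
    and w: "w \<in> generated_semigroup (set_pmf \<mu>)"
    and escape: "\<And>u. u \<in> D \<Longrightarrow> u \<circ> inv w \<notin> D"
    and u: "u \<in> U"
  shows "e u \<le> 0"
proof (rule ccontr)
  assume pos: "\<not> e u \<le> 0"
  define E where "E = (SUP v\<in>U. e v)"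
  have bdd: "bdd_above (e ` U)"
    using bd U by (intro bdd_aboveI2[of _ _ B]) force
  have le: "e v \<le> E" if "v \<in> U" for v
    unfolding E_def by (rule cSUP_upper[OF that bdd])
  have E: "E > 0" using pos le[OF u] by simp
  have propagate: "\<forall>\<eta>>0. \<exists>\<eta>'>0. \<forall>v\<in>U. E - \<eta>' \<le> e v \<longrightarrow> v \<circ> inv w \<in> U \<and> E - \<eta> \<le> e (v \<circ> inv w)"
    using w
  proof (induction rule: generated_semigroup.induct)
    case (generator s)
    show ?case
    proof (intro allI impI)
      fix \<eta> :: real assume \<eta>: "\<eta> > 0"
      \<comment> \<open>The bound \<open>E / 2\<close> keeps the value at \<open>v\<close> positive,
        so that \<open>v\<close> lies in \<open>D\<close>, where harmonicity is available.\<close>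
      define \<eta>' where "\<eta>' = min (pmf \<mu> s * \<eta>) (E / 2)"
      have pr: "pmf \<mu> s > 0" using generator by (rule pmf_positive)
      have "v \<circ> inv s \<in> U \<and> E - \<eta> \<le> e (v \<circ> inv s)" if v: "v \<in> U" and ge: "E - \<eta>' \<le> e v" for v
      proof -
        have "E - \<eta>' > 0" using E by (auto simp: \<eta>'_def min_def)
        then have D: "v \<in> D" using stop[OF v] ge by force
        have "pmf \<mu> s * (E - e (v \<circ> inv s)) \<le> E - (\<integral>s. e (v \<circ> inv s) \<partial>measure_pmf \<mu>)"
          using step[OF D] U by (intro pmf_integral_le_point[OF generator, where C = B] bd le) auto
        also have "\<dots> \<le> \<eta>'" using harm[OF D] ge by simp
        also have "\<dots> \<le> pmf \<mu> s * \<eta>" by (simp add: \<eta>'_def)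
        finally have "E - e (v \<circ> inv s) \<le> \<eta>" using pr by simp
        then show ?thesis using step[OF D generator] by simp
      qed
      moreover have "\<eta>' > 0" using pr \<eta> E by (auto simp: \<eta>'_def)
      ultimately show "\<exists>\<eta>'>0. \<forall>v\<in>U. E - \<eta>' \<le> e v \<longrightarrow> v \<circ> inv s \<in> U \<and> E - \<eta> \<le> e (v \<circ> inv s)"
        by blast
    qed
  next
    case (composition g h)
    have "g \<in> Isom" "h \<in> Isom"
      using composition.hyps generated_semigroup_Isom iso by blast+
    then have "v \<circ> inv (g \<circ> h) = (v \<circ> inv h) \<circ> inv g" for v :: "'a \<Rightarrow> 'a"
      by (simp add: Isom_inv_comp o_assoc)
    then show ?case using composition.IH by (metis (no_types, lifting))
  qed
  obtain \<eta>' where \<eta>': "\<eta>' > 0" "\<And>v. v \<in> U \<Longrightarrow> E - \<eta>' \<le> e v \<Longrightarrow> v \<circ> inv w \<in> U \<and> E - E/2 \<le> e (v \<circ> inv w)"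
    using propagate[rule_format, of "E/2"] E by auto
  have "\<exists>v\<in>U. E - min \<eta>' E < e v"
    using less_cSUP_iff[OF _ bdd, of "E - min \<eta>' E"] u \<eta>'(1) E unfolding E_def by auto
  then obtain v where v: "v \<in> U" "E - min \<eta>' E < e v" by blast
  have "v \<in> D" using stop[OF v(1)] v(2) by force
  moreover have "v \<circ> inv w \<in> U" "E / 2 \<le> e (v \<circ> inv w)"
    using \<eta>'(2)[OF v(1)] v(2) by auto
  ultimately show False using escape[of v] stop[of "v \<circ> inv w"] E by auto
qed

section \<open>Measures of shadows\<close>

locale horofunction_walk =
  fixes p :: "'a::metric_space" and \<delta> :: real and \<mu> :: "('a \<Rightarrow> 'a) pmf" and \<nu> :: "('a \<Rightarrow> real) measure"
  assumes geodesic: "geodesic_space TYPE('a)"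
    and hyperbolic: "hyperbolic \<delta> TYPE('a)"
    and isometries: "set_pmf \<mu> \<subseteq> Isom"
    and bounded: "bounded_support p \<mu>"
    and non_elementary: "non_elementary p \<mu>"
    and stationary: "stationary_horo_measure p (map_pmf inv \<mu>) \<nu>"
begin

abbreviation "\<H> \<equiv> horofunctions \<delta> p"
abbreviation "act \<equiv> horo_action p"
abbreviation "\<kappa>S \<equiv> kappa_supp p \<mu>"

text \<open>The isometry is kept as an argument because, for fixed \<open>x\<close> and
  \<open>R\<close>, stationarity becomes harmonicity in \<open>u\<close>.\<close>

definition shadow_mass :: "('a \<Rightarrow> real) \<Rightarrow> real \<Rightarrow> ('a \<Rightarrow> 'a) \<Rightarrow> real" where
  "shadow_mass x R u = measure \<nu> {y \<in> space \<nu>. act u y \<in> shadow x R}"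

definition max_mass :: "real \<Rightarrow> real" where
  "max_mass R = (SUP x\<in>\<H>. shadow_mass x R id)"

sublocale prob_space \<nu>
  using stationary by (simp add: stationary_horo_measure_def)

lemma delta_nonneg: "\<delta> \<ge> 0"
  by (rule hyperbolic_nonneg[OF hyperbolic])

lemma space_nu: "space \<nu> = horo_compactification p"
proof -
  have "sets \<nu> = sets (restrict_space borel (horo_compactification p))"
    using stationary by (simp add: stationary_horo_measure_def)
  from sets_eq_imp_space_eq[OF this] show ?thesis by (simp add: space_restrict_space)
qed

lemma sets_nu: "sets \<nu> = sets (restrict_space borel (space \<nu>))"
  using stationary by (simp add: stationary_horo_measure_def space_nu)

lemma in_space_H: "y \<in> space \<nu> \<Longrightarrow> y \<in> \<H>"
  using horo_compactification_subset[OF hyperbolic] by (auto simp: space_nu)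

lemma act_space: "u \<in> Isom \<Longrightarrow> y \<in> space \<nu> \<Longrightarrow> act u y \<in> space \<nu>"
  using horo_action_compactification by (auto simp: space_nu)

lemma act_H: "u \<in> Isom \<Longrightarrow> x \<in> \<H> \<Longrightarrow> act u x \<in> \<H>"
  by (rule horo_action_horofunctions)

lemma borel_measurable_nu: "f \<in> borel_measurable borel \<Longrightarrow> f \<in> borel_measurable \<nu>"
  unfolding measurable_cong_sets[OF sets_nu refl, of borel] by (rule measurable_restrict_space1)

lemma continuous_act: "continuous_on UNIV (act u)"
  unfolding horo_action_def by (intro continuous_on_coordinatewise_then_product continuous_intros)

lemma measurable_act: "u \<in> Isom \<Longrightarrow> act u \<in> measurable \<nu> \<nu>"
proof -
  assume u: "u \<in> Isom"
  have "act u \<in> measurable \<nu> borel"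
    using borel_measurable_nu[OF borel_measurable_continuous_onI[OF continuous_act]] .
  then have "act u \<in> measurable \<nu> (restrict_space borel (space \<nu>))"
    using act_space[OF u] by (intro measurable_restrict_space2) auto
  then show ?thesis unfolding measurable_cong_sets[OF refl sets_nu, of \<nu>] .
qed

lemma open_shadow: "open (shadow x R)"
  unfolding shadow_def by (intro open_Collect_ex open_Collect_less continuous_intros)

lemma sets_shadow: "{y \<in> space \<nu>. act u y \<in> shadow x R} \<in> sets \<nu>"
proof -
  have "open (act u -` shadow x R)"
    by (rule open_vimage[OF open_shadow continuous_act])
  then have "(act u -` shadow x R) \<inter> space \<nu> \<in> sets (restrict_space borel (space \<nu>))"
    unfolding sets_restrict_space by (auto intro!: image_eqI[of _ _ "act u -` shadow x R"])
  then show ?thesis unfolding sets_nu[symmetric] by (simp add: vimage_def Int_def conj_commute)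
qed

lemma kappa_le: "s \<in> set_pmf \<mu> \<Longrightarrow> kappa p s \<le> \<kappa>S"
  using bounded unfolding kappa_supp_def bounded_support_def by (rule cSUP_upper[rotated])

lemma kappa_supp_nonneg: "\<kappa>S \<ge> 0"
proof -
  obtain s where "s \<in> set_pmf \<mu>" using set_pmf_not_empty by fast
  from kappa_le[OF this] kappa_nonneg[of p s] show ?thesis by linarith
qed

lemma stationary_integral:
  fixes \<phi> :: "('a \<Rightarrow> real) \<Rightarrow> real"
  assumes "\<phi> \<in> borel_measurable \<nu>" and bd: "\<And>y. y \<in> space \<nu> \<Longrightarrow> \<bar>\<phi> y\<bar> \<le> B"
  shows "(\<integral>y. \<phi> y \<partial>\<nu>) = (\<integral>g. (\<integral>y. \<phi> (act (inv g) y) \<partial>\<nu>) \<partial>measure_pmf \<mu>)"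
proof -
  have "(\<integral>y. (\<integral>g. \<phi> (act g y) \<partial>measure_pmf (map_pmf inv \<mu>)) \<partial>\<nu>) = (\<integral>y. \<phi> y \<partial>\<nu>)"
    using stationary assms unfolding stationary_horo_measure_def stationary_def by blast
  moreover have "(\<integral>y. (\<integral>g. \<phi> (act (inv g) y) \<partial>measure_pmf \<mu>) \<partial>\<nu>) = (\<integral>g. (\<integral>y. \<phi> (act (inv g) y) \<partial>\<nu>) \<partial>measure_pmf \<mu>)"
  proof (rule pmf_integral_swap[where B = B])
    fix g assume "g \<in> set_pmf \<mu>"
    then have g: "inv g \<in> Isom" using isometries by auto
    show "(\<lambda>y. \<phi> (act (inv g) y)) \<in> borel_measurable \<nu>"
      by (rule measurable_compose[OF measurable_act[OF g] assms(1)])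
    show "\<bar>\<phi> (act (inv g) y)\<bar> \<le> B" if "y \<in> space \<nu>" for y
      by (rule bd[OF act_space[OF g that]])
  qed (rule finite_measure_axioms)
  ultimately show ?thesis by simp
qed

lemma shadow_mass_bounds: "0 \<le> shadow_mass x R u" "shadow_mass x R u \<le> 1"
  by (auto simp: shadow_mass_def)

lemma shadow_mass_id: "shadow_mass x R id = measure \<nu> {y \<in> space \<nu>. y \<in> shadow x R}"
proof -
  have "act id y = y" if "y \<in> space \<nu>" for y
    using in_space_H[OF that] by (simp add: horo_action_id horofunctions_base)
  then show ?thesis unfolding shadow_mass_def by (intro arg_cong[of _ _ "measure \<nu>"]) auto
qed

lemma sets_shadow_id: "{y \<in> space \<nu>. y \<in> shadow x R} \<in> sets \<nu>"
proof -
  have "act id y = y" if "y \<in> space \<nu>" for y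
    using in_space_H[OF that] by (simp add: horo_action_id horofunctions_base)
  then have "{y \<in> space \<nu>. y \<in> shadow x R} = {y \<in> space \<nu>. act id y \<in> shadow x R}" by auto
  then show ?thesis using sets_shadow by simp
qed

text \<open>The steps are \<open>inv s\<close> because the measure is stationary for the inverted
  law, and they multiply on the right because they act on \<open>y\<close> before \<open>u\<close>
  does.\<close>

lemma shadow_mass_harmonic:
  assumes u: "u \<in> Isom"
  shows "shadow_mass x R u = (\<integral>s. shadow_mass x R (u \<circ> inv s) \<partial>measure_pmf \<mu>)"
proof -
  let ?\<phi> = "indicator {y \<in> space \<nu>. act u y \<in> shadow x R} :: _ \<Rightarrow> real"
  have "(\<integral>y. ?\<phi> y \<partial>\<nu>) = (\<integral>s. (\<integral>y. ?\<phi> (act (inv s) y) \<partial>\<nu>) \<partial>measure_pmf \<mu>)"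
    by (rule stationary_integral[where B = 1]) (auto intro!: borel_measurable_indicator sets_shadow)
  also have "\<dots> = (\<integral>s. shadow_mass x R (u \<circ> inv s) \<partial>measure_pmf \<mu>)"
  proof (intro integral_cong_AE, simp, simp, unfold AE_measure_pmf_iff, intro ballI)
    fix s assume "s \<in> set_pmf \<mu>"
    then have s: "inv s \<in> Isom" using isometries by auto
    have "(\<integral>y. ?\<phi> (act (inv s) y) \<partial>\<nu>) = (\<integral>y. indicator {y \<in> space \<nu>. act (u \<circ> inv s) y \<in> shadow x R} y \<partial>\<nu>)"
      using act_space[OF s] by (intro Bochner_Integration.integral_cong)
        (auto simp: indicator_def horo_action_comp[OF u s])
    also have "\<dots> = shadow_mass x R (u \<circ> inv s)"
      using sets_shadow by (simp add: shadow_mass_def)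
    finally show "(\<integral>y. ?\<phi> (act (inv s) y) \<partial>\<nu>) = shadow_mass x R (u \<circ> inv s)" .
  qed
  finally show ?thesis using sets_shadow by (simp add: shadow_mass_def)
qed

section \<open>The heaviest shadow of a given depth\<close>

lemma bdd_mass: "bdd_above ((\<lambda>x. shadow_mass x R id) ` \<H>)"
  by (intro bdd_aboveI2[of _ _ 1] shadow_mass_bounds)

lemma H_nonempty: "horo p m \<in> \<H>"
  by (rule horo_in_horofunctions[OF hyperbolic])

lemma mass_le_max: "x \<in> \<H> \<Longrightarrow> shadow_mass x R id \<le> max_mass R"
  unfolding max_mass_def by (rule cSUP_upper[OF _ bdd_mass])

lemma max_mass_bounds: "0 \<le> max_mass R" "max_mass R \<le> 1"
proof -
  show "0 \<le> max_mass R"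
    using mass_le_max[OF H_nonempty] shadow_mass_bounds(1) by (rule order_trans[rotated])
  show "max_mass R \<le> 1"
    unfolding max_mass_def using H_nonempty by (intro cSUP_least shadow_mass_bounds) auto
qed

lemma max_mass_le: "(\<And>x. x \<in> \<H> \<Longrightarrow> shadow_mass x R id \<le> c) \<Longrightarrow> max_mass R \<le> c"
  unfolding max_mass_def using H_nonempty by (intro cSUP_least) auto

lemma max_mass_antimono: "R \<le> R' \<Longrightarrow> max_mass R' \<le> max_mass R"
proof (rule max_mass_le)
  fix x assume "R \<le> R'" "x \<in> \<H>"
  have "shadow_mass x R' id \<le> shadow_mass x R id"
    unfolding shadow_mass_id using shadow_antimono[OF \<open>R \<le> R'\<close>]
    by (intro finite_measure_mono sets_shadow_id) auto
  then show "shadow_mass x R' id \<le> max_mass R"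
    using mass_le_max[OF \<open>x \<in> \<H>\<close>, of R] by linarith
qed

lemma shadow_mass_shift:
  assumes "u \<in> Isom"
  shows "shadow_mass x R u \<le> shadow_mass (act (inv u) x) (R - point_product p x (u p)) id"
  unfolding shadow_mass_id unfolding shadow_mass_def
  using shadow_horo_action_inv[OF assms in_space_H] 
  by (intro finite_measure_mono sets_shadow_id) auto

lemma shadow_mass_le_max:
  assumes "u \<in> Isom" "x \<in> \<H>" "point_product p x (u p) \<le> c"
  shows "shadow_mass x R u \<le> max_mass (R - c)"
proof -
  have "shadow_mass x R u \<le> max_mass (R - point_product p x (u p))"
    using shadow_mass_shift[OF assms(1), of x R] mass_le_max[OF act_H[OF Isom_inv[OF assms(1)] assms(2)]]
    by (rule order_trans)
  also have "\<dots> \<le> max_mass (R - c)"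
    using assms(3) by (intro max_mass_antimono) auto
  finally show ?thesis .
qed

lemma sets_point_product: "{y \<in> space \<nu>. R < point_product p y m} \<in> sets \<nu>"
proof -
  have "(\<lambda>y. point_product p y m) \<in> borel_measurable \<nu>"
    unfolding point_product_def
    by (intro borel_measurable_nu borel_measurable_continuous_onI continuous_intros) auto
  then show ?thesis by measurable
qed

text \<open>Used at \<open>m = inv u p\<close> for arbitrary isometries \<open>u\<close>: the
  horofunctions that \<open>u\<close> fails to carry towards \<open>u p\<close> have little mass,
  uniformly in \<open>u\<close>.\<close>

lemma point_product_mass: "measure \<nu> {y \<in> space \<nu>. R < point_product p y m} \<le> max_mass R"
proof -
  have "measure \<nu> {y \<in> space \<nu>. R < point_product p y m} \<le> shadow_mass (horo p m) R id"
    unfolding shadow_mass_id using mem_shadow_horo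
    by (intro finite_measure_mono sets_shadow_id) auto
  then show ?thesis using mass_le_max[OF H_nonempty, of m R] by linarith
qed

section \<open>The mass of the heaviest shadow tends to zero\<close>

definition mass_limit :: real where
  "mass_limit = (INF R. max_mass R)"

lemma mass_limit_le: "mass_limit \<le> max_mass R"
  unfolding mass_limit_def using max_mass_bounds(1) by (intro cINF_lower bdd_belowI2) auto

lemma mass_limit_approx: "\<eta> > 0 \<Longrightarrow> \<exists>R. max_mass R < mass_limit + \<eta>"
proof -
  assume "\<eta> > 0"
  have "bdd_below (range max_mass)" using max_mass_bounds(1) by (intro bdd_belowI2) auto
  from cINF_less_iff[OF _ this, of "mass_limit + \<eta>"] show ?thesis
    using \<open>\<eta> > 0\<close> by (simp add: mass_limit_def)
qed

text \<open>As \<open>max_mass\<close> is antitone, \<open>mass_limit\<close> is its limit, so at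
  large depth no mass exceeds \<open>mass_limit\<close> by much. The mass at \<open>x\<close> is the
  average of the masses seen after one step; if it is almost \<open>mass_limit\<close>, then so is
  the term of each atom. One step costs a depth of at most \<open>\<kappa>S\<close>, and longer
  words compose.\<close>

lemma mass_propagation:
  assumes "w \<in> generated_semigroup (set_pmf \<mu>)" "\<eta> > 0"
  shows "\<exists>\<eta>'>0. \<exists>K R0. \<forall>R\<ge>R0. \<forall>x\<in>\<H>. mass_limit - \<eta>' \<le> shadow_mass x R id \<longrightarrow>
           mass_limit - \<eta> \<le> shadow_mass (act w x) (R - K) id"
  using assms
proof (induction arbitrary: \<eta> rule: generated_semigroup.induct)
  case (generator s)
  \<comment> \<open>The possible excess over \<open>mass_limit\<close> and the deficit at
    \<open>x\<close> are both \<open>\<eta>'\<close>, which accounts for the factor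
    \<open>2\<close>.\<close>
  define \<eta>' where "\<eta>' = pmf \<mu> s * \<eta> / 2"
  have pr: "pmf \<mu> s > 0" using generator(1) by (rule pmf_positive)
  have \<eta>': "\<eta>' > 0" using pr generator(2) by (simp add: \<eta>'_def)
  obtain R1 where R1: "max_mass R1 < mass_limit + \<eta>'" using mass_limit_approx[OF \<eta>'] by blast
  have "mass_limit - \<eta> \<le> shadow_mass (act s x) (R - \<kappa>S) id"
    if R: "R \<ge> R1 + \<kappa>S" and x: "x \<in> \<H>" and ge: "mass_limit - \<eta>' \<le> shadow_mass x R id" for R x
  proof -
    have le: "shadow_mass x R (inv g) \<le> mass_limit + \<eta>'" if "g \<in> set_pmf \<mu>" for g
    proof -
      have g: "g \<in> Isom" using that isometries by auto
      have "point_product p x (inv g p) \<le> \<kappa>S"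
        using point_product_bounds(2)[OF x, of "inv g p"] kappa_inv[OF g, of p] kappa_le[OF that] by (simp add: kappa_def)
      then have "shadow_mass x R (inv g) \<le> max_mass (R - \<kappa>S)"
        using g by (intro shadow_mass_le_max x) auto
      also have "\<dots> \<le> max_mass R1" using R by (intro max_mass_antimono) auto
      finally show ?thesis using R1 by simp
    qed
    have "pmf \<mu> s * (mass_limit + \<eta>' - shadow_mass x R (inv s))
        \<le> mass_limit + \<eta>' - (\<integral>g. shadow_mass x R (inv g) \<partial>measure_pmf \<mu>)"
      using le by (intro pmf_integral_le_point[OF generator(1), where C = 1])
        (auto simp: shadow_mass_bounds)
    also have "(\<integral>g. shadow_mass x R (inv g) \<partial>measure_pmf \<mu>) = shadow_mass x R id"
      using shadow_mass_harmonic[of id x R] by simp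
    also have "mass_limit + \<eta>' - shadow_mass x R id \<le> pmf \<mu> s * \<eta>"
      using ge by (simp add: \<eta>'_def)
    finally have "mass_limit + \<eta>' - shadow_mass x R (inv s) \<le> \<eta>" using pr by simp
    moreover have "shadow_mass x R (inv s) \<le> shadow_mass (act s x) (R - \<kappa>S) id"
    proof -
      have s: "s \<in> Isom" using generator(1) isometries by auto
      have "point_product p x (inv s p) \<le> \<kappa>S"
        using point_product_bounds(2)[OF x, of "inv s p"] kappa_inv[OF s, of p] kappa_le[OF generator(1)] by (simp add: kappa_def)
      then have "shadow (act s x) (R - point_product p x (inv s p)) \<subseteq> shadow (act s x) (R - \<kappa>S)"
        by (intro shadow_antimono) auto
      then have "shadow_mass (act s x) (R - point_product p x (inv s p)) id \<le> shadow_mass (act s x) (R - \<kappa>S) id"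
        unfolding shadow_mass_id by (intro finite_measure_mono sets_shadow_id) auto
      then show ?thesis
        using shadow_mass_shift[OF Isom_inv[OF s], of x R] s by simp
    qed
    ultimately show ?thesis using \<eta>' by linarith
  qed
  then show ?case using \<eta>' by blast
next
  case (composition g h)
  have gh: "g \<in> Isom" "h \<in> Isom"
    using composition.hyps generated_semigroup_Isom isometries by blast+
  obtain \<eta>1 K1 R1 where 1: "\<eta>1 > 0" "\<And>R x. R \<ge> R1 \<Longrightarrow> x \<in> \<H> \<Longrightarrow> mass_limit - \<eta>1 \<le> shadow_mass x R id \<Longrightarrow>
           mass_limit - \<eta> \<le> shadow_mass (act g x) (R - K1) id"
    using composition.IH(1)[OF composition.prems] by metis
  obtain \<eta>2 K2 R2 where 2: "\<eta>2 > 0" "\<And>R x. R \<ge> R2 \<Longrightarrow> x \<in> \<H> \<Longrightarrow> mass_limit - \<eta>2 \<le> shadow_mass x R id \<Longrightarrow>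
           mass_limit - \<eta>1 \<le> shadow_mass (act h x) (R - K2) id"
    using composition.IH(2)[OF 1(1)] by metis
  have "mass_limit - \<eta> \<le> shadow_mass (act (g \<circ> h) x) (R - (K2 + K1)) id"
    if "R \<ge> max R2 (R1 + K2)" "x \<in> \<H>" "mass_limit - \<eta>2 \<le> shadow_mass x R id" for R x
    using 1(2)[OF _ act_H[OF gh(2) that(2)], of "R - K2"] 2(2)[of R x] that
    by (simp add: horo_action_comp[OF gh] diff_diff_eq)
  then show ?case using 2(1) by blast
qed

text \<open>Since \<open>x\<close> has a small product with \<open>inv g p\<close>, its translate
  \<open>act g x\<close> points almost exactly towards \<open>g p\<close>. A common \<open>y\<close>
  deep in both shadows would transfer this to \<open>x\<close>, giving it a product of at least
  \<open>kappa p g - C - 4 * \<delta> > C\<close> with \<open>g p\<close>.\<close>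

lemma disjoint_translates:
  assumes g: "g \<in> Isom" and x: "x \<in> \<H>"
    and C: "point_product p x (g p) \<le> C" "point_product p x (inv g p) \<le> C"
    and big: "kappa p g > 2 * C + 4 * \<delta>" and R: "R \<ge> kappa p g"
    and y: "y \<in> \<H>" "y \<in> shadow x R" "y \<in> shadow (act g x) R"
  shows False
proof -
  have gx: "act g x \<in> \<H>" by (rule act_H[OF g x])
  have "point_product p (act g x) (g p) \<ge> kappa p g - C"
    using point_product_horo_action[OF x g] C(2) by simp
  moreover have "act g x \<in> shadow y R" using y(3) by (simp add: shadow_commute)
  ultimately have "point_product p y (g p) \<ge> min R (kappa p g - C) - 2 * \<delta>"
    using shadow_point_product[OF y(1) gx, of R "g p"] by (auto simp: min_def split: if_splits)
  moreover have "kappa p g - C \<le> R"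
    using R C(1) point_product_bounds(1)[OF x, of "g p"] by linarith
  ultimately have "point_product p y (g p) \<ge> kappa p g - C - 2 * \<delta>" by simp
  then have "point_product p x (g p) \<ge> kappa p g - C - 4 * \<delta>"
    using shadow_point_product[OF x y(1,2), of "g p"] \<open>kappa p g - C \<le> R\<close> delta_nonneg
    by (auto simp: min_def split: if_splits)
  then show False using C(1) big by linarith
qed

text \<open>Applying \<open>inv (g ^^ i)\<close> reduces the pair to \<open>x\<close> and its
  translate by \<open>g ^^ (j - i)\<close>. This costs a depth of \<open>kappa p (g ^^ i)\<close>,
  and \<open>disjoint_translates\<close> asks for another \<open>kappa p (g ^^ (j - i))\<close>,
  hence the factor \<open>2\<close> in the bound on \<open>R\<close>.\<close>

lemma disjoint_orbit_shadows:
  assumes g: "g \<in> Isom" and x: "x \<in> \<H>"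
    and C: "\<And>k. point_product p x ((g ^^ k) p) \<le> C" "\<And>k. point_product p x ((inv g ^^ k) p) \<le> C"
    and big: "\<And>k. k \<ge> 1 \<Longrightarrow> kappa p (g ^^ k) > 2 * C + 4 * \<delta>"
    and R: "\<And>k. k \<le> J \<Longrightarrow> R \<ge> 2 * kappa p (g ^^ k)"
    and ij: "i < j" "j \<le> J"
    and y: "y \<in> \<H>" "y \<in> shadow (act (g ^^ i) x) R" "y \<in> shadow (act (g ^^ j) x) R"
  shows False
proof -
  define k where "k = j - i"
  have gi: "g ^^ i \<in> Isom" "inv (g ^^ i) \<in> Isom" and gk: "g ^^ k \<in> Isom" using g by auto
  have j: "g ^^ j = g ^^ i \<circ> g ^^ k" using ij by (simp add: k_def flip: funpow_add)
  have x0: "act id x = x" by (rule horo_action_id[of x p, OF horofunctions_base[OF x]])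
  have id: "inv (g ^^ i) \<circ> (g ^^ i) = id" using gi by (auto simp: fun_eq_iff)
  have canc: "act (inv (g ^^ i)) (act (g ^^ i) z) = z" if "z \<in> \<H>" for z
    using horo_action_comp[OF gi(2,1), of p z] horo_action_id[of z p, OF horofunctions_base[OF that]] id by simp
  let ?y = "act (inv (g ^^ i)) y" and ?R = "R - kappa p (g ^^ i)"
  have y': "?y \<in> \<H>" by (rule act_H[OF gi(2) y(1)])
  have "?y \<in> shadow x ?R"
    using shadow_horo_action[OF gi(2) act_H[OF gi(1) x] y(1,2)] canc[OF x] gi by simp
  moreover have "?y \<in> shadow (act (g ^^ k) x) ?R"
    using shadow_horo_action[OF gi(2) act_H[OF Isom_funpow[OF g] x] y(1,3)] canc[OF act_H[OF gk x]] gi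
    by (simp add: j horo_action_comp[OF gi(1) gk])
  moreover have "kappa p (g ^^ k) > 2 * C + 4 * \<delta>" using ij by (intro big) (simp add: k_def)
  moreover have "?R \<ge> kappa p (g ^^ k)"
  proof -
    have "i \<le> J" "k \<le> J" using ij by (auto simp: k_def)
    from R[OF this(1)] R[OF this(2)] show ?thesis by linarith
  qed
  ultimately show False
    using disjoint_translates[OF gk x, of C ?R ?y] C y' by (simp add: inv_funpow[OF g])
qed

lemma disjoint_mass_bound:
  assumes g: "g \<in> Isom" and x: "x \<in> \<H>"
    and C: "\<And>k. point_product p x ((g ^^ k) p) \<le> C" "\<And>k. point_product p x ((inv g ^^ k) p) \<le> C"
    and big: "\<And>k. k \<ge> 1 \<Longrightarrow> kappa p (g ^^ k) > 2 * C + 4 * \<delta>"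
    and R: "\<And>k. k \<le> J \<Longrightarrow> R \<ge> 2 * kappa p (g ^^ k)"
    and mass: "\<And>i. i \<in> {1..J} \<Longrightarrow> \<beta> \<le> shadow_mass (act (g ^^ i) x) R id"
  shows "real J * \<beta> \<le> 1"
proof -
  let ?S = "\<lambda>i. {y \<in> space \<nu>. y \<in> shadow (act (g ^^ i) x) R}"
  have "?S i \<inter> ?S j = {}" if "i < j" "j \<le> J" for i j
    using disjoint_orbit_shadows[OF g x C big R that in_space_H] by blast
  then have "disjoint_family_on ?S {1..J}"
    unfolding disjoint_family_on_def
    by (intro ballI impI) (metis (lifting) Int_commute atLeastAtMost_iff linorder_neqE_nat)
  then have "(\<Sum>i\<in>{1..J}. measure \<nu> (?S i)) = measure \<nu> (\<Union>i\<in>{1..J}. ?S i)"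
    using sets_shadow_id by (intro finite_measure_finite_Union[symmetric]) auto
  also have "\<dots> \<le> 1" by simp
  finally have "(\<Sum>i\<in>{1..J}. shadow_mass (act (g ^^ i) x) R id) \<le> 1"
    by (simp add: shadow_mass_id)
  moreover have "real J * \<beta> \<le> (\<Sum>i\<in>{1..J}. shadow_mass (act (g ^^ i) x) R id)"
    using sum_mono[of "{1..J}" "\<lambda>_. \<beta>", OF mass] by simp
  ultimately show ?thesis by linarith
qed

text \<open>The thresholds have to be uniform over the words, because \<open>x\<close> is chosen
  only after them.\<close>

lemma finite_mass_propagation:
  assumes "finite F" "F \<subseteq> generated_semigroup (set_pmf \<mu>)" "\<eta> > 0"
  shows "\<exists>\<eta>'>0. \<exists>K R0. \<forall>R\<ge>R0. \<forall>x\<in>\<H>. mass_limit - \<eta>' \<le> shadow_mass x R id \<longrightarrow>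
           (\<forall>w\<in>F. mass_limit - \<eta> \<le> shadow_mass (act w x) (R - K) id)"
  using assms(1,2)
proof (induction rule: finite_induct)
  case empty
  then show ?case by (auto intro: exI[of _ 1])
next
  case (insert w F)
  obtain \<eta>1 K1 R1 where 1: "\<eta>1 > 0" "\<And>R x. R \<ge> R1 \<Longrightarrow> x \<in> \<H> \<Longrightarrow> mass_limit - \<eta>1 \<le> shadow_mass x R id \<Longrightarrow>
           (\<forall>w\<in>F. mass_limit - \<eta> \<le> shadow_mass (act w x) (R - K1) id)"
    using insert by (metis insert_subset)
  obtain \<eta>2 K2 R2 where 2: "\<eta>2 > 0" "\<And>R x. R \<ge> R2 \<Longrightarrow> x \<in> \<H> \<Longrightarrow> mass_limit - \<eta>2 \<le> shadow_mass x R id \<Longrightarrow>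
           mass_limit - \<eta> \<le> shadow_mass (act w x) (R - K2) id"
    using mass_propagation[of w \<eta>] insert.prems assms(3) by (metis insert_subset)
  have mono: "shadow_mass z (R - K) id \<le> shadow_mass z (R - max K1 K2) id" if "K \<in> {K1, K2}" for z R K
  proof -
    have "R - max K1 K2 \<le> R - K" using that by auto
    from shadow_antimono[OF this] show ?thesis
      unfolding shadow_mass_id by (intro finite_measure_mono sets_shadow_id) auto
  qed
  have "\<forall>w\<in>insert w F. mass_limit - \<eta> \<le> shadow_mass (act w x) (R - max K1 K2) id"
    if "R \<ge> max R1 R2" "x \<in> \<H>" "mass_limit - min \<eta>1 \<eta>2 \<le> shadow_mass x R id" for R x
  proof
    fix v assume "v \<in> insert w F"
    then consider "v = w" | "v \<in> F" by auto
    then show "mass_limit - \<eta> \<le> shadow_mass (act v x) (R - max K1 K2) id"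
    proof cases
      case 1
      then show ?thesis using 2(2)[of R x] mono[of K2 "act v x" R] that by fastforce
    next
      case v: 2
      then have "mass_limit - \<eta> \<le> shadow_mass (act v x) (R - K1) id" using 1(2)[of R x] that by auto
      then show ?thesis using mono[of K1 "act v x" R] by fastforce
    qed
  qed
  moreover have "min \<eta>1 \<eta>2 > 0" using 1(1) 2(1) by simp
  ultimately show ?case by blast
qed

lemma linear_growth_power:
  assumes "linear_growth p g"
  shows "\<exists>n\<ge>1. \<forall>k\<ge>1. kappa p ((g ^^ n) ^^ k) > T"
proof -
  obtain A B where A: "A > 0" and B: "\<And>n. real n / A - B \<le> kappa p (g ^^ n)"
    using assms unfolding linear_growth_def by auto
  obtain n0 :: nat where n0: "real n0 > A * (T + B)" using reals_Archimedean2 by blast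
  define n where "n = Suc n0"
  have "kappa p ((g ^^ n) ^^ k) > T" if "k \<ge> 1" for k
  proof -
    have "n0 \<le> n * k" using that by (simp add: n_def) (metis One_nat_def le_add1 le_trans mult.commute mult_le_mono1 nat_mult_1 add.commute le_Suc_eq)
    then have "real (n * k) > A * (T + B)" using n0 by (metis less_le_trans of_nat_le_iff)
    then have "real (n * k) / A > T + B" using A by (simp add: field_simps)
    moreover have "(g ^^ n) ^^ k = g ^^ (n * k)" by (simp add: funpow_mult)
    ultimately show ?thesis using B[of "n * k"] by simp
  qed
  then show ?thesis by (intro exI[of _ n]) (auto simp: n_def)
qed

text \<open>A horofunction whose deep shadows have almost maximal mass is moved by the semigroup to others
  of this kind; if it is far from the limit points of \<open>g\<close>, then many of them have disjoint shadows.\<close>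

lemma mass_limit_zero: "mass_limit = 0"
proof (rule ccontr)
  assume "mass_limit \<noteq> 0"
  moreover have "mass_limit \<ge> 0"
    unfolding mass_limit_def using max_mass_bounds(1) by (intro cINF_greatest) auto
  ultimately have pos: "mass_limit > 0" by simp
  obtain g h where gh: "g \<in> generated_semigroup (set_pmf \<mu>)" "h \<in> generated_semigroup (set_pmf \<mu>)"
    "independent_loxodromics p g h"
    using non_elementary unfolding non_elementary_def by blast
  then have lox: "loxodromic g" "loxodromic h" by (auto simp: independent_loxodromics_def)
  then have I: "g \<in> Isom" "h \<in> Isom" by (auto simp: loxodromic_def)
  obtain C0 where C0: "\<And>a b m n. a \<in> {g, inv g} \<Longrightarrow> b \<in> {h, inv h} \<Longrightarrow> gromov_product p ((a ^^ m) p) ((b ^^ n) p) \<le> C0"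
    using independent_loxodromics_bounded[OF hyperbolic gh(3)] by meson
  \<comment> \<open>Products above \<open>C\<close> with an orbit point of \<open>g\<close> or
    \<open>inv g\<close> and with one of \<open>h\<close> or \<open>inv h\<close> would give these
    points a Gromov product above \<open>C0\<close>. So each \<open>x\<close> in \<open>\<H>\<close>
    is far from the limit points of \<open>g\<close> or from those of \<open>h\<close>.\<close>
  define C where "C = C0 + \<delta>"
  obtain ng where ng: "ng \<ge> 1" "\<And>k. k \<ge> 1 \<Longrightarrow> kappa p ((g ^^ ng) ^^ k) > 2 * C + 4 * \<delta>"
    using linear_growth_power[OF loxodromic_linear_growth(1)[OF lox(1)], where T = "2 * C + 4 * \<delta>"] by blast
  obtain nh where nh: "nh \<ge> 1" "\<And>k. k \<ge> 1 \<Longrightarrow> kappa p ((h ^^ nh) ^^ k) > 2 * C + 4 * \<delta>"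
    using linear_growth_power[OF loxodromic_linear_growth(1)[OF lox(2)], where T = "2 * C + 4 * \<delta>"] by blast
  define G where "G = g ^^ ng"
  define H where "H = h ^^ nh"
  have GH: "G \<in> generated_semigroup (set_pmf \<mu>)" "H \<in> generated_semigroup (set_pmf \<mu>)" "G \<in> Isom" "H \<in> Isom"
    using gh(1,2) ng(1) nh(1) I generated_semigroup_funpow unfolding G_def H_def by (auto simp: Suc_le_eq)
  \<comment> \<open>\<open>J\<close> disjoint shadows of mass at least \<open>mass_limit / 2\<close>
    would have a total mass above \<open>1\<close>.\<close>
  obtain J :: nat where J: "real J > 2 / mass_limit" using reals_Archimedean2 by blast
  \<comment> \<open>Which of the two orbits \<open>x\<close> avoids is known only once
    \<open>x\<close> is chosen, and that choice depends on the thresholds for \<open>F\<close>; so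
    the powers of both are propagated.\<close>
  define F where "F = (\<lambda>i. G ^^ i) ` {1..J} \<union> (\<lambda>i. H ^^ i) ` {1..J}"
  have F: "finite F" "F \<subseteq> generated_semigroup (set_pmf \<mu>)"
    unfolding F_def using generated_semigroup_funpow[OF GH(1)] generated_semigroup_funpow[OF GH(2)] by auto
  obtain \<eta>' K R0 where propagate: "\<eta>' > 0" "\<And>R x. R \<ge> R0 \<Longrightarrow> x \<in> \<H> \<Longrightarrow> mass_limit - \<eta>' \<le> shadow_mass x R id \<Longrightarrow>
           (\<forall>w\<in>F. mass_limit - mass_limit / 2 \<le> shadow_mass (act w x) (R - K) id)"
    using finite_mass_propagation[OF F, of "mass_limit / 2"] pos by (metis half_gt_zero)
  \<comment> \<open>After the loss \<open>K\<close> of the propagation, the depth is still at least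
    twice the displacement of every power up to \<open>J\<close>.\<close>
  define R where "R = max R0 (K + 2 * real J * (kappa p G + kappa p H))"
  have "mass_limit - \<eta>' < max_mass R" using mass_limit_le[of R] propagate(1) by linarith
  then obtain x where x: "x \<in> \<H>" "mass_limit - \<eta>' < shadow_mass x R id"
    using less_cSUP_iff[OF _ bdd_mass, of _ R] H_nonempty unfolding max_mass_def by blast
  have mass: "mass_limit / 2 \<le> shadow_mass (act w x) (R - K) id" if "w \<in> F" for w
    using propagate(2)[of R x] x that by (auto simp: R_def)
  have large: "R - K \<ge> 2 * kappa p (a ^^ k)" if a: "a \<in> {G, H}" and k: "k \<le> J" for a k
  proof -
    have "a \<in> Isom" using a GH by auto
    then have "kappa p (a ^^ k) \<le> real k * kappa p a" by (rule kappa_funpow)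
    also have "\<dots> \<le> real J * (kappa p G + kappa p H)"
      using a k kappa_nonneg[of p G] kappa_nonneg[of p H] by (intro mult_mono) auto
    finally show ?thesis unfolding R_def by simp
  qed
  have far: "(\<forall>k. point_product p x ((g ^^ k) p) \<le> C \<and> point_product p x ((inv g ^^ k) p) \<le> C) \<or>
    (\<forall>k. point_product p x ((h ^^ k) p) \<le> C \<and> point_product p x ((inv h ^^ k) p) \<le> C)"
  proof (rule ccontr)
    assume "\<not> ?thesis"
    then obtain a m b n where ab: "a \<in> {g, inv g}" "b \<in> {h, inv h}"
      "point_product p x ((a ^^ m) p) > C" "point_product p x ((b ^^ n) p) > C"
      by (meson insertCI not_le)
    then show False
      using point_product_min(1)[OF x(1), of "(a ^^ m) p" "(b ^^ n) p"] C0[OF ab(1,2), of m n]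
      by (auto simp: C_def min_def split: if_splits)
  qed
  have power: "(a ^^ n) ^^ k = a ^^ (n * k)" "inv (a ^^ n) ^^ k = inv a ^^ (n * k)" if "a \<in> Isom" for a :: "'a \<Rightarrow> 'a" and n k
    using that by (simp_all add: inv_funpow funpow_mult)
  have "real J * (mass_limit / 2) \<le> 1"
    using far
  proof
    assume "\<forall>k. point_product p x ((g ^^ k) p) \<le> C \<and> point_product p x ((inv g ^^ k) p) \<le> C"
    then have "\<And>k. point_product p x ((G ^^ k) p) \<le> C" "\<And>k. point_product p x ((inv G ^^ k) p) \<le> C"
      by (simp_all add: G_def power I)
    then show ?thesis
      using ng(2) large by (intro disjoint_mass_bound[OF GH(3) x(1), where R = "R - K"] mass) (auto simp: F_def G_def)
  next
    assume "\<forall>k. point_product p x ((h ^^ k) p) \<le> C \<and> point_product p x ((inv h ^^ k) p) \<le> C"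
    then have "\<And>k. point_product p x ((H ^^ k) p) \<le> C" "\<And>k. point_product p x ((inv H ^^ k) p) \<le> C"
      by (simp_all add: H_def power I)
    then show ?thesis
      using nh(2) large by (intro disjoint_mass_bound[OF GH(4) x(1), where R = "R - K"] mass) (auto simp: F_def H_def)
  qed
  then show False using J pos by (simp add: field_simps)
qed

section \<open>Exponential decay of the heaviest shadow\<close>

lemma max_mass_small: "\<eta> > 0 \<Longrightarrow> \<exists>Q\<ge>0. \<forall>R\<ge>Q. max_mass R < \<eta>"
proof -
  assume "\<eta> > 0"
  then obtain R where R: "max_mass R < \<eta>"
    using mass_limit_approx[of \<eta>] mass_limit_zero by auto
  then have "\<forall>R'\<ge>max R 0. max_mass R' < \<eta>" using max_mass_antimono by (meson le_less_trans max.boundedE)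
  then show ?thesis by (intro exI[of _ "max R 0"]) auto
qed

text \<open>A walk with bounded steps has to cross the shell \<open>R1 \<le> (x|u p) \<le> R1 + \<kappa>S\<close> before it enters a
  deeper shadow of \<open>x\<close>, and from the shell it returns to the complement of the shadow with
  probability at least \<open>2/3\<close>.\<close>

lemma max_mass_decay_step:
  assumes Q: "Q \<ge> 0" "max_mass Q \<le> 1/3" and R: "R \<ge> 2 * Q + 4 * \<delta> + 1"
  shows "max_mass R \<le> max_mass (R - (2 * Q + 2 * \<delta> + 1 + \<kappa>S)) / 2"
proof (rule max_mass_le)
  fix x assume x: "x \<in> \<H>"
  \<comment> \<open>The constant makes \<open>(R1 - Q) - 2 * \<delta> = Q + 1\<close>, so that
    \<open>shadowI_point_product\<close> with \<open>r = R1 - Q\<close> reaches the shadow of depth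
    \<open>Q\<close>.\<close>
  define R1 where "R1 = 2 * Q + 2 * \<delta> + 1"
  define a where "a = max_mass (R - R1 - \<kappa>S)"
  have a: "a \<ge> 0" "a \<le> 1" by (auto simp: a_def max_mass_bounds)
  have R1: "R1 \<ge> 0" "R1 + 2 * \<delta> \<le> R" using Q(1) delta_nonneg R by (auto simp: R1_def)
  define c where "c = 1 - max_mass Q"
  have c: "c \<ge> 2/3" using Q(2) by (simp add: c_def)
  have main: "shadow_mass x R id \<le> a / 2 + max_mass T" for T
  proof -
    define b where "b = max_mass T"
    have b: "b \<ge> 0" "b \<le> 1" by (auto simp: b_def max_mass_bounds)
    \<comment> \<open>The mass at depth \<open>R\<close> is compared with a harmonic majorant. On
      the shell it is at most \<open>a\<close>, while \<open>shadow_mass x Q u / c\<close> is at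
      least \<open>1\<close>; before the shell but far from \<open>p\<close> it is at most
      \<open>b\<close>. At \<open>id\<close> the quotient is at most \<open>(1/3) / (2/3)\<close>,
      whence the factor \<open>1/2\<close>.\<close>
    define e where "e u = shadow_mass x R u - (a * (shadow_mass x Q u / c) + b)" for u
    define U where "U = {u \<in> Isom. point_product p x (u p) \<le> R1 + \<kappa>S}"
    \<comment> \<open>Bounding the displacement lets one word \<open>w\<close>, with a displacement
      above twice the bound, lead out of \<open>D\<close> from every point.\<close>
    define D where "D = {u \<in> Isom. point_product p x (u p) < R1 \<and> kappa p u \<le> T + R1 + 2 * \<delta>}"
    obtain g where g: "g \<in> generated_semigroup (set_pmf \<mu>)" "loxodromic g"
      using non_elementary unfolding non_elementary_def independent_loxodromics_def by blast
    obtain n where n: "n \<ge> 1" "\<And>k. k \<ge> 1 \<Longrightarrow> kappa p ((g ^^ n) ^^ k) > 2 * (T + R1 + 2 * \<delta>)"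
      using linear_growth_power[OF loxodromic_linear_growth(1)[OF g(2)], where T = "2 * (T + R1 + 2 * \<delta>)"] by blast
    define w where "w = g ^^ n"
    have w: "w \<in> generated_semigroup (set_pmf \<mu>)" "w \<in> Isom" "kappa p w > 2 * (T + R1 + 2 * \<delta>)"
      using generated_semigroup_funpow[OF g(1), of n] n(1) n(2)[of 1] g(2)
      by (auto simp: w_def loxodromic_def)
    have "e id \<le> 0"
    proof (rule harmonic_nonpos[OF isometries, where e = e and U = U and D = D and w = w and B = 4])
      show "U \<subseteq> Isom" by (auto simp: U_def)
      show "\<bar>e u\<bar> \<le> 4" for u
      proof -
        have "a * (shadow_mass x Q u / c) \<le> 1 * (1 / (2/3))"
          using a c shadow_mass_bounds[of x Q u] by (intro mult_mono frac_le) auto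
        then have "a * (shadow_mass x Q u / c) \<le> 3/2" by simp
        moreover have "0 \<le> a * (shadow_mass x Q u / c)"
          using a c shadow_mass_bounds[of x Q u] by simp
        ultimately show ?thesis
          using shadow_mass_bounds[of x R u] b unfolding e_def by linarith
      qed
      show "e u = (\<integral>s. e (u \<circ> inv s) \<partial>measure_pmf \<mu>)" if "u \<in> D" for u
      proof -
        have u: "u \<in> Isom" using that by (simp add: D_def)
        have i: "integrable (measure_pmf \<mu>) (\<lambda>s. shadow_mass x r (u \<circ> inv s))" for r
          by (rule integrable_pmf_bounded[where B = 1]) (simp add: shadow_mass_bounds)
        show ?thesis
          unfolding e_def using i shadow_mass_harmonic[OF u, of x R] shadow_mass_harmonic[OF u, of x Q] by simp
      qed
      show "u \<circ> inv s \<in> U" if "u \<in> D" "s \<in> set_pmf \<mu>" for u s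
      proof -
        have u: "u \<in> Isom" "point_product p x (u p) < R1" using that by (auto simp: D_def)
        have s: "s \<in> Isom" using that isometries by auto
        have "dist ((u \<circ> inv s) p) (u p) = kappa p s"
          using Isom_dist[OF u(1), of "inv s p" p] kappa_inv[OF s, of p] by (simp add: kappa_def)
        then show ?thesis
          using point_product_lipschitz[OF x, of "(u \<circ> inv s) p" "u p"] u s kappa_le[OF that(2)]
          by (auto simp: U_def)
      qed
      show "e u \<le> 0" if "u \<in> U" "u \<notin> D" for u
      proof -
        have u: "u \<in> Isom" "point_product p x (u p) \<le> R1 + \<kappa>S" using that by (auto simp: U_def)
        show ?thesis
        proof (cases "point_product p x (u p) < R1")
          case False
          \<comment> \<open>An element \<open>y\<close> with a small product with
            \<open>inv u p\<close> is carried towards \<open>u p\<close>, which lies in the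
            direction of \<open>x\<close>; all \<open>y\<close> but a set of mass
            \<open>max_mass Q\<close> land in the shadow of depth \<open>Q\<close>.\<close>
          have "{y \<in> space \<nu>. \<not> Q < point_product p y (inv u p)} \<subseteq> {y \<in> space \<nu>. act u y \<in> shadow x Q}"
          proof safe
            fix y assume y: "y \<in> space \<nu>" "\<not> Q < point_product p y (inv u p)"
            have yH: "y \<in> \<H>" by (rule in_space_H[OF y(1)])
            have "kappa p u \<ge> R1" using point_product_bounds(2)[OF x, of "u p"] False by (simp add: kappa_def)
            then have "point_product p (act u y) (u p) \<ge> R1 - Q"
              using point_product_horo_action[OF yH u(1)] y(2) by simp
            then show "act u y \<in> shadow x Q"
              using False Q(1) delta_nonneg
              by (intro shadowI_point_product[OF geodesic x act_H[OF u(1) yH], where r = "R1 - Q" and m = "u p"])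
                (auto simp: R1_def)
          qed
          then have "measure \<nu> {y \<in> space \<nu>. \<not> Q < point_product p y (inv u p)} \<le> shadow_mass x Q u"
            unfolding shadow_mass_def by (rule finite_measure_mono[OF _ sets_shadow])
          moreover have "measure \<nu> {y \<in> space \<nu>. \<not> Q < point_product p y (inv u p)}
              = 1 - measure \<nu> {y \<in> space \<nu>. Q < point_product p y (inv u p)}"
            using prob_neg[of "\<lambda>y. Q < point_product p y (inv u p)"] sets_point_product by simp
          ultimately have "shadow_mass x Q u \<ge> c"
            using point_product_mass[of Q "inv u p"] by (simp add: c_def)
          then have "1 \<le> shadow_mass x Q u / c" using c by (simp add: field_simps)
          then have "a * 1 \<le> a * (shadow_mass x Q u / c)" using a by (intro mult_left_mono) auto
          moreover have "shadow_mass x R u \<le> a"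
            using shadow_mass_le_max[OF u(1) x u(2), of R] by (simp add: a_def diff_diff_eq)
          ultimately show ?thesis using b by (simp add: e_def)
        next
          case True
          then have k: "kappa p u > T + R1 + 2 * \<delta>" using that u by (auto simp: D_def)
          \<comment> \<open>As \<open>u p\<close> has a product below \<open>R1\<close> with
            \<open>x\<close>, an \<open>act u y\<close> deep in the shadow of \<open>x\<close> has a
            bounded product with \<open>u p\<close>. As \<open>u\<close> has a large displacement,
            \<open>y\<close> then has a large product with \<open>inv u p\<close>, which happens
            with mass at most \<open>max_mass T\<close>.\<close>
          have "{y \<in> space \<nu>. act u y \<in> shadow x R} \<subseteq> {y \<in> space \<nu>. T < point_product p y (inv u p)}"
          proof safe
            fix y assume y: "y \<in> space \<nu>" "act u y \<in> shadow x R"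
            have yH: "y \<in> \<H>" by (rule in_space_H[OF y(1)])
            have "point_product p (act u y) (u p) \<le> R1 + 2 * \<delta>"
              using shadow_point_product[OF x act_H[OF u(1) yH] y(2), of "u p"] True R1
              by (auto simp: min_def split: if_splits)
            then show "T < point_product p y (inv u p)"
              using point_product_horo_action[OF yH u(1)] k by simp
          qed
          then have "shadow_mass x R u \<le> measure \<nu> {y \<in> space \<nu>. T < point_product p y (inv u p)}"
            unfolding shadow_mass_def by (rule finite_measure_mono[OF _ sets_point_product])
          then have "shadow_mass x R u \<le> b"
            using point_product_mass[of T "inv u p"] by (simp add: b_def)
          moreover have "0 \<le> a * (shadow_mass x Q u / c)"
            using a c shadow_mass_bounds[of x Q u] by simp
          ultimately show ?thesis by (simp add: e_def)
        qed
      qed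
      show "w \<in> generated_semigroup (set_pmf \<mu>)" by fact
      show "u \<circ> inv w \<notin> D" if "u \<in> D" for u
        using that kappa_comp_ge[of u p "inv w"] w by (auto simp: D_def)
      have "point_product p x p = 0" using x by (simp add: point_product_def horofunctions_base)
      then show "id \<in> U" using R1 kappa_supp_nonneg by (simp add: U_def)
    qed
    moreover have "a * (shadow_mass x Q id / c) \<le> a * ((1/3) / (2/3))"
      using a c mass_le_max[OF x, of Q] Q(2) shadow_mass_bounds[of x Q id] 
      by (intro mult_left_mono frac_le) auto
    then have "a * (shadow_mass x Q id / c) \<le> a / 2" by simp
    ultimately show ?thesis unfolding e_def b_def by linarith
  qed
  \<comment> \<open>The depth \<open>T\<close> is free: letting it tend to infinity removes the term
    \<open>b\<close>, because the limiting mass is zero.\<close>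
  have *: "shadow_mass x R id \<le> a / 2 + \<eta>" if "\<eta> > 0" for \<eta>
  proof -
    obtain T where "max_mass T < \<eta>" using max_mass_small[OF \<open>\<eta> > 0\<close>] by blast
    then show ?thesis using main[of T] by linarith
  qed
  have eq: "R - (2 * Q + 2 * \<delta> + 1 + \<kappa>S) = R - R1 - \<kappa>S" by (simp add: R1_def)
  show "shadow_mass x R id \<le> max_mass (R - (2 * Q + 2 * \<delta> + 1 + \<kappa>S)) / 2"
    unfolding eq a_def[symmetric] by (rule field_le_epsilon[OF *])
qed

lemma max_mass_exponential: "\<exists>K>0. \<forall>j::nat. max_mass (real j * K) \<le> (1/2) ^ j"
proof -
  obtain Q where Q: "Q \<ge> 0" "max_mass Q \<le> 1/3"
    using max_mass_small[of "1/3"] by force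
  \<comment> \<open>Large enough both for the threshold in \<open>max_mass_decay_step\<close> and
    for the depth lost there.\<close>
  define K where "K = 2 * Q + 4 * \<delta> + 1 + \<kappa>S"
  have K: "K > 0" "2 * Q + 4 * \<delta> + 1 \<le> K" using Q(1) delta_nonneg kappa_supp_nonneg by (auto simp: K_def)
  have "max_mass (real j * K) \<le> (1/2) ^ j" for j
  proof (induction j)
    case (Suc j)
    have le: "K \<le> real (Suc j) * K" using K(1) by (simp add: algebra_simps)
    have "max_mass (real (Suc j) * K) \<le> max_mass (real (Suc j) * K - (2 * Q + 2 * \<delta> + 1 + \<kappa>S)) / 2"
      using le K(2) by (intro max_mass_decay_step[OF Q]) linarith
    also have "\<dots> \<le> max_mass (real j * K) / 2"
      using delta_nonneg by (intro divide_right_mono max_mass_antimono) (auto simp: K_def algebra_simps)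
    finally show ?case using Suc by simp
  qed (simp add: max_mass_bounds)
  then show ?thesis using K(1) by blast
qed

end

section \<open>The potential of the stationary measure\<close>

lemma less_horo_product_iff: "ereal R < horo_product x y \<longleftrightarrow> y \<in> shadow x R"
proof -
  have "ereal R < horo_product x y \<longleftrightarrow> (INF m. ereal (x m + y m)) / 2 < ereal (- R)"
    unfolding horo_product_def by (subst ereal_less_uminus_reorder) simp
  also have "\<dots> \<longleftrightarrow> (INF m. ereal (x m + y m)) < ereal (- 2 * R)"
    by (cases "INF m. ereal (x m + y m)") (auto simp: field_simps)
  also have "\<dots> \<longleftrightarrow> y \<in> shadow x R"
    by (simp add: INF_less_iff shadow_def)
  finally show ?thesis .
qed

text \<open>An infinite product is sent to \<open>0\<close>. For a fixed horofunction
  \<open>x\<close> this concerns only a null set of \<open>y\<close>, by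
  \<open>AE_product_finite\<close>.\<close>

definition product_real :: "('a::metric_space \<Rightarrow> real) \<Rightarrow> ('a \<Rightarrow> real) \<Rightarrow> real" where
  "product_real x y = enn2real (e2ennreal (horo_product x y))"

lemma product_real_nonneg [simp]: "0 \<le> product_real x y"
  by (simp add: product_real_def)

text \<open>Both sides are characterised by the shadows containing \<open>y\<close>.\<close>

lemma product_real_eqI:
  assumes fin: "e2ennreal (horo_product x y) \<noteq> \<infinity>" "e2ennreal (horo_product x' y') \<noteq> \<infinity>"
    and pos: "0 \<le> horo_product x y" "0 \<le> horo_product x' y'"
    and sh: "\<And>R. y \<in> shadow x R \<longleftrightarrow> y' \<in> shadow x' (R + d)"
  shows "product_real x' y' = product_real x y + d"
proof -
  have ne: "horo_product x y \<noteq> \<infinity>" "horo_product x' y' \<noteq> \<infinity>"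
    using fin by (auto simp: e2ennreal_infty)
  obtain a where a: "horo_product x y = ereal a" "a \<ge> 0"
    using ne pos by (cases "horo_product x y") auto
  obtain b where b: "horo_product x' y' = ereal b" "b \<ge> 0"
    using ne pos by (cases "horo_product x' y'") auto
  have *: "R < a \<longleftrightarrow> R + d < b" for R
    using sh[of R] unfolding less_horo_product_iff[symmetric] a b by simp
  have "b = a + d" using *[of a] *[of "b - d"] by simp
  then show ?thesis using a b by (simp add: product_real_def e2ennreal_ereal)
qed

context horofunction_walk
begin

definition nn_potential :: "('a \<Rightarrow> real) \<Rightarrow> ennreal" where
  "nn_potential x = (\<integral>\<^sup>+ y. e2ennreal (horo_product x y) \<partial>\<nu>)"

definition potential :: "('a \<Rightarrow> real) \<Rightarrow> real" where
  "potential x = enn2real (nn_potential x)"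

lemma space_base: "y \<in> space \<nu> \<Longrightarrow> y p = 0"
  by (auto simp: space_nu horo_compactification_eq)

lemma horo_product_nonneg:
  assumes "x \<in> space \<nu>" "y \<in> space \<nu>"
  shows "0 \<le> horo_product x y"
proof -
  have "ereal R < horo_product x y" if "R < 0" for R
    using that assms unfolding less_horo_product_iff shadow_def by (auto intro!: exI[of _ p] simp: space_base)
  then show ?thesis by (metis ereal_less(2) ereal_dense2 less_ereal.simps(1) not_le_imp_less order_less_imp_not_less zero_ereal_def)
qed

text \<open>The product is lower semicontinuous in \<open>y\<close>: its strict superlevel sets are
  shadows, which are open.\<close>

lemma measurable_horo_product: "horo_product x \<in> borel_measurable \<nu>"
proof -
  have o: "open {y. horo_product x y > z}" for z
  proof (cases z)
    case (real R)
    then show ?thesis using open_shadow[of x R] by (simp add: less_horo_product_iff)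
  next
    case PInf
    then show ?thesis by simp
  next
    case MInf
    have "{y. horo_product x y > - \<infinity>} = (\<Union>R. shadow x R)"
      by (auto simp flip: less_horo_product_iff dest: ereal_dense2 intro: less_trans)
        (metis ereal_dense2 less_ereal.simps(5) ereal_less_PInfty less_le_trans less_ereal.simps(4) MInfty_neq_ereal(1) ereal_infty_less(2))
    then show ?thesis by (simp add: MInf open_UN open_shadow)
  qed
  have "horo_product x \<in> borel_measurable borel"
    by (rule borel_measurableI_greater) (use o in simp)
  then show ?thesis by (rule borel_measurable_nu)
qed

lemma measurable_e2ennreal_product: "(\<lambda>y. e2ennreal (horo_product x y)) \<in> borel_measurable \<nu>"
  by (rule measurable_compose[OF measurable_horo_product measurable_e2ennreal])

text \<open>A layer-cake bound: if the product exceeds \<open>R\<close>, then \<open>y\<close> lies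
  in the shadows of depth \<open>0\<close>, \<open>K\<close>, \<open>2 * K\<close> and so on up to
  \<open>R\<close>, which are at least \<open>R / K\<close> in number. Approximation from below
  treats infinite products along with finite ones.\<close>

lemma product_le_sum:
  assumes K: "K > 0"
  shows "e2ennreal (horo_product x y) \<le> (\<Sum>j. ennreal K * indicator {y. y \<in> shadow x (real j * K)} y)"
proof (rule dense_le)
  fix z assume z: "z < e2ennreal (horo_product x y)"
  then have "z \<noteq> \<infinity>" by auto
  then obtain R where R: "z = ennreal R" "R \<ge> 0" by (cases z) auto
  have "ereal R < horo_product x y"
  proof (rule ccontr)
    assume "\<not> ?thesis"
    then have "e2ennreal (horo_product x y) \<le> e2ennreal (ereal R)" by (intro e2ennreal_mono) auto
    then show False using z R by (simp add: e2ennreal_ereal)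
  qed
  then have sh: "y \<in> shadow x R" by (simp add: less_horo_product_iff)
  define n where "n = nat \<lceil>R / K\<rceil>"
  have n: "R \<le> real n * K"
  proof -
    have "R / K \<le> real n" unfolding n_def by (rule of_nat_ceiling)
    then show ?thesis using K by (simp add: field_simps)
  qed
  have "y \<in> shadow x (real j * K)" if "j < n" for j
  proof -
    have "real j < R / K" using that unfolding n_def by linarith
    then have "real j * K \<le> R" using K by (simp add: field_simps)
    then show ?thesis using sh shadow_antimono by blast
  qed
  then have "(\<Sum>j<n. ennreal K * indicator {y. y \<in> shadow x (real j * K)} y) = (\<Sum>j<n. ennreal K)"
    by (intro sum.cong) auto
  also have "\<dots> = ennreal (real n * K)"
    using K by (simp add: ennreal_mult ennreal_of_nat_eq_real_of_nat)
  finally have "z \<le> (\<Sum>j<n. ennreal K * indicator {y. y \<in> shadow x (real j * K)} y)"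
    using n R by (simp add: ennreal_leI)
  also have "\<dots> \<le> (\<Sum>j. ennreal K * indicator {y. y \<in> shadow x (real j * K)} y)"
    by (rule sum_le_suminf) auto
  finally show "z \<le> (\<Sum>j. ennreal K * indicator {y. y \<in> shadow x (real j * K)} y)" .
qed

text \<open>Integrating the layer-cake bound turns the decay \<open>(1/2) ^ j\<close> of the shadows
  into a geometric series.\<close>

lemma nn_potential_bounded: "\<exists>B\<ge>0. \<forall>x\<in>\<H>. nn_potential x \<le> ennreal B"
proof -
  obtain K where K: "K > 0" "\<And>j. max_mass (real j * K) \<le> (1/2) ^ j"
    using max_mass_exponential by blast
  have "nn_potential x \<le> ennreal (2 * K)" if x: "x \<in> \<H>" for x
  proof -
    let ?S = "\<lambda>j. {y \<in> space \<nu>. y \<in> shadow x (real j * K)}"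
    have "nn_potential x \<le> (\<integral>\<^sup>+ y. (\<Sum>j. ennreal K * indicator (?S j) y) \<partial>\<nu>)"
      unfolding nn_potential_def
    proof (rule nn_integral_mono)
      fix y assume "y \<in> space \<nu>"
      then have "indicator (?S j) y = (indicator {y. y \<in> shadow x (real j * K)} y :: ennreal)" for j
        by (simp add: indicator_def)
      then show "e2ennreal (horo_product x y) \<le> (\<Sum>j. ennreal K * indicator (?S j) y)"
        using product_le_sum[OF K(1), of x y] by simp
    qed
    also have "\<dots> = (\<Sum>j. \<integral>\<^sup>+ y. ennreal K * indicator (?S j) y \<partial>\<nu>)"
      using sets_shadow_id by (intro nn_integral_suminf) simp
    also have "\<dots> = (\<Sum>j. ennreal K * ennreal (shadow_mass x (real j * K) id))"
      using sets_shadow_id by (intro suminf_cong) (simp add: nn_integral_cmult_indicator shadow_mass_id emeasure_eq_measure)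
    also have "\<dots> \<le> (\<Sum>j. ennreal (K * (1/2) ^ j))"
    proof (rule suminf_le)
      fix j
      have "shadow_mass x (real j * K) id \<le> (1/2) ^ j" using mass_le_max[OF x] K(2) by (rule order_trans)
      then have "K * shadow_mass x (real j * K) id \<le> K * (1/2) ^ j"
        using K(1) by (intro mult_left_mono) auto
      then show "ennreal K * ennreal (shadow_mass x (real j * K) id) \<le> ennreal (K * (1/2) ^ j)"
        using K(1) by (simp add: ennreal_leI shadow_mass_bounds flip: ennreal_mult)
    qed auto
    also have "\<dots> = ennreal (2 * K)"
    proof (rule suminf_ennreal_eq)
      show "(\<lambda>j. K * (1/2) ^ j) sums (2 * K)"
        using sums_mult[OF geometric_sums[of "1/2 :: real"], of K] by (simp add: mult.commute)
    qed (use K(1) in simp)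
    finally show ?thesis .
  qed
  then show ?thesis using K(1) by (intro exI[of _ "2 * K"]) auto
qed

lemma nn_potential_finite: "x \<in> \<H> \<Longrightarrow> nn_potential x = ennreal (potential x)"
proof -
  assume "x \<in> \<H>"
  then obtain B where "nn_potential x \<le> ennreal B" using nn_potential_bounded by blast
  then have "nn_potential x < \<infinity>" using ennreal_less_top le_less_trans by (metis infinity_ennreal_def)
  then show ?thesis by (simp add: potential_def)
qed

lemma potential_nonneg [simp]: "0 \<le> potential x"
  by (simp add: potential_def)

lemma psi_eq: "x \<in> \<H> \<Longrightarrow> psi \<nu> x = ereal (- 2 * potential x)"
  using nn_potential_finite[of x] unfolding psi_def nn_potential_def[symmetric]
  by (simp add: enn2ereal_ennreal)

definition \<c> :: real where "\<c> = real_of_ereal (frak_c p \<nu>)"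

lemma frak_c_finite: "frak_c p \<nu> < \<infinity>" and frak_c_eq: "frak_c p \<nu> = ereal \<c>"
proof -
  obtain B where B: "B \<ge> 0" "\<And>x. x \<in> \<H> \<Longrightarrow> nn_potential x \<le> ennreal B"
    using nn_potential_bounded by blast
  have "ereal (- 2 * B) \<le> psi \<nu> x" if "x \<in> horo_compactification p" for x
  proof -
    have x: "x \<in> \<H>" using that horo_compactification_subset[OF hyperbolic] by auto
    have "potential x \<le> B"
      using B(2)[OF x] nn_potential_finite[OF x] B(1) by simp
    then show ?thesis using psi_eq[OF x] by simp
  qed
  then have 1: "ereal (- 2 * B) \<le> (INF x\<in>horo_compactification p. psi \<nu> x)"
    by (rule INF_greatest)
  have "(INF x\<in>horo_compactification p. psi \<nu> x) \<le> psi \<nu> (horo p p)"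
    by (rule INF_lower) simp
  also have "\<dots> = ereal (- 2 * potential (horo p p))"
    by (rule psi_eq[OF H_nonempty])
  finally obtain r where "(INF x\<in>horo_compactification p. psi \<nu> x) = ereal r"
    using 1 by (cases "INF x\<in>horo_compactification p. psi \<nu> x") auto
  then show "frak_c p \<nu> < \<infinity>" "frak_c p \<nu> = ereal \<c>"
    by (auto simp: frak_c_def \<c>_def)
qed

lemma potential_le: "x \<in> space \<nu> \<Longrightarrow> 2 * potential x \<le> \<c>"
proof -
  assume x: "x \<in> space \<nu>"
  then have "(INF x\<in>horo_compactification p. psi \<nu> x) \<le> psi \<nu> x"
    by (intro INF_lower) (simp add: space_nu)
  then have "- psi \<nu> x \<le> frak_c p \<nu>" by (simp add: frak_c_def)
  then show ?thesis using psi_eq[OF in_space_H[OF x]] frak_c_eq by simp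
qed

lemma c_nonneg: "\<c> \<ge> 0"
proof -
  have "horo p p \<in> space \<nu>" by (simp add: space_nu)
  from potential_le[OF this] potential_nonneg[of "horo p p"] show ?thesis by linarith
qed

lemma AE_product_finite: "x \<in> \<H> \<Longrightarrow> AE y in \<nu>. e2ennreal (horo_product x y) \<noteq> \<infinity>"
  using nn_potential_finite[of x] unfolding nn_potential_def
  by (intro nn_integral_PInf_AE measurable_e2ennreal_product) simp

lemma measurable_product_real: "product_real x \<in> borel_measurable \<nu>"
  unfolding product_real_def by (intro borel_measurable_enn2real measurable_e2ennreal_product)

lemma nn_integral_product_real:
  assumes "x \<in> \<H>"
  shows "(\<integral>\<^sup>+ y. ennreal (product_real x y) \<partial>\<nu>) = ennreal (potential x)"
proof -
  have "(\<integral>\<^sup>+ y. ennreal (product_real x y) \<partial>\<nu>) = (\<integral>\<^sup>+ y. e2ennreal (horo_product x y) \<partial>\<nu>)"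
    using AE_product_finite[OF assms]
    by (intro nn_integral_cong_AE) (auto elim!: eventually_mono simp: product_real_def less_top)
  then show ?thesis using nn_potential_finite[OF assms] by (simp add: nn_potential_def)
qed

lemma integrable_product_real:
  assumes "x \<in> \<H>"
  shows "integrable \<nu> (product_real x)" "(\<integral>y. product_real x y \<partial>\<nu>) = potential x"
proof -
  have "0 \<le> product_real x y" for y by (simp add: product_real_def)
  then have "has_bochner_integral \<nu> (product_real x) (potential x)"
    using nn_integral_product_real[OF assms] measurable_product_real
    by (intro has_bochner_integral_nn_integral) auto
  then show "integrable \<nu> (product_real x)" "(\<integral>y. product_real x y \<partial>\<nu>) = potential x"
    by (auto simp: has_bochner_integral_iff)
qed

text \<open>Stationarity is given for bounded functions, but the product may be unbounded in
  \<open>y\<close>; truncation at \<open>k\<close> and monotone convergence on both sides extend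
  it.\<close>

lemma stationary_nn_integral:
  assumes u: "u \<in> borel_measurable \<nu>"
  shows "(\<integral>\<^sup>+ y. u y \<partial>\<nu>) = (\<integral>\<^sup>+ g. (\<integral>\<^sup>+ y. u (act (inv g) y) \<partial>\<nu>) \<partial>measure_pmf \<mu>)"
proof -
  have iso: "inv g \<in> Isom" if "g \<in> set_pmf \<mu>" for g using that isometries by auto
  have trunc: "(\<integral>\<^sup>+ y. min (u y) (of_nat k) \<partial>\<nu>) =
      (\<integral>\<^sup>+ g. (\<integral>\<^sup>+ y. min (u (act (inv g) y)) (of_nat k) \<partial>\<nu>) \<partial>measure_pmf \<mu>)" for k
  proof -
    define \<phi> where "\<phi> y = enn2real (min (u y) (of_nat k))" for y
    have fin: "min (u y) (of_nat k) < top" for y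
      by (simp add: min_less_iff_disj ennreal_of_nat_eq_real_of_nat)
    have \<phi>: "ennreal (\<phi> y) = min (u y) (of_nat k)" for y
      unfolding \<phi>_def using fin by simp
    have m: "\<phi> \<in> borel_measurable \<nu>" unfolding \<phi>_def using u by measurable
    have bd: "\<bar>\<phi> y\<bar> \<le> real k" for y
    proof -
      have "ennreal (\<phi> y) \<le> ennreal (real k)" unfolding \<phi> by (simp add: ennreal_of_nat_eq_real_of_nat)
      then have "\<phi> y \<le> real k" by simp
      moreover have "0 \<le> \<phi> y" by (simp add: \<phi>_def)
      ultimately show ?thesis by simp
    qed
    have pos: "0 \<le> \<phi> y" for y by (simp add: \<phi>_def)
    have i: "(\<integral>\<^sup>+ y. ennreal (\<phi> (f y)) \<partial>\<nu>) = ennreal (\<integral>y. \<phi> (f y) \<partial>\<nu>)" if "f \<in> measurable \<nu> \<nu>" for f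
      using bd pos by (intro nn_integral_eq_integral integrable_const_bound[where B = "real k"]
          measurable_compose[OF that m]) auto
    have ib: "\<bar>\<integral>y. \<phi> (act (inv g) y) \<partial>\<nu>\<bar> \<le> real k" if "g \<in> set_pmf \<mu>" for g
    proof -
      have int: "integrable \<nu> (\<lambda>y. \<phi> (act (inv g) y))"
        using bd by (intro integrable_const_bound[where B = "real k"] measurable_compose[OF measurable_act[OF iso[OF that]] m]) auto
      have "(\<integral>y. \<phi> (act (inv g) y) \<partial>\<nu>) \<le> (\<integral>y. real k \<partial>\<nu>)"
        using bd by (intro integral_mono int) (auto simp: abs_le_iff)
      moreover have "0 \<le> (\<integral>y. \<phi> (act (inv g) y) \<partial>\<nu>)" using pos by simp
      ultimately show ?thesis by (simp add: prob_space)
    qed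
    have "(\<integral>\<^sup>+ y. min (u y) (of_nat k) \<partial>\<nu>) = ennreal (\<integral>y. \<phi> y \<partial>\<nu>)"
      using i[of "\<lambda>y. y"] by (simp add: \<phi>)
    also have "\<dots> = ennreal (\<integral>g. (\<integral>y. \<phi> (act (inv g) y) \<partial>\<nu>) \<partial>measure_pmf \<mu>)"
      using bd by (subst stationary_integral[OF m]) auto
    also have "\<dots> = (\<integral>\<^sup>+ g. ennreal (\<integral>y. \<phi> (act (inv g) y) \<partial>\<nu>) \<partial>measure_pmf \<mu>)"
      using pos ib by (intro nn_integral_eq_integral[symmetric] integrable_pmf_bounded) auto
    also have "\<dots> = (\<integral>\<^sup>+ g. (\<integral>\<^sup>+ y. min (u (act (inv g) y)) (of_nat k) \<partial>\<nu>) \<partial>measure_pmf \<mu>)"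
      using i[OF measurable_act[OF iso]]
      by (intro nn_integral_cong_AE) (auto simp: AE_measure_pmf_iff \<phi>)
    finally show ?thesis .
  qed
  have sup: "(SUP k. min a (of_nat k)) = a" for a :: ennreal
  proof -
    have "(SUP k. min a (of_nat k)) = min a (SUP k. of_nat k)" by (simp add: inf_SUP flip: inf_min)
    then show ?thesis by (simp add: ennreal_SUP_of_nat_eq_top)
  qed
  have inc: "incseq (\<lambda>k. min (a :: ennreal) (of_nat k))" for a
    by (auto intro!: incseq_SucI min.mono)
  have mc: "(\<integral>\<^sup>+ y. u (f y) \<partial>\<nu>) = (SUP k. \<integral>\<^sup>+ y. min (u (f y)) (of_nat k) \<partial>\<nu>)" if f: "f \<in> measurable \<nu> \<nu>" for f
  proof -
    have "(\<lambda>y. u (f y)) \<in> borel_measurable \<nu>" by (rule measurable_compose[OF f u])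
    then have "(\<integral>\<^sup>+ y. (SUP k. min (u (f y)) (of_nat k)) \<partial>\<nu>) = (SUP k. \<integral>\<^sup>+ y. min (u (f y)) (of_nat k) \<partial>\<nu>)"
      using inc by (intro nn_integral_monotone_convergence_SUP) (auto simp: incseq_def le_fun_def)
    then show ?thesis by (simp add: sup)
  qed
  have "(\<integral>\<^sup>+ y. u y \<partial>\<nu>) = (SUP k. \<integral>\<^sup>+ y. min (u y) (of_nat k) \<partial>\<nu>)"
    using mc[of "\<lambda>y. y"] by simp
  also have "\<dots> = (SUP k. \<integral>\<^sup>+ g. (\<integral>\<^sup>+ y. min (u (act (inv g) y)) (of_nat k) \<partial>\<nu>) \<partial>measure_pmf \<mu>)"
    by (simp add: trunc)
  also have "\<dots> = (\<integral>\<^sup>+ g. (SUP k. \<integral>\<^sup>+ y. min (u (act (inv g) y)) (of_nat k) \<partial>\<nu>) \<partial>measure_pmf \<mu>)"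
    using inc by (intro nn_integral_monotone_convergence_SUP[symmetric]) (auto simp: incseq_def le_fun_def intro!: nn_integral_mono)
  also have "\<dots> = (\<integral>\<^sup>+ g. (\<integral>\<^sup>+ y. u (act (inv g) y) \<partial>\<nu>) \<partial>measure_pmf \<mu>)"
    using mc[OF measurable_act[OF iso]]
    by (intro nn_integral_cong_AE) (auto simp: AE_measure_pmf_iff)
  finally show ?thesis .
qed

section \<open>Centring the Busemann cocycle\<close>

definition mean_drift :: real where
  "mean_drift = (\<integral>g. (\<integral>y. y (g p) \<partial>\<nu>) \<partial>measure_pmf \<mu>)"

lemma measurable_eval: "(\<lambda>y. y m) \<in> borel_measurable \<nu>"
  by (intro borel_measurable_nu borel_measurable_continuous_onI continuous_intros)

lemma eval_le_kappa: "x \<in> \<H> \<Longrightarrow> \<bar>x (g p)\<bar> \<le> kappa p g"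
  using horofunctions_abs_le[of x \<delta> p "g p"] by (simp add: kappa_def)

lemma integrable_eval: "integrable \<nu> (\<lambda>y. y (g p))"
  using eval_le_kappa[OF in_space_H]
  by (intro integrable_const_bound[where B = "kappa p g"] measurable_eval) auto

text \<open>This is the substitution of \<open>g m\<close> for \<open>m\<close> in the infimum. It
  holds for almost every \<open>y\<close> only, since the value \<open>0\<close> that
  \<open>product_real\<close> takes at infinite products does not follow the shift.\<close>

lemma product_translate:
  assumes g: "g \<in> Isom" and x: "x \<in> space \<nu>"
  shows "AE y in \<nu>. product_real x (act (inv g) y) = product_real (act g x) y + (y (g p) - x (inv g p)) / 2"
proof -
  have gx: "act g x \<in> space \<nu>" by (rule act_space[OF g x])
  have "AE y in \<nu>. e2ennreal (horo_product (act g x) y) \<noteq> \<infinity>"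
    by (rule AE_product_finite[OF in_space_H[OF gx]])
  then show ?thesis
  proof (rule AE_mp, intro AE_I2 impI)
    fix y assume y: "y \<in> space \<nu>" and fin: "e2ennreal (horo_product (act g x) y) \<noteq> \<infinity>"
    have gy: "act (inv g) y \<in> space \<nu>" by (rule act_space[OF Isom_inv[OF g] y])
    have sh: "y \<in> shadow (act g x) R \<longleftrightarrow> act (inv g) y \<in> shadow x (R + (y (g p) - x (inv g p)) / 2)" for R
    proof -
      have "(\<exists>m. act g x m + y m < - 2 * R) \<longleftrightarrow> (\<exists>m. act g x (g m) + y (g m) < - 2 * R)"
        using Isom_f_inv[OF g] by metis
      also have "\<dots> \<longleftrightarrow> (\<exists>m. x m + act (inv g) y m < - 2 * (R + (y (g p) - x (inv g p)) / 2))"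
        using g by (intro ex_cong1) (auto simp: horo_action_def field_simps)
      finally show ?thesis by (simp add: shadow_def)
    qed
    have nonneg: "0 \<le> horo_product (act g x) y" "0 \<le> horo_product x (act (inv g) y)"
      using horo_product_nonneg gx y x gy by auto
    obtain a where a: "horo_product (act g x) y = ereal a"
      using fin nonneg(1) by (cases "horo_product (act g x) y") (auto simp: e2ennreal_infty)
    have "\<not> ereal (a + (y (g p) - x (inv g p)) / 2) < horo_product x (act (inv g) y)"
      using sh[of a] unfolding less_horo_product_iff[symmetric] a by simp
    then have fin': "e2ennreal (horo_product x (act (inv g) y)) \<noteq> \<infinity>"
      using nonneg(2) by (cases "horo_product x (act (inv g) y)") (auto simp: e2ennreal_ereal)
    show "product_real x (act (inv g) y) = product_real (act g x) y + (y (g p) - x (inv g p)) / 2"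
      by (rule product_real_eqI[OF fin fin' nonneg sh])
  qed
qed

text \<open>The Busemann cocycle becomes centred after adding the coboundary of \<open>\<psi> = - 2 potential\<close>.\<close>

lemma centred_cocycle:
  assumes x: "x \<in> space \<nu>"
  shows "(\<integral>s. x (inv s p) - 2 * potential (act s x) \<partial>measure_pmf \<mu>) = mean_drift - 2 * potential x"
proof -
  have iso: "g \<in> Isom" if "g \<in> set_pmf \<mu>" for g using that isometries by auto
  \<comment> \<open>The mean of \<open>F\<close> over \<open>\<mu>\<close> is
    \<open>potential x\<close> by stationarity, while \<open>product_translate\<close> expresses
    each \<open>F g\<close> by the potential at \<open>act g x\<close>. \<open>G g\<close> is the
    mean of the cocycle of \<open>inv g\<close>.\<close>
  define F where "F g = (\<integral>y. product_real x (act (inv g) y) \<partial>\<nu>)" for g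
  define G where "G g = (\<integral>y. y (g p) \<partial>\<nu>)" for g :: "'a \<Rightarrow> 'a"
  have F: "has_bochner_integral \<nu> (\<lambda>y. product_real x (act (inv g) y)) (potential (act g x) + (G g - x (inv g p)) / 2)"
    if "g \<in> set_pmf \<mu>" for g
  proof -
    have gx: "act g x \<in> \<H>" using act_space[OF iso[OF that] x] in_space_H by auto
    have "has_bochner_integral \<nu> (\<lambda>y. product_real (act g x) y + (y (g p) - x (inv g p)) / 2)
        (potential (act g x) + (G g - x (inv g p) * measure \<nu> (space \<nu>)) / 2)"
      unfolding G_def using integrable_product_real[OF gx] integrable_eval[of g]
      by (intro has_bochner_integral_add has_bochner_integral_divide_zero has_bochner_integral_diff)
        (auto simp: has_bochner_integral_iff)
    moreover have "(\<lambda>y. product_real x (act (inv g) y)) \<in> borel_measurable \<nu>"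
      by (rule measurable_compose[OF measurable_act[OF Isom_inv[OF iso[OF that]]] measurable_product_real])
    ultimately show ?thesis
      using product_translate[OF iso[OF that] x] integrable_product_real[OF gx] integrable_eval[of g]
      by (subst has_bochner_integral_cong_AE[of _ _ "\<lambda>y. product_real (act g x) y + (y (g p) - x (inv g p)) / 2"])
        (auto simp: prob_space intro!: borel_measurable_integrable)
  qed
  then have F_eq: "F g = potential (act g x) + (G g - x (inv g p)) / 2" if "g \<in> set_pmf \<mu>" for g
    using that by (simp add: F_def has_bochner_integral_iff)
  \<comment> \<open>The integrals are nonnegative ones because the integrability of \<open>F\<close>
    over \<open>\<mu>\<close> is itself deduced from this identity.\<close>
  have "(\<integral>\<^sup>+ g. ennreal (F g) \<partial>measure_pmf \<mu>) = (\<integral>\<^sup>+ g. (\<integral>\<^sup>+ y. ennreal (product_real x (act (inv g) y)) \<partial>\<nu>) \<partial>measure_pmf \<mu>)"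
    unfolding F_def
  proof (intro nn_integral_cong_AE, unfold AE_measure_pmf_iff, intro ballI)
    fix g assume "g \<in> set_pmf \<mu>"
    then have "integrable \<nu> (\<lambda>y. product_real x (act (inv g) y))"
      using F by (simp add: has_bochner_integral_iff)
    then show "ennreal (\<integral>y. product_real x (act (inv g) y) \<partial>\<nu>) = (\<integral>\<^sup>+ y. ennreal (product_real x (act (inv g) y)) \<partial>\<nu>)"
      by (intro nn_integral_eq_integral[symmetric] AE_I2 product_real_nonneg)
  qed
  also have "\<dots> = (\<integral>\<^sup>+ y. ennreal (product_real x y) \<partial>\<nu>)"
    using measurable_product_real by (intro stationary_nn_integral[symmetric]) auto
  also have "\<dots> = ennreal (potential x)"
    by (rule nn_integral_product_real[OF in_space_H[OF x]])
  finally have nnF: "(\<integral>\<^sup>+ g. ennreal (F g) \<partial>measure_pmf \<mu>) = ennreal (potential x)" .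
  have Fpos: "0 \<le> F g" for g unfolding F_def by (intro integral_nonneg_AE) (simp add: product_real_def)
  have intF: "has_bochner_integral (measure_pmf \<mu>) F (potential x)"
    using nnF Fpos by (intro has_bochner_integral_nn_integral) auto
  have G_bd: "\<bar>G g\<bar> \<le> \<kappa>S" if "g \<in> set_pmf \<mu>" for g
  proof -
    have "\<bar>G g\<bar> \<le> (\<integral>y. \<bar>y (g p)\<bar> \<partial>\<nu>)" unfolding G_def by (rule integral_abs_bound)
    also have "\<dots> \<le> (\<integral>y. \<kappa>S \<partial>\<nu>)"
      using eval_le_kappa[OF in_space_H, of _ g] kappa_le[OF that] integrable_eval[of g]
      by (intro integral_mono) (auto intro: order_trans)
    finally show ?thesis by (simp add: prob_space)
  qed
  have intG: "integrable (measure_pmf \<mu>) G"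
    using G_bd by (rule integrable_pmf_bounded)
  have "(\<integral>s. x (inv s p) - 2 * potential (act s x) \<partial>measure_pmf \<mu>) = (\<integral>s. G s - 2 * F s \<partial>measure_pmf \<mu>)"
    by (intro integral_cong_AE) (auto simp: AE_measure_pmf_iff F_eq field_simps)
  also have "\<dots> = mean_drift - 2 * potential x"
  proof -
    have "mean_drift = (\<integral>s. G s \<partial>measure_pmf \<mu>)" by (simp add: mean_drift_def G_def)
    then show ?thesis using intG intF by (simp add: has_bochner_integral_iff)
  qed
  finally show ?thesis .
qed

end

section \<open>The law of the walk\<close>

primrec walk_pmf :: "('a \<Rightarrow> 'a) pmf \<Rightarrow> nat \<Rightarrow> ('a \<Rightarrow> 'a) pmf" where
  "walk_pmf \<mu> 0 = return_pmf id"
| "walk_pmf \<mu> (Suc n) = bind_pmf (walk_pmf \<mu> n) (\<lambda>L. map_pmf (\<lambda>s. s \<circ> L) \<mu>)"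

text \<open>At each fixed time the left and the right walk have the same law, as the independent
  steps may be exchanged. This transfers tail bounds to the right walk, by which
  \<open>drift\<close> is defined.\<close>

lemma walk_pmf_Suc_right:
  "walk_pmf \<mu> (Suc n) = bind_pmf (walk_pmf \<mu> n) (\<lambda>L. map_pmf (\<lambda>s. L \<circ> s) \<mu>)"
proof (induction n)
  case 0
  show ?case by (simp add: bind_return_pmf)
next
  case (Suc n)
  have "walk_pmf \<mu> (Suc (Suc n)) = bind_pmf (walk_pmf \<mu> n) (\<lambda>K. bind_pmf \<mu> (\<lambda>t. bind_pmf \<mu> (\<lambda>s. return_pmf (s \<circ> (K \<circ> t)))))"
    by (subst walk_pmf.simps(2), subst Suc) (simp add: map_pmf_def bind_assoc_pmf bind_return_pmf)
  also have "\<dots> = bind_pmf (walk_pmf \<mu> n) (\<lambda>K. bind_pmf \<mu> (\<lambda>s. bind_pmf \<mu> (\<lambda>t. return_pmf (s \<circ> (K \<circ> t)))))"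
    by (subst bind_commute_pmf) simp
  also have "\<dots> = bind_pmf (walk_pmf \<mu> (Suc n)) (\<lambda>L. map_pmf (\<lambda>s. L \<circ> s) \<mu>)"
    by (simp add: map_pmf_def bind_assoc_pmf bind_return_pmf o_assoc)
  finally show ?case .
qed

lemma left_walk_cong: "(\<And>i. i \<in> {1..n} \<Longrightarrow> x i = y i) \<Longrightarrow> left_walk x n = left_walk y n"
  by (induction n) auto

lemma right_walk_cong: "(\<And>i. i \<in> {1..n} \<Longrightarrow> x i = y i) \<Longrightarrow> right_walk x n = right_walk y n"
  by (induction n) auto

lemma map_Pi_pmf_Suc:
  "map_pmf h (Pi_pmf {1..Suc n} d (\<lambda>_. \<mu>)) =
     bind_pmf (Pi_pmf {1..n} d (\<lambda>_. \<mu>)) (\<lambda>f. map_pmf (\<lambda>s. h (f(Suc n := s))) \<mu>)"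
proof -
  have "{1..Suc n} = insert (Suc n) {1..n}" by auto
  then have "map_pmf h (Pi_pmf {1..Suc n} d (\<lambda>_. \<mu>)) =
      map_pmf h (map_pmf (\<lambda>(y, f). f(Suc n := y)) (pair_pmf \<mu> (Pi_pmf {1..n} d (\<lambda>_. \<mu>))))"
    by (simp add: Pi_pmf_insert)
  also have "\<dots> = bind_pmf \<mu> (\<lambda>s. bind_pmf (Pi_pmf {1..n} d (\<lambda>_. \<mu>)) (\<lambda>f. return_pmf (h (f(Suc n := s)))))"
    by (simp add: map_pmf_def pair_pmf_def bind_assoc_pmf bind_return_pmf)
  finally show ?thesis
    by (subst (asm) bind_commute_pmf) (simp add: map_pmf_def)
qed

lemma map_left_walk_Pi_pmf: "map_pmf (\<lambda>x. left_walk x n) (Pi_pmf {1..n} id (\<lambda>_. \<mu>)) = walk_pmf \<mu> n"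
proof (induction n)
  case (Suc n)
  have "left_walk (f(Suc n := s)) n = left_walk f n" for f :: "nat \<Rightarrow> 'a \<Rightarrow> 'a" and s
    by (rule left_walk_cong) auto
  then show ?case
    unfolding map_Pi_pmf_Suc walk_pmf.simps(2) Suc[symmetric] by (simp add: bind_map_pmf)
qed (simp add: id_def)

lemma map_right_walk_Pi_pmf: "map_pmf (\<lambda>x. right_walk x n) (Pi_pmf {1..n} id (\<lambda>_. \<mu>)) = walk_pmf \<mu> n"
proof (induction n)
  case (Suc n)
  have "right_walk (f(Suc n := s)) n = right_walk f n" for f :: "nat \<Rightarrow> 'a \<Rightarrow> 'a" and s
    by (rule right_walk_cong) auto
  then show ?case
    unfolding map_Pi_pmf_Suc walk_pmf_Suc_right Suc[symmetric] by (simp add: bind_map_pmf)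
qed (simp add: id_def)

text \<open>The group need not be countable, so maps of several steps are measurable only after a
  modification on a null set.\<close>

lemma iid_steps_law:
  assumes steps: "iid_steps P \<mu> X"
  shows "\<exists>F \<in> measurable P (count_space UNIV).
    distr P (count_space UNIV) F = measure_pmf (Pi_pmf {1..n} d (\<lambda>_. \<mu>)) \<and>
    (AE \<omega> in P. F \<omega> = (\<lambda>i. if i \<in> {1..n} then X i \<omega> else d))"
proof -
  interpret prob_space P using steps by (simp add: iid_steps_def)
  have indep: "indep_vars (\<lambda>_. count_space UNIV) X {1..}"
    and law: "\<And>i. i \<ge> 1 \<Longrightarrow> distr P (count_space UNIV) (X i) = measure_pmf \<mu>"
    using steps by (auto simp: iid_steps_def)
  have X: "X i \<in> measurable P (count_space UNIV)" if "i \<ge> 1" for i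
    using indep that by (auto simp: indep_vars_def2)
  define H where "H \<omega> = (\<lambda>i. if i \<in> {1..n} then X i \<omega> else d)" for \<omega>
  define B where "B = set_pmf (Pi_pmf {1..n} d (\<lambda>_. \<mu>))"
  have B_eq: "B = PiE_dflt {1..n} d (\<lambda>_. set_pmf \<mu>)"
    unfolding B_def by (subst set_Pi_pmf) (auto simp: o_def)
  have cB: "countable B" unfolding B_def by (rule countable_set_pmf)
  obtain b0 where b0: "b0 \<in> B" unfolding B_def using set_pmf_not_empty by fast
  have Hset: "{\<omega> \<in> space P. H \<omega> = b} = {\<omega> \<in> space P. \<forall>i\<in>{1..n}. X i \<omega> = b i}" if "b \<in> B" for b
    using that unfolding B_eq PiE_dflt_def H_def by (auto simp: fun_eq_iff split: if_splits)
  have Xeq: "{\<omega> \<in> space P. X i \<omega> = c} \<in> sets P" if "i \<ge> 1" for i c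
    using measurable_sets[OF X[OF that], of "{c}"] by (simp add: vimage_def Int_def conj_commute)
  have Hm: "{\<omega> \<in> space P. H \<omega> = b} \<in> sets P" if "b \<in> B" for b
    unfolding Hset[OF that] using Xeq by (intro sets.sets_Collect_finite_All) auto
  have HBm: "{\<omega> \<in> space P. H \<omega> \<in> B} \<in> sets P"
  proof -
    have "{\<omega> \<in> space P. H \<omega> \<in> B} = (\<Union>b\<in>B. {\<omega> \<in> space P. H \<omega> = b})" by auto
    then show ?thesis using sets.countable_UN''[OF cB Hm] by simp
  qed
  have AEB: "AE \<omega> in P. H \<omega> \<in> B"
  proof -
    have "AE \<omega> in P. X i \<omega> \<in> set_pmf \<mu>" if "1 \<le> i" for i
    proof (rule AE_distrD[OF X])
      show "1 \<le> i" by fact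
      show "AE s in distr P (count_space UNIV) (X i). s \<in> set_pmf \<mu>"
        unfolding law[OF \<open>1 \<le> i\<close>] by (rule AE_measure_pmf)
    qed
    then have "AE \<omega> in P. \<forall>i\<in>{1..n}. X i \<omega> \<in> set_pmf \<mu>" by (simp add: AE_ball_countable)
    then show ?thesis by (rule AE_mp) (auto simp: B_eq PiE_dflt_def H_def)
  qed
  have prob_H: "prob {\<omega> \<in> space P. H \<omega> = b} = (\<Prod>i\<in>{1..n}. pmf \<mu> (b i))" if b: "b \<in> B" for b
  proof (cases "n = 0")
    \<comment> \<open>For \<open>n = 0\<close> the intersection over the empty index set would be
      the whole type instead of \<open>space P\<close>, so independence is applied for positive
      \<open>n\<close>.\<close>
    case True
    then show ?thesis unfolding Hset[OF b] by (simp add: prob_space)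
  next
    case False
    have "prob {\<omega> \<in> space P. X i \<omega> = c} = pmf \<mu> c" if "i \<ge> 1" for i c
    proof -
      have "pmf \<mu> c = measure (distr P (count_space UNIV) (X i)) {c}"
        using law[OF that] by (simp add: pmf.rep_eq)
      also have "\<dots> = prob {\<omega> \<in> space P. X i \<omega> = c}"
        using X[OF that] by (subst measure_distr) (auto intro!: arg_cong[of _ _ prob])
      finally show ?thesis by simp
    qed
    moreover have "{\<omega> \<in> space P. \<forall>i\<in>{1..n}. X i \<omega> = b i} = (\<Inter>i\<in>{1..n}. X i -` {b i} \<inter> space P)"
      using False by auto
    moreover have "X i -` {c} \<inter> space P = {\<omega> \<in> space P. X i \<omega> = c}" for i c by auto
    ultimately show ?thesis
      unfolding Hset[OF b] using False indep_varsD[OF indep, of "{1..n}" "\<lambda>i. {b i}"]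
      by (simp cong: prod.cong_simp)
  qed
  \<comment> \<open>The fibres of \<open>H\<close> over the countable set \<open>B\<close> are
    measurable; off \<open>B\<close>, on a null event, the value is replaced by a fixed element of
    \<open>B\<close>.\<close>
  define F where "F \<omega> = (if H \<omega> \<in> B then H \<omega> else b0)" for \<omega>
  have FH: "AE \<omega> in P. F \<omega> = H \<omega>" using AEB by (rule AE_mp) (auto simp: F_def)
  have F: "F \<in> measurable P (count_space UNIV)"
  proof (rule measurable_compose[of F P "count_space B" "\<lambda>x. x"])
    show "F \<in> measurable P (count_space B)"
    proof (subst measurable_count_space_eq_countable[OF cB], intro conjI ballI)
      show "F \<in> space P \<rightarrow> B" using b0 by (auto simp: F_def)
      fix b assume b: "b \<in> B"
      have "F -` {b} \<inter> space P = {\<omega> \<in> space P. H \<omega> = b} \<union> (if b = b0 then space P - {\<omega> \<in> space P. H \<omega> \<in> B} else {})"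
        using b b0 by (auto simp: F_def)
      then show "F -` {b} \<inter> space P \<in> sets P" using Hm[OF b] HBm by auto
    qed
  qed simp
  have "distr P (count_space UNIV) F = measure_pmf (Pi_pmf {1..n} d (\<lambda>_. \<mu>))"
  proof (rule measure_eqI_countable_AE[where \<Omega> = B])
    show "AE x in distr P (count_space UNIV) F. x \<in> B"
      using b0 by (subst AE_distr_iff[OF F]) (auto simp: F_def)
    show "AE x in measure_pmf (Pi_pmf {1..n} d (\<lambda>_. \<mu>)). x \<in> B"
      unfolding B_def by (rule AE_measure_pmf)
    fix b assume b: "b \<in> B"
    have "emeasure (distr P (count_space UNIV) F) {b} = emeasure P (F -` {b} \<inter> space P)"
      using F by (simp add: emeasure_distr)
    also have "\<dots> = emeasure P {\<omega> \<in> space P. H \<omega> = b}"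
      using FH measurable_sets[OF F, of "{b}"] Hm[OF b] by (intro emeasure_eq_AE) (auto elim!: eventually_mono)
    also have "\<dots> = ennreal (\<Prod>i\<in>{1..n}. pmf \<mu> (b i))"
      by (simp add: emeasure_eq_measure prob_H[OF b])
    also have "\<dots> = emeasure (measure_pmf (Pi_pmf {1..n} d (\<lambda>_. \<mu>))) {b}"
      using b by (subst emeasure_pmf_single, subst pmf_Pi') (auto simp: B_eq PiE_dflt_def)
    finally show "emeasure (distr P (count_space UNIV) F) {b} = emeasure (measure_pmf (Pi_pmf {1..n} d (\<lambda>_. \<mu>))) {b}" .
  qed (auto simp: cB)
  then show ?thesis using F FH unfolding H_def by blast
qed

lemma iid_walk_law:
  assumes steps: "iid_steps P \<mu> X"
    and walk: "walk \<in> {left_walk, right_walk}"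
  shows "\<exists>F \<in> measurable P (count_space UNIV). distr P (count_space UNIV) F = measure_pmf (walk_pmf \<mu> n) \<and>
    (AE \<omega> in P. F \<omega> = walk (\<lambda>i. X i \<omega>) n)"
proof -
  obtain F where F: "F \<in> measurable P (count_space UNIV)"
    "distr P (count_space UNIV) F = measure_pmf (Pi_pmf {1..n} id (\<lambda>_. \<mu>))"
    "AE \<omega> in P. F \<omega> = (\<lambda>i. if i \<in> {1..n} then X i \<omega> else id)"
    using iid_steps_law[OF steps, of n id] by blast
  let ?w = "\<lambda>x. walk x n"
  have "distr P (count_space UNIV) (?w \<circ> F) = distr (distr P (count_space UNIV) F) (count_space UNIV) ?w"
    using F(1) by (subst distr_distr) auto
  also have "\<dots> = measure_pmf (map_pmf ?w (Pi_pmf {1..n} id (\<lambda>_. \<mu>)))"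
    by (simp add: F(2) map_pmf_rep_eq)
  also have "\<dots> = measure_pmf (walk_pmf \<mu> n)"
    using walk map_left_walk_Pi_pmf[of n \<mu>] map_right_walk_Pi_pmf[of n \<mu>] by auto
  finally have "distr P (count_space UNIV) (?w \<circ> F) = measure_pmf (walk_pmf \<mu> n)" .
  moreover have "AE \<omega> in P. (?w \<circ> F) \<omega> = walk (\<lambda>i. X i \<omega>) n"
    using F(3)
  proof (rule AE_mp, intro AE_I2 impI)
    fix \<omega> assume "F \<omega> = (\<lambda>i. if i \<in> {1..n} then X i \<omega> else id)"
    then show "(?w \<circ> F) \<omega> = walk (\<lambda>i. X i \<omega>) n"
      using walk by (auto intro: left_walk_cong right_walk_cong)
  qed
  moreover have "?w \<circ> F \<in> measurable P (count_space UNIV)" by (rule measurable_comp[OF F(1)]) simp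
  ultimately show ?thesis by blast
qed

text \<open>Only an inequality, because the event need not be measurable; \<open>measure\<close>
  then gives it the value \<open>0\<close>.\<close>

lemma prob_left_walk_le:
  assumes steps: "iid_steps P \<mu> X"
  shows "measure P {\<omega> \<in> space P. left_walk (\<lambda>i. X i \<omega>) n \<in> A} \<le> measure_pmf.prob (walk_pmf \<mu> n) A"
proof (cases "{\<omega> \<in> space P. left_walk (\<lambda>i. X i \<omega>) n \<in> A} \<in> sets P")
  case True
  interpret prob_space P using steps by (simp add: iid_steps_def)
  obtain F where F: "F \<in> measurable P (count_space UNIV)"
    "distr P (count_space UNIV) F = measure_pmf (walk_pmf \<mu> n)" "AE \<omega> in P. F \<omega> = left_walk (\<lambda>i. X i \<omega>) n"
    using iid_walk_law[OF steps, of left_walk n] by blast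
  have "prob {\<omega> \<in> space P. left_walk (\<lambda>i. X i \<omega>) n \<in> A} = prob (F -` A \<inter> space P)"
    using F(3) True measurable_sets[OF F(1), of A] by (intro finite_measure_eq_AE) (auto elim!: eventually_mono)
  also have "\<dots> = measure (distr P (count_space UNIV) F) A"
    using F(1) by (simp add: measure_distr)
  finally show ?thesis by (simp add: F(2))
qed (simp add: measure_notin_sets)

section \<open>Exponential moments\<close>

lemma pmf_hoeffding:
  fixes f :: "'b \<Rightarrow> real"
  assumes "\<And>s. s \<in> set_pmf \<mu> \<Longrightarrow> f s \<in> {a..a + D}" "l > 0"
  shows "(\<integral>\<^sup>+ s. ennreal (exp (l * (f s - (\<integral>s. f s \<partial>measure_pmf \<mu>)))) \<partial>measure_pmf \<mu>) \<le> ennreal (exp (l\<^sup>2 * D\<^sup>2 / 8))"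
proof -
  interpret interval_bounded_random_variable "measure_pmf \<mu>" f a "a + D"
    by unfold_locales (use assms(1) in \<open>auto simp: AE_measure_pmf_iff\<close>)
  show ?thesis using Hoeffdings_lemma_nn_integral[OF assms(2)] by simp
qed

text \<open>Given \<open>L\<close>, the next step contributes a factor of at most
  \<open>exp (l\<^sup>2 * D\<^sup>2 / 8)\<close> by Hoeffding's lemma; the interval may depend on
  \<open>L\<close>, only its length is common. The support is carried along in the induction because
  the hypotheses on mean and range hold on \<open>I\<close> only.\<close>

lemma walk_exp_moment:
  fixes V :: "('a \<Rightarrow> 'a) \<Rightarrow> real"
  assumes I: "id \<in> I" "\<And>L s. L \<in> I \<Longrightarrow> s \<in> set_pmf \<mu> \<Longrightarrow> s \<circ> L \<in> I"
    and mean: "\<And>L. L \<in> I \<Longrightarrow> (\<integral>s. V (s \<circ> L) \<partial>measure_pmf \<mu>) = V L + m"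
    and range: "\<And>L. L \<in> I \<Longrightarrow> \<exists>a. \<forall>s\<in>set_pmf \<mu>. V (s \<circ> L) \<in> {a..a + D}"
    and l: "l > 0"
  shows "set_pmf (walk_pmf \<mu> n) \<subseteq> I \<and>
    (\<integral>\<^sup>+ L. ennreal (exp (l * (V L - V id - real n * m))) \<partial>measure_pmf (walk_pmf \<mu> n))
      \<le> ennreal (exp (real n * (l\<^sup>2 * D\<^sup>2 / 8)))"
proof (induction n)
  case 0
  show ?case using I(1) by (simp add: id_def)
next
  case (Suc n)
  let ?W = "measure_pmf (walk_pmf \<mu> n)"
  have sub: "set_pmf (walk_pmf \<mu> n) \<subseteq> I" using Suc by blast
  have one: "(\<integral>\<^sup>+ s. ennreal (exp (l * (V (s \<circ> L) - V id - real (Suc n) * m))) \<partial>measure_pmf \<mu>)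
      \<le> ennreal (exp (l * (V L - V id - real n * m))) * ennreal (exp (l\<^sup>2 * D\<^sup>2 / 8))" if L: "L \<in> I" for L
  proof -
    obtain a where a: "\<forall>s\<in>set_pmf \<mu>. V (s \<circ> L) \<in> {a..a + D}" using range[OF L] by blast
    have "(\<integral>\<^sup>+ s. ennreal (exp (l * (V (s \<circ> L) - V id - real (Suc n) * m))) \<partial>measure_pmf \<mu>)
        = (\<integral>\<^sup>+ s. ennreal (exp (l * (V L - V id - real n * m))) * ennreal (exp (l * (V (s \<circ> L) - (V L + m)))) \<partial>measure_pmf \<mu>)"
      by (intro nn_integral_cong) (simp add: algebra_simps flip: ennreal_mult exp_add)
    also have "\<dots> = ennreal (exp (l * (V L - V id - real n * m))) * (\<integral>\<^sup>+ s. ennreal (exp (l * (V (s \<circ> L) - (V L + m)))) \<partial>measure_pmf \<mu>)"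
      by (rule nn_integral_cmult) simp
    also have "\<dots> \<le> ennreal (exp (l * (V L - V id - real n * m))) * ennreal (exp (l\<^sup>2 * D\<^sup>2 / 8))"
      using pmf_hoeffding[of \<mu> "\<lambda>s. V (s \<circ> L)" a D l] a l mean[OF L] by (intro mult_left_mono) auto
    finally show ?thesis .
  qed
  have "(\<integral>\<^sup>+ L. ennreal (exp (l * (V L - V id - real (Suc n) * m))) \<partial>measure_pmf (walk_pmf \<mu> (Suc n)))
      = (\<integral>\<^sup>+ L. \<integral>\<^sup>+ s. ennreal (exp (l * (V (s \<circ> L) - V id - real (Suc n) * m))) \<partial>measure_pmf \<mu> \<partial>?W)"
    by simp
  also have "\<dots> \<le> (\<integral>\<^sup>+ L. ennreal (exp (l * (V L - V id - real n * m))) * ennreal (exp (l\<^sup>2 * D\<^sup>2 / 8)) \<partial>?W)"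
    using one sub by (intro nn_integral_mono_AE) (auto simp: AE_measure_pmf_iff)
  also have "\<dots> = (\<integral>\<^sup>+ L. ennreal (exp (l * (V L - V id - real n * m))) \<partial>?W) * ennreal (exp (l\<^sup>2 * D\<^sup>2 / 8))"
    by (rule nn_integral_multc) simp
  also have "\<dots> \<le> ennreal (exp (real n * (l\<^sup>2 * D\<^sup>2 / 8))) * ennreal (exp (l\<^sup>2 * D\<^sup>2 / 8))"
    by (intro mult_right_mono conjunct2[OF Suc]) auto
  also have "\<dots> = ennreal (exp (real (Suc n) * (l\<^sup>2 * D\<^sup>2 / 8)))"
    by (simp add: algebra_simps add_divide_distrib flip: ennreal_mult exp_add)
  finally have "(\<integral>\<^sup>+ L. ennreal (exp (l * (V L - V id - real (Suc n) * m))) \<partial>measure_pmf (walk_pmf \<mu> (Suc n)))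
      \<le> ennreal (exp (real (Suc n) * (l\<^sup>2 * D\<^sup>2 / 8)))" .
  moreover have "set_pmf (walk_pmf \<mu> (Suc n)) \<subseteq> I" using sub I(2) by auto
  ultimately show ?case by blast
qed

lemma walk_tail:
  fixes V :: "('a \<Rightarrow> 'a) \<Rightarrow> real"
  assumes I: "id \<in> I" "\<And>L s. L \<in> I \<Longrightarrow> s \<in> set_pmf \<mu> \<Longrightarrow> s \<circ> L \<in> I"
    and mean: "\<And>L. L \<in> I \<Longrightarrow> (\<integral>s. V (s \<circ> L) \<partial>measure_pmf \<mu>) = V L + m"
    and range: "\<And>L. L \<in> I \<Longrightarrow> \<exists>a. \<forall>s\<in>set_pmf \<mu>. V (s \<circ> L) \<in> {a..a + D}"
    and D: "D > 0" and n: "n > 0" and \<epsilon>: "\<epsilon> > 0"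
  shows "measure_pmf.prob (walk_pmf \<mu> n) {L. \<epsilon> \<le> V L - V id - real n * m} \<le> exp (- (2 * \<epsilon>\<^sup>2 / (real n * D\<^sup>2)))"
proof -
  \<comment> \<open>The minimiser of the exponent
    \<open>- l * \<epsilon> + n * l\<^sup>2 * D\<^sup>2 / 8\<close> that Markov's inequality
    gives.\<close>
  define l where "l = 4 * \<epsilon> / (real n * D\<^sup>2)"
  have l: "l > 0" using D n \<epsilon> by (simp add: l_def)
  let ?W = "measure_pmf (walk_pmf \<mu> n)" and ?A = "{L. \<epsilon> \<le> V L - V id - real n * m}"
  have "emeasure ?W ?A = (\<integral>\<^sup>+ L. indicator ?A L \<partial>?W)" by simp
  also have "\<dots> \<le> (\<integral>\<^sup>+ L. ennreal (exp (- l * \<epsilon>)) * ennreal (exp (l * (V L - V id - real n * m))) \<partial>?W)"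
  proof (rule nn_integral_mono)
    fix L
    have "1 \<le> exp (- l * \<epsilon> + l * (V L - V id - real n * m))" if "L \<in> ?A"
    proof -
      have "l * \<epsilon> \<le> l * (V L - V id - real n * m)" using that l by (intro mult_left_mono) auto
      then show ?thesis by simp
    qed
    then show "indicator ?A L \<le> ennreal (exp (- l * \<epsilon>)) * ennreal (exp (l * (V L - V id - real n * m)))"
      by (auto simp: indicator_def simp flip: ennreal_mult exp_add)
  qed
  also have "\<dots> = ennreal (exp (- l * \<epsilon>)) * (\<integral>\<^sup>+ L. ennreal (exp (l * (V L - V id - real n * m))) \<partial>?W)"
    by (rule nn_integral_cmult) simp
  also have "\<dots> \<le> ennreal (exp (- l * \<epsilon>)) * ennreal (exp (real n * (l\<^sup>2 * D\<^sup>2 / 8)))"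
    by (intro mult_left_mono conjunct2[OF walk_exp_moment[OF I mean range l]]) auto
  also have "\<dots> = ennreal (exp (- l * \<epsilon> + real n * (l\<^sup>2 * D\<^sup>2 / 8)))"
    by (simp flip: ennreal_mult exp_add)
  also have "- l * \<epsilon> + real n * (l\<^sup>2 * D\<^sup>2 / 8) = - (2 * \<epsilon>\<^sup>2 / (real n * D\<^sup>2))"
    using D n unfolding l_def by (simp add: field_simps power2_eq_square)
  finally show ?thesis
    unfolding measure_pmf.emeasure_eq_measure by (subst (asm) ennreal_le_iff) auto
qed

section \<open>Concentration of the cocycle and identification of the drift\<close>

context horofunction_walk
begin

text \<open>Otherwise the whole semigroup would fix \<open>p\<close>, against the linear growth
  along a loxodromic element.\<close>

lemma kappa_supp_pos: "\<kappa>S > 0"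
proof (rule ccontr)
  assume "\<not> \<kappa>S > 0"
  then have z: "kappa p s = 0" if "s \<in> set_pmf \<mu>" for s
    using kappa_le[OF that] kappa_nonneg[of p s] by linarith
  have zero: "kappa p w = 0" if "w \<in> generated_semigroup (set_pmf \<mu>)" for w
    using that
  proof (induction rule: generated_semigroup.induct)
    case (composition g h)
    then show ?case by (simp add: kappa_def)
  qed (rule z)
  obtain g where g: "g \<in> generated_semigroup (set_pmf \<mu>)" "loxodromic g"
    using non_elementary unfolding non_elementary_def independent_loxodromics_def by blast
  obtain n where n: "n \<ge> 1" "\<And>k. k \<ge> 1 \<Longrightarrow> kappa p ((g ^^ n) ^^ k) > 0"
    using linear_growth_power[OF loxodromic_linear_growth(1)[OF g(2)], where T = 0] by blast
  show False
    using n(2)[of 1] zero[OF generated_semigroup_funpow[OF g(1), of n]] n(1) by simp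
qed

text \<open>If \<open>real n * t \<ge> 2 * \<c>\<close>, the coboundary term, at most
  \<open>\<c>\<close> in absolute value, takes up at most half of the deviation and leaves
  \<open>real n * t / 2\<close> to the Hoeffding bound. For smaller \<open>t\<close> the right-hand
  side exceeds \<open>1\<close>.\<close>

lemma cocycle_tail:
  assumes x: "x \<in> space \<nu>" and t: "t > 0"
  shows "measure_pmf.prob (walk_pmf \<mu> n) {L. \<bar>x (inv L p) - real n * mean_drift\<bar> \<ge> real n * t}
    \<le> 2 * exp (- (real n * t\<^sup>2 / (32 * (\<kappa>S + \<c>)\<^sup>2)))"
proof (cases "real n * t < 2 * \<c> \<or> n = 0")
  case True
  \<comment> \<open>This makes the right-hand side at least \<open>2 * (1 - 1/8)\<close>, more than
    any probability.\<close>
  have "real n * t\<^sup>2 / (32 * (\<kappa>S + \<c>)\<^sup>2) \<le> 1 / 8"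
  proof (cases "n = 0")
    case False
    then have lt: "real n * t < 2 * \<c>" and n1: "1 \<le> real n" using True by auto
    have "real n * t\<^sup>2 \<le> (real n * t)\<^sup>2"
      using n1 t by (simp add: power2_eq_square mult_mono mult_le_cancel_right1)
    also have "\<dots> \<le> (2 * (\<kappa>S + \<c>))\<^sup>2"
      using lt t n1 kappa_supp_nonneg by (intro power_mono) auto
    finally have "real n * t\<^sup>2 \<le> 4 * (\<kappa>S + \<c>)\<^sup>2" by (simp only: power_mult_distrib) simp
    moreover have "(\<kappa>S + \<c>)\<^sup>2 > 0" using kappa_supp_pos c_nonneg by simp
    ultimately show ?thesis by (simp add: field_simps)
  qed simp
  then have "1 - 1/8 \<le> exp (- (real n * t\<^sup>2 / (32 * (\<kappa>S + \<c>)\<^sup>2)))"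
    using exp_ge_add_one_self[of "- (real n * t\<^sup>2 / (32 * (\<kappa>S + \<c>)\<^sup>2))"] by linarith
  moreover have "measure_pmf.prob (walk_pmf \<mu> n) {L. \<bar>x (inv L p) - real n * mean_drift\<bar> \<ge> real n * t} \<le> 1"
    by simp
  ultimately show ?thesis by linarith
next
  case False
  then have nt: "real n * t \<ge> 2 * \<c>" and n: "n > 0" by auto
  define V where "V L = x (inv L p) - 2 * potential (act L x)" for L
  \<comment> \<open>Given \<open>L\<close>, the next value of \<open>V\<close> lies in an interval
    of length \<open>2 * \<kappa>S + \<c>\<close>: the cocycle of a step is within
    \<open>\<kappa>S\<close> of \<open>0\<close>, and twice the potential is between
    \<open>0\<close> and \<open>\<c>\<close>. \<open>D\<close> rounds this up to a multiple of
    \<open>\<kappa>S + \<c>\<close>.\<close>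
  define D where "D = 2 * (\<kappa>S + \<c>)"
  have D: "D > 0" using kappa_supp_pos c_nonneg by (simp add: D_def)
  have iso: "s \<in> Isom" if "s \<in> set_pmf \<mu>" for s using that isometries by auto
  have V_step: "V (s \<circ> L) = x (inv L p) + (act L x (inv s p) - 2 * potential (act s (act L x)))"
    if "L \<in> Isom" "s \<in> Isom" for L s
    using that by (simp add: V_def horo_action_comp Isom_inv_comp) (simp add: horo_action_def)
  have I: "id \<in> Isom" "\<And>L s. L \<in> Isom \<Longrightarrow> s \<in> set_pmf \<mu> \<Longrightarrow> s \<circ> L \<in> Isom"
    using iso by auto
  have V_range: "\<exists>a. \<forall>s\<in>set_pmf \<mu>. V (s \<circ> L) \<in> {a..a + D}" if L: "L \<in> Isom" for L
  proof (intro exI ballI)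
    fix s assume s: "s \<in> set_pmf \<mu>"
    have Lx: "act L x \<in> space \<nu>" by (rule act_space[OF L x])
    have "\<bar>act L x (inv s p)\<bar> \<le> \<kappa>S"
      using eval_le_kappa[OF in_space_H[OF Lx], of "inv s"] kappa_le[OF s] iso[OF s] by simp
    then have "act L x (inv s p) \<le> \<kappa>S" "- \<kappa>S \<le> act L x (inv s p)"
      by (auto simp: abs_le_iff)
    moreover have "2 * potential (act s (act L x)) \<le> \<c>" "0 \<le> potential (act s (act L x))"
      using potential_le[OF act_space[OF iso[OF s] Lx]] by auto
    ultimately show "V (s \<circ> L) \<in> {x (inv L p) - \<kappa>S - \<c>..x (inv L p) - \<kappa>S - \<c> + D}"
      using c_nonneg kappa_supp_nonneg unfolding V_step[OF L iso[OF s]] D_def atLeastAtMost_iff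
      by argo
  qed
  have V_mean: "(\<integral>s. V (s \<circ> L) \<partial>measure_pmf \<mu>) = V L + mean_drift" if L: "L \<in> Isom" for L
  proof -
    have Lx: "act L x \<in> space \<nu>" by (rule act_space[OF L x])
    have "integrable (measure_pmf \<mu>) (\<lambda>s. act L x (inv s p) - 2 * potential (act s (act L x)))"
    proof (rule integrable_pmf_bounded[where B = "\<kappa>S + \<c>"])
      fix s assume s: "s \<in> set_pmf \<mu>"
      have "\<bar>act L x (inv s p)\<bar> \<le> \<kappa>S"
        using eval_le_kappa[OF in_space_H[OF Lx], of "inv s"] kappa_le[OF s] iso[OF s] by simp
      moreover have "2 * potential (act s (act L x)) \<le> \<c>" "0 \<le> potential (act s (act L x))"
        using potential_le[OF act_space[OF iso[OF s] Lx]] by auto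
      ultimately show "\<bar>act L x (inv s p) - 2 * potential (act s (act L x))\<bar> \<le> \<kappa>S + \<c>"
        unfolding abs_le_iff by linarith
    qed
    then have "(\<integral>s. x (inv L p) + (act L x (inv s p) - 2 * potential (act s (act L x))) \<partial>measure_pmf \<mu>)
        = V L + mean_drift"
      using centred_cocycle[OF Lx] by (simp add: V_def)
    moreover have "(\<integral>s. V (s \<circ> L) \<partial>measure_pmf \<mu>)
        = (\<integral>s. x (inv L p) + (act L x (inv s p) - 2 * potential (act s (act L x))) \<partial>measure_pmf \<mu>)"
      using iso by (intro integral_cong_AE) (auto simp: AE_measure_pmf_iff V_step[OF L])
    ultimately show ?thesis by simp
  qed
  define \<epsilon> where "\<epsilon> = real n * t / 2"
  have \<epsilon>: "\<epsilon> > 0" using n t by (simp add: \<epsilon>_def)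
  define E where "E = exp (- (2 * \<epsilon>\<^sup>2 / (real n * D\<^sup>2)))"
  have upper: "measure_pmf.prob (walk_pmf \<mu> n) {L. \<epsilon> \<le> V L - V id - real n * mean_drift} \<le> E"
    unfolding E_def by (rule walk_tail[OF I V_mean V_range D n \<epsilon>])
  have lower: "measure_pmf.prob (walk_pmf \<mu> n) {L. \<epsilon> \<le> - V L - (- V id) - real n * (- mean_drift)} \<le> E"
    unfolding E_def
  proof (rule walk_tail[OF I _ _ D n \<epsilon>])
    fix L :: "'a \<Rightarrow> 'a" assume L: "L \<in> Isom"
    show "(\<integral>s. - V (s \<circ> L) \<partial>measure_pmf \<mu>) = - V L + (- mean_drift)"
      using V_mean[OF L] by simp
    obtain a where "\<forall>s\<in>set_pmf \<mu>. V (s \<circ> L) \<in> {a..a + D}" using V_range[OF L] by blast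
    then show "\<exists>a. \<forall>s\<in>set_pmf \<mu>. - V (s \<circ> L) \<in> {a..a + D}"
      by (intro exI[of _ "- a - D"]) auto
  qed
  have Vid: "V id = - 2 * potential x"
    using space_base[OF x] by (simp add: V_def horo_action_id)
  have supp: "set_pmf (walk_pmf \<mu> n) \<subseteq> Isom"
    using walk_exp_moment[OF I V_mean V_range, of 1 n] by simp
  have pot: "0 \<le> 2 * potential (act L x)" "2 * potential (act L x) \<le> \<c>" "0 \<le> 2 * potential x" "2 * potential x \<le> \<c>"
    if "L \<in> Isom" for L
    using potential_le[OF act_space[OF that x]] potential_le[OF x] by auto
  let ?U = "{L. \<epsilon> \<le> V L - V id - real n * mean_drift}"
  let ?L = "{L. \<epsilon> \<le> - V L - (- V id) - real n * (- mean_drift)}"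
  let ?A = "{L. \<bar>x (inv L p) - real n * mean_drift\<bar> \<ge> real n * t}"
  have "L \<in> ?U \<union> ?L" if "L \<in> ?A" "L \<in> Isom" for L
  proof -
    have "real n * t \<le> x (inv L p) - real n * mean_drift \<or> real n * t \<le> real n * mean_drift - x (inv L p)"
      using that(1) by (auto simp: abs_if split: if_splits)
    then show ?thesis
    proof (elim disjE, goal_cases)
      case 1
      then have "\<epsilon> \<le> V L - V id - real n * mean_drift"
        using pot[OF that(2)] nt unfolding \<epsilon>_def Vid unfolding V_def by linarith
      then show ?thesis by blast
    next
      case 2
      then have "\<epsilon> \<le> - V L - (- V id) - real n * (- mean_drift)"
        using pot[OF that(2)] nt unfolding \<epsilon>_def Vid mult_minus_right unfolding V_def by linarith
      then show ?thesis by blast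
    qed
  qed
  then have "measure_pmf.prob (walk_pmf \<mu> n) ?A \<le> measure_pmf.prob (walk_pmf \<mu> n) (?U \<union> ?L)"
    using supp by (intro measure_pmf.finite_measure_mono_AE) (auto simp: AE_measure_pmf_iff)
  also have "\<dots> \<le> measure_pmf.prob (walk_pmf \<mu> n) ?U + measure_pmf.prob (walk_pmf \<mu> n) ?L"
    by (rule measure_Un_le) auto
  also have "\<dots> \<le> 2 * E" using upper lower by linarith
  also have "E \<le> exp (- (real n * t\<^sup>2 / (32 * (\<kappa>S + \<c>)\<^sup>2)))"
  proof -
    have "2 * \<epsilon>\<^sup>2 / (real n * D\<^sup>2) = real n * t\<^sup>2 / (8 * (\<kappa>S + \<c>)\<^sup>2)"
    proof -
      have 1: "D\<^sup>2 = 4 * (\<kappa>S + \<c>)\<^sup>2" unfolding D_def by (simp only: power_mult_distrib) simp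
      have 2: "\<epsilon>\<^sup>2 = real n * (real n * t\<^sup>2) / 4" by (simp add: \<epsilon>_def power2_eq_square)
      show ?thesis unfolding 1 2 using n by simp
    qed
    also have "\<dots> \<ge> real n * t\<^sup>2 / (32 * (\<kappa>S + \<c>)\<^sup>2)"
      using kappa_supp_pos c_nonneg by (intro divide_left_mono) auto
    finally show ?thesis by (simp add: E_def)
  qed
  finally show ?thesis by simp
qed

text \<open>The displacement is the cocycle at the horofunction of the base point, so this is a case
  of \<open>cocycle_tail\<close>.\<close>

lemma kappa_tail:
  assumes "t > 0"
  shows "measure_pmf.prob (walk_pmf \<mu> n) {L. \<bar>kappa p L - real n * mean_drift\<bar> \<ge> real n * t}
    \<le> 2 * exp (- (real n * t\<^sup>2 / (32 * (\<kappa>S + \<c>)\<^sup>2)))"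
proof -
  have h: "horo p p \<in> space \<nu>" by (simp add: space_nu)
  have supp: "set_pmf (walk_pmf \<mu> n) \<subseteq> Isom"
  proof (induction n)
    case (Suc n)
    then show ?case using isometries by (auto intro!: Isom_comp)
  qed simp
  have "horo p p (inv L p) = kappa p L" if "L \<in> Isom" for L
    using kappa_inv[OF that, of p] by (simp add: horo_def kappa_def dist_commute)
  then have "measure_pmf.prob (walk_pmf \<mu> n) {L. \<bar>kappa p L - real n * mean_drift\<bar> \<ge> real n * t}
      = measure_pmf.prob (walk_pmf \<mu> n) {L. \<bar>horo p p (inv L p) - real n * mean_drift\<bar> \<ge> real n * t}"
    using supp by (intro measure_pmf.finite_measure_eq_AE) (auto simp: AE_measure_pmf_iff)
  then show ?thesis using cocycle_tail[OF h assms, of n] by simp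
qed

text \<open>The tail bounds are summable in \<open>n\<close>, so Borel-Cantelli applies at each
  precision. It involves only the laws at single times, which the left and the right walk share.
  \<open>F n\<close> is a measurable version of the walk at time \<open>n\<close>.\<close>

lemma kappa_right_walk_limit:
  assumes steps: "iid_steps P \<mu> X"
  shows "AE \<omega> in P. (\<lambda>n. kappa p (right_walk (\<lambda>i. X i \<omega>) n) / real n) \<longlonglongrightarrow> mean_drift"
proof -
  interpret P: prob_space P using steps by (simp add: iid_steps_def)
  have "\<forall>n. \<exists>F. F \<in> measurable P (count_space UNIV) \<and> distr P (count_space UNIV) F = measure_pmf (walk_pmf \<mu> n) \<and>
      (AE \<omega> in P. F \<omega> = right_walk (\<lambda>i. X i \<omega>) n)"
    using iid_walk_law[OF steps, of right_walk] by blast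
  from choice[OF this] obtain F where F: "\<And>n. F n \<in> measurable P (count_space UNIV)"
    "\<And>n. distr P (count_space UNIV) (F n) = measure_pmf (walk_pmf \<mu> n)"
    "\<And>n. AE \<omega> in P. F n \<omega> = right_walk (\<lambda>i. X i \<omega>) n"
    by blast
  have ev: "AE \<omega> in P. eventually (\<lambda>n. \<bar>kappa p (F n \<omega>) - real n * mean_drift\<bar> < real n * t) sequentially"
    if t: "t > 0" for t
  proof -
    define A where "A n = {L. \<bar>kappa p L - real n * mean_drift\<bar> \<ge> real n * t}" for n
    define r where "r = exp (- (t\<^sup>2 / (32 * (\<kappa>S + \<c>)\<^sup>2)))"
    have "t\<^sup>2 / (32 * (\<kappa>S + \<c>)\<^sup>2) > 0" using t kappa_supp_pos c_nonneg by simp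
    then have r: "0 < r" "r < 1" by (auto simp: r_def)
    have bound: "P.prob (F n -` A n \<inter> space P) \<le> 2 * r ^ n" for n
    proof -
      have "P.prob (F n -` A n \<inter> space P) = measure (distr P (count_space UNIV) (F n)) (A n)"
        using F(1) by (simp add: measure_distr)
      also have "\<dots> = measure_pmf.prob (walk_pmf \<mu> n) (A n)" by (simp add: F(2))
      also have "\<dots> \<le> 2 * exp (- (real n * t\<^sup>2 / (32 * (\<kappa>S + \<c>)\<^sup>2)))"
        unfolding A_def by (rule kappa_tail[OF t])
      also have "exp (- (real n * t\<^sup>2 / (32 * (\<kappa>S + \<c>)\<^sup>2))) = r ^ n"
        by (simp add: r_def flip: exp_of_nat_mult)
      finally show ?thesis .
    qed
    have "summable (\<lambda>n. P.prob (F n -` A n \<inter> space P))"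
    proof (rule summable_comparison_test')
      show "summable (\<lambda>n. 2 * r ^ n)" using r by (intro summable_mult summable_geometric) simp
      show "norm (P.prob (F n -` A n \<inter> space P)) \<le> 2 * r ^ n" if "n \<ge> 0" for n
        using bound[of n] by simp
    qed
    then have "AE \<omega> in P. eventually (\<lambda>n. \<omega> \<in> space P - (F n -` A n \<inter> space P)) sequentially"
      using measurable_sets[OF F(1)] by (intro borel_cantelli_AE1) (auto simp: P.emeasure_eq_measure)
    then show ?thesis
      by (rule AE_mp) (auto simp: A_def elim!: eventually_mono)
  qed
  have "AE \<omega> in P. \<forall>m. eventually (\<lambda>n. \<bar>kappa p (F n \<omega>) - real n * mean_drift\<bar> < real n * inverse (real (Suc m))) sequentially"
    using ev by (subst AE_all_countable) simp
  moreover have "AE \<omega> in P. \<forall>n. F n \<omega> = right_walk (\<lambda>i. X i \<omega>) n"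
    using F(3) by (subst AE_all_countable) simp
  ultimately show ?thesis
  proof eventually_elim
    case (elim \<omega>)
    show ?case
    proof (rule tendstoI)
      fix e :: real assume "e > 0"
      then obtain m where m: "inverse (real (Suc m)) < e" using reals_Archimedean by blast
      show "\<forall>\<^sub>F n in sequentially. dist (kappa p (right_walk (\<lambda>i. X i \<omega>) n) / real n) mean_drift < e"
        using elim(1)[rule_format, of m] eventually_gt_at_top[of 0]
      proof eventually_elim
        case (elim n)
        have "kappa p (F n \<omega>) / real n - mean_drift = (kappa p (F n \<omega>) - real n * mean_drift) / real n"
          using elim(2) by (simp add: field_simps)
        then have "\<bar>kappa p (F n \<omega>) / real n - mean_drift\<bar> = \<bar>kappa p (F n \<omega>) - real n * mean_drift\<bar> / real n"
          by (simp add: abs_divide)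
        also have "\<dots> < inverse (real (Suc m))"
          using elim by (simp add: field_simps)
        finally show ?case
          using m \<open>\<forall>n. F n \<omega> = right_walk (\<lambda>i. X i \<omega>) n\<close> by (simp add: dist_real_def)
      qed
    qed
  qed
qed

text \<open>The limit is taken for the coordinate process on the product space in the definition of
  \<open>drift\<close>. Two almost sure limits agree at some point of a probability space, which
  gives the uniqueness that \<open>THE\<close> requires.\<close>

lemma drift_eq: "drift p \<mu> = mean_drift"
proof -
  let ?P = "Pi\<^sub>M (UNIV :: nat set) (\<lambda>_. measure_pmf \<mu>)"
  interpret P: prob_space ?P by (intro prob_space_PiM measure_pmf.prob_space_axioms)
  have comp: "distr ?P (count_space UNIV) (\<lambda>x. x i) = measure_pmf \<mu>" for i
  proof -
    have "distr ?P (measure_pmf \<mu>) (\<lambda>x. x i) = measure_pmf \<mu>"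
      by (rule distr_PiM_component) (auto intro: measure_pmf.prob_space_axioms)
    moreover have "distr ?P (count_space UNIV) (\<lambda>x. x i) = distr ?P (measure_pmf \<mu>) (\<lambda>x. x i)"
      by (rule distr_cong) auto
    ultimately show ?thesis by simp
  qed
  have "iid_steps ?P \<mu> (\<lambda>i x. x i)"
    unfolding iid_steps_def
  proof (intro conjI allI impI)
    show "prob_space ?P" by (rule P.prob_space_axioms)
    have rv: "(\<lambda>x. x i) \<in> measurable ?P (count_space UNIV)" for i
    proof -
      have "(\<lambda>x. x i) \<in> measurable ?P (measure_pmf \<mu>)" by (rule measurable_component_singleton) simp
      then show ?thesis by simp
    qed
    have "P.indep_vars (\<lambda>_. count_space UNIV) (\<lambda>i x. x i) UNIV"
    proof (subst P.indep_vars_iff_distr_eq_PiM')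
      have "distr ?P (Pi\<^sub>M UNIV (\<lambda>_. count_space UNIV)) (\<lambda>x. \<lambda>i\<in>UNIV. x i) = distr ?P ?P (\<lambda>x. x)"
        by (intro distr_cong sets_PiM_cong) auto
      then show "distr ?P (Pi\<^sub>M UNIV (\<lambda>_. count_space UNIV)) (\<lambda>x. \<lambda>i\<in>UNIV. x i) = Pi\<^sub>M UNIV (\<lambda>i. distr ?P (count_space UNIV) (\<lambda>x. x i))"
        by (simp add: comp)
    qed (auto intro: rv)
    then show "P.indep_vars (\<lambda>_. count_space UNIV) (\<lambda>i x. x i) {1..}"
      by (rule P.indep_vars_subset) simp
  qed (rule comp)
  from kappa_right_walk_limit[OF this]
  have lim: "AE x in ?P. (\<lambda>n. kappa p (right_walk x n) / real n) \<longlonglongrightarrow> mean_drift" by simp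
  show ?thesis
    unfolding drift_def
  proof (rule the_equality)
    show "AE x in ?P. (\<lambda>n. kappa p (right_walk x n) / real n) \<longlonglongrightarrow> mean_drift" by (rule lim)
    fix l assume "AE x in ?P. (\<lambda>n. kappa p (right_walk x n) / real n) \<longlonglongrightarrow> l"
    with lim have "AE x in ?P. l = mean_drift"
      by eventually_elim (rule LIMSEQ_unique)
    then show "l = mean_drift" by simp
  qed
qed

end

theorem proposition3p4:
  fixes p :: "'a::metric_space"
    and \<delta> :: real
    and \<mu> :: "('a \<Rightarrow> 'a) pmf"
    and \<nu> :: "('a \<Rightarrow> real) measure"
    and P :: "'w measure"
    and X :: "nat \<Rightarrow> 'w \<Rightarrow> 'a \<Rightarrow> 'a"
  assumes separable: "separable_space (euclidean :: 'a topology)"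
    and geodesic: "geodesic_space TYPE('a)"
    and hyperbolic: "hyperbolic \<delta> TYPE('a)"
    and isometries: "set_pmf \<mu> \<subseteq> Isom"
    and bounded: "bounded_support p \<mu>"
    and non_elementary: "non_elementary p \<mu>"
    and stationary: "stationary_horo_measure p (map_pmf inv \<mu>) \<nu>"
    and steps: "iid_steps P \<mu> X"
  shows "frak_c p \<nu> < \<infinity> \<and>
    (\<forall>t>0. \<forall>n::nat.
      (SUP \<xi>\<in>horo_compactification p.
          \<P>(\<omega> in P. \<bar>busemann_cocycle p (left_walk (\<lambda>i. X i \<omega>) n) \<xi> - real n * drift p \<mu>\<bar> \<ge> real n * t))
        \<le> 2 * exp (- (real n * t\<^sup>2 / (32 * (kappa_supp p \<mu> + real_of_ereal (frak_c p \<nu>))\<^sup>2))) \<and>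
      \<P>(\<omega> in P. \<bar>kappa p (left_walk (\<lambda>i. X i \<omega>) n) - real n * drift p \<mu>\<bar> \<ge> real n * t)
        \<le> 2 * exp (- (real n * t\<^sup>2 / (32 * (kappa_supp p \<mu> + real_of_ereal (frak_c p \<nu>))\<^sup>2))))"
proof -
  interpret horofunction_walk p \<delta> \<mu> \<nu>
    by unfold_locales fact+
  show ?thesis
    unfolding drift_eq \<c>_def[symmetric] busemann_cocycle_def
  proof (intro conjI allI impI)
    show "frak_c p \<nu> < \<infinity>" by (rule frak_c_finite)
    fix t :: real and n :: nat assume t: "t > 0"
    let ?b = "2 * exp (- (real n * t\<^sup>2 / (32 * (\<kappa>S + \<c>)\<^sup>2)))"
    have "\<P>(\<omega> in P. \<bar>\<xi> (inv (left_walk (\<lambda>i. X i \<omega>) n) p) - real n * mean_drift\<bar> \<ge> real n * t) \<le> ?b"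
      if "\<xi> \<in> horo_compactification p" for \<xi>
      using prob_left_walk_le[OF steps, of n "{L. \<bar>\<xi> (inv L p) - real n * mean_drift\<bar> \<ge> real n * t}"]
        cocycle_tail[OF _ t, of \<xi> n] that by (simp add: space_nu)
    moreover have "horo_compactification p \<noteq> {}" using horo_in_compactification by blast
    ultimately show "(SUP \<xi>\<in>horo_compactification p.
        \<P>(\<omega> in P. \<bar>\<xi> (inv (left_walk (\<lambda>i. X i \<omega>) n) p) - real n * mean_drift\<bar> \<ge> real n * t)) \<le> ?b"
      by (intro cSUP_least)
    show "\<P>(\<omega> in P. \<bar>kappa p (left_walk (\<lambda>i. X i \<omega>) n) - real n * mean_drift\<bar> \<ge> real n * t) \<le> ?b"
      using prob_left_walk_le[OF steps, of n "{L. \<bar>kappa p L - real n * mean_drift\<bar> \<ge> real n * t}"]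
        kappa_tail[OF t, of n] by simp
  qed
qed


end
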